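(* Let $\Sigma$ be a smooth fan with $n$ rays and let $\mathcal B=\{b_1,\dots,b_r\}\subset\operatorname{Sym}(E)$ be a (not necessarily linear) Khovanskii basis for a toric vector bundle over $Y(\Sigma)$ with general fiber $E$. Then the set of diagrams $\Delta(\Sigma,\operatorname{Trop}_\star(I_{\mathcal B}))\subset\mathbb Q^{n\times r}$ is the support of a polyhedral fan.
   Context: $\mathbf k$ is algebraically closed, $\Sigma$ a smooth fan with rays $\varrho_1,\dots,\varrho_n$ and primitive generators $\rho_1,\dots,\rho_n$, $E$ a finite-dimensional vector space. $\mathcal B$ is a finite set of nonzero homogeneous elements generating $\operatorname{Sym}(E)$ (so its elements of degree 1, the linear part of $\mathcal B$, span $E$). $I_{\mathcal B}\subset\mathbf k[x_1,\dots,x_r]$ is the ideal of relations among $\mathcal B$ ($x_j\mapsto b_j$), and $L_{\mathcal B}$ is the linear ideal of relations among the linear part of $\mathcal B$. A toric vector bundle with fiber $E$ over the base point corresponds to a valuation $\mathfrak v:\operatorname{Sym}(E)\to\mathcal O_\Sigma$ into integral piecewise linear functions on $|\Sigma|$ such that for each $\sigma\in\Sigma$ some basis $\mathcal B_\sigma$ of $E$ has monomials forming a basis of $\operatorname{Sym}(E)$ adapted to $\mathfrak v|_\sigma$ (the value of a linear combination is the minimum of the values of the terms), with $\mathfrak v(b)|_\sigma$ linear for $b\in\mathcal B_\sigma$. $\mathcal B$ is a Khovanskii basis if for all $\rho\in|\Sigma|$ its classes generate the associated graded algebra of $f\mapsto\mathfrak v(f)(\rho)$. For a presentation $p:\mathbf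 k[x]\to\operatorname{Sym}(E)$ by a generating set and a weight $w$, the weight quasivaluation is $\mathfrak v_w(f)=\max\{\min\{\langle w,\alpha\rangle:c_\alpha\neq0\}:p(\sum c_\alpha x^\alpha)=f\}$. A point $w\in\operatorname{Trop}(L_{\mathcal B})$ defines a weight valuation $\mathfrak v_w$ on $\operatorname{Sym}(E)$ via the linear part of $\mathcal B$; $\operatorname{Trop}_\star(I_{\mathcal B})\subset\operatorname{Trop}(I_{\mathcal B})\subset\mathbb Q^r$ is the set of all points $(\mathfrak v_w(b_1),\dots,\mathfrak v_w(b_r))$, $w\in\operatorname{Trop}(L_{\mathcal B})$. $\operatorname{GF}(I_{\mathcal B})$ is the Gröbner fan in $\mathbb Q^r$ (initial forms are terms of minimal weight), and $\mathcal K(I_{\mathcal B})\subset\operatorname{GF}(I_{\mathcal B})$ the subfan supported on $\{(\mathfrak v_w(b_1),\dots,\mathfrak v_w(b_r)):w\in\mathbb Q^r\}$, with $\mathfrak v_w$ the weight quasivaluation via $\mathcal B$. An apartment is $\mathcal K(I_{\mathcal B})\cap\tau$ for a maximal cone $\tau$ of $\operatorname{GF}(I_{\mathcal B})$. A matrix with rows $w_1,\dots,w_n$ is adapted to $\Sigma$ if for each $\sigma\in\Sigma$ the rows $w_i$ with $\varrho_i\in\sigma(1)$ lie in a common apartment. $\Delta(\Sigma,\operatorname{Trop}_\star(I_{\mathcal B}))$ is the set of matrices in $\operatorname{Trop}_\star(I_{\mathcal B})^n\subset\mathbb Q^{n\times r}$ adapted to $\Sigma$. *)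

theory Defs
  imports "HOL-Library.Poly_Mapping" "HOL-Computational_Algebra.Polynomial"
begin

section \<open>Rational polyhedral geometry\<close>

text \<open>For a finite index set \<open>I\<close>, the space $\mathbb{Q}^I$ is the set of functions vanishing
  outside \<open>I\<close>; $\mathbb{Q}^r$ is the case \<open>I = {..<r}\<close>, and $\mathbb{Q}^{n \times r}$ the case
  \<open>I = {..<n} \<times> {..<r}\<close>. All indices start at 0.\<close>

definition qspace :: "'i set \<Rightarrow> ('i \<Rightarrow> rat) set" where
  "qspace I = {x. \<forall>i. i \<notin> I \<longrightarrow> x i = 0}"

definition qdot :: "'i set \<Rightarrow> ('i \<Rightarrow> rat) \<Rightarrow> ('i \<Rightarrow> rat) \<Rightarrow> rat" where
  "qdot I u x = (\<Sum>i\<in>I. u i * x i)"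

definition qclosure :: "'i set \<Rightarrow> ('i \<Rightarrow> rat) set \<Rightarrow> ('i \<Rightarrow> rat) set" where
  "qclosure I A = {x \<in> qspace I. \<forall>e>0. \<exists>y\<in>A. \<forall>i\<in>I. \<bar>x i - y i\<bar> < e}"

definition polyhedral_cone :: "'i set \<Rightarrow> ('i \<Rightarrow> rat) set \<Rightarrow> bool" where
  "polyhedral_cone I C \<longleftrightarrow>
     (\<exists>A. finite A \<and> A \<subseteq> qspace I \<and> C = {x \<in> qspace I. \<forall>u\<in>A. 0 \<le> qdot I u x})"

definition cone_face :: "'i set \<Rightarrow> ('i \<Rightarrow> rat) set \<Rightarrow> ('i \<Rightarrow> rat) set \<Rightarrow> bool" where
  "cone_face I F C \<longleftrightarrow>
     (\<exists>u\<in>qspace I. (\<forall>x\<in>C. 0 \<le> qdot I u x) \<and> F = {x \<in> C. qdot I u x = 0})"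

text \<open>Cones of a polyhedral fan are not required to be pointed.\<close>

definition polyhedral_fan :: "'i set \<Rightarrow> ('i \<Rightarrow> rat) set set \<Rightarrow> bool" where
  "polyhedral_fan I \<F> \<longleftrightarrow> finite \<F> \<and>
     (\<forall>C\<in>\<F>. polyhedral_cone I C) \<and>
     (\<forall>C\<in>\<F>. \<forall>F. cone_face I F C \<longrightarrow> F \<in> \<F>) \<and>
     (\<forall>C\<in>\<F>. \<forall>D\<in>\<F>. cone_face I (C \<inter> D) C \<and> cone_face I (C \<inter> D) D)"

section \<open>Smooth fans\<close>

definition int_lattice :: "nat \<Rightarrow> (nat \<Rightarrow> rat) set" where
  "int_lattice d = {x \<in> qspace {..<d}. \<forall>i. x i \<in> \<int>}"

definition lattice_basis :: "nat \<Rightarrow> (nat \<Rightarrow> rat) set \<Rightarrow> bool" where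
  "lattice_basis d U \<longleftrightarrow> finite U \<and> U \<subseteq> int_lattice d \<and>
     (\<forall>x\<in>int_lattice d. \<exists>!c :: (nat \<Rightarrow> rat) \<Rightarrow> int.
        (\<forall>u. u \<notin> U \<longrightarrow> c u = 0) \<and> x = (\<lambda>i. \<Sum>u\<in>U. of_int (c u) * u i))"

definition cone_gen :: "('i \<Rightarrow> rat) set \<Rightarrow> ('i \<Rightarrow> rat) set" where
  "cone_gen S = {(\<lambda>i. \<Sum>u\<in>S. t u * u i) | t. \<forall>u\<in>S. 0 \<le> t u}"

definition smooth_fan :: "nat \<Rightarrow> (nat \<Rightarrow> rat) set set \<Rightarrow> bool" where
  "smooth_fan d \<Sigma> \<longleftrightarrow> polyhedral_fan {..<d} \<Sigma> \<and>
     (\<forall>\<sigma>\<in>\<Sigma>. \<exists>U S. lattice_basis d U \<and> S \<subseteq> U \<and> \<sigma> = cone_gen S)"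

definition primitive_vector :: "nat \<Rightarrow> (nat \<Rightarrow> rat) \<Rightarrow> bool" where
  "primitive_vector d u \<longleftrightarrow> u \<in> int_lattice d \<and> u \<noteq> (\<lambda>_. 0) \<and>
     (\<forall>k::nat. \<forall>y\<in>int_lattice d. u = (\<lambda>i. of_nat k * y i) \<longrightarrow> k = 1)"

definition primitive_ray_generators :: "nat \<Rightarrow> (nat \<Rightarrow> rat) set set \<Rightarrow> (nat \<Rightarrow> rat) set" where
  "primitive_ray_generators d \<Sigma> = {u. primitive_vector d u \<and> cone_gen {u} \<in> \<Sigma>}"

text \<open>Linearity is required only on the cones of some refinement of \<open>\<Sigma>\<close> (so that minima of
  such functions are again of this kind). Values outside the support are irrelevant.\<close>

definition integral_PL :: "nat \<Rightarrow> (nat \<Rightarrow> rat) set set \<Rightarrow> ((nat \<Rightarrow> rat) \<Rightarrow> rat) \<Rightarrow> bool" where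
  "integral_PL d \<Sigma> \<phi> \<longleftrightarrow>
     (\<exists>\<Sigma>'. polyhedral_fan {..<d} \<Sigma>' \<and> \<Union>\<Sigma>' = \<Union>\<Sigma> \<and>
       (\<forall>\<tau>\<in>\<Sigma>'. \<exists>m\<in>int_lattice d. \<forall>x\<in>\<tau>. \<phi> x = qdot {..<d} m x))"

section \<open>Polynomials and initial ideals\<close>

text \<open>The polynomial ring with variables indexed by \<open>X\<close> is realised inside
  \<open>('x \<Rightarrow>\<^sub>0 nat) \<Rightarrow>\<^sub>0 'k\<close>, a finitely supported map from exponent vectors to coefficients.\<close>

definition poly_ring :: "'x set \<Rightarrow> (('x \<Rightarrow>\<^sub>0 nat) \<Rightarrow>\<^sub>0 'k::comm_ring_1) set" where
  "poly_ring X = {P. \<forall>\<alpha>\<in>Poly_Mapping.keys P. Poly_Mapping.keys \<alpha> \<subseteq> X}"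

definition monomial_val :: "('x \<Rightarrow> 'a::comm_monoid_mult) \<Rightarrow> ('x \<Rightarrow>\<^sub>0 nat) \<Rightarrow> 'a" where
  "monomial_val g \<alpha> = (\<Prod>i\<in>Poly_Mapping.keys \<alpha>. g i ^ Poly_Mapping.lookup \<alpha> i)"

definition poly_val ::
  "('k \<Rightarrow> 'a \<Rightarrow> 'a) \<Rightarrow> ('x \<Rightarrow> 'a) \<Rightarrow> (('x \<Rightarrow>\<^sub>0 nat) \<Rightarrow>\<^sub>0 'k::comm_ring_1) \<Rightarrow> 'a::comm_ring_1" where
  "poly_val scale g P =
     (\<Sum>\<alpha>\<in>Poly_Mapping.keys P. scale (Poly_Mapping.lookup P \<alpha>) (monomial_val g \<alpha>))"

definition relation_ideal ::
  "('k \<Rightarrow> 'a \<Rightarrow> 'a) \<Rightarrow> 'x set \<Rightarrow> ('x \<Rightarrow> 'a::comm_ring_1) \<Rightarrow> (('x \<Rightarrow>\<^sub>0 nat) \<Rightarrow>\<^sub>0 'k::comm_ring_1) set" where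
  "relation_ideal scale X g = {P \<in> poly_ring X. poly_val scale g P = 0}"

definition ideal_generated :: "'a::comm_ring_1 set \<Rightarrow> 'a set \<Rightarrow> 'a set" where
  "ideal_generated R A =
     {(\<Sum>a\<in>A'. q a * a) | A' q. finite A' \<and> A' \<subseteq> A \<and> (\<forall>a\<in>A'. q a \<in> R)}"

definition weight :: "('x \<Rightarrow> rat) \<Rightarrow> ('x \<Rightarrow>\<^sub>0 nat) \<Rightarrow> rat" where
  "weight w \<alpha> = (\<Sum>i\<in>Poly_Mapping.keys \<alpha>. w i * of_nat (Poly_Mapping.lookup \<alpha> i))"

definition min_weight :: "('x \<Rightarrow> rat) \<Rightarrow> (('x \<Rightarrow>\<^sub>0 nat) \<Rightarrow>\<^sub>0 'k::comm_ring_1) \<Rightarrow> rat" where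
  "min_weight w P = Min (weight w ` Poly_Mapping.keys P)"

definition initial_form ::
  "('x \<Rightarrow> rat) \<Rightarrow> (('x \<Rightarrow>\<^sub>0 nat) \<Rightarrow>\<^sub>0 'k::comm_ring_1) \<Rightarrow> (('x \<Rightarrow>\<^sub>0 nat) \<Rightarrow>\<^sub>0 'k)" where
  "initial_form w P =
     (\<Sum>\<alpha>\<in>{\<alpha> \<in> Poly_Mapping.keys P. weight w \<alpha> = min_weight w P}.
        Poly_Mapping.single \<alpha> (Poly_Mapping.lookup P \<alpha>))"

definition initial_ideal ::
  "'x set \<Rightarrow> (('x \<Rightarrow>\<^sub>0 nat) \<Rightarrow>\<^sub>0 'k::comm_ring_1) set \<Rightarrow> ('x \<Rightarrow> rat) \<Rightarrow>
     (('x \<Rightarrow>\<^sub>0 nat) \<Rightarrow>\<^sub>0 'k) set" where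
  "initial_ideal X J w = ideal_generated (poly_ring X) (initial_form w ` J)"

definition Trop ::
  "'x set \<Rightarrow> (('x \<Rightarrow>\<^sub>0 nat) \<Rightarrow>\<^sub>0 'k::comm_ring_1) set \<Rightarrow> ('x \<Rightarrow> rat) set" where
  "Trop X J = {w \<in> qspace X.
     \<forall>\<alpha>. Poly_Mapping.keys \<alpha> \<subseteq> X \<longrightarrow> Poly_Mapping.single \<alpha> 1 \<notin> initial_ideal X J w}"

text \<open>The cones of the Groebner fan are the closures of the classes of weights with equal
  initial ideal.\<close>

definition Groebner_fan ::
  "'x set \<Rightarrow> (('x \<Rightarrow>\<^sub>0 nat) \<Rightarrow>\<^sub>0 'k::comm_ring_1) set \<Rightarrow> ('x \<Rightarrow> rat) set set" where
  "Groebner_fan X J =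
     (\<lambda>w. qclosure X {w' \<in> qspace X. initial_ideal X J w' = initial_ideal X J w}) ` qspace X"

definition maximal_cones :: "'a set set \<Rightarrow> 'a set set" where
  "maximal_cones \<F> = {C \<in> \<F>. \<forall>D\<in>\<F>. C \<subseteq> D \<longrightarrow> C = D}"

section \<open>Symmetric algebras\<close>

definition basis_of :: "('k::field \<Rightarrow> 's \<Rightarrow> 's) \<Rightarrow> 's::comm_ring_1 set \<Rightarrow> 's set \<Rightarrow> bool" where
  "basis_of scale E U \<longleftrightarrow>
     finite U \<and> \<not> module.dependent scale U \<and> module.span scale U = E"

text \<open>A variable for each element of \<open>U\<close>, evaluated at that element: every element of the
  algebra is a unique linear combination of monomials in \<open>U\<close>.\<close>

definition monomials_form_basis :: "('k::field \<Rightarrow> 's \<Rightarrow> 's) \<Rightarrow> 's::comm_ring_1 set \<Rightarrow> bool" where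
  "monomials_form_basis scale U \<longleftrightarrow>
     bij_betw (poly_val scale (\<lambda>u. u)) (poly_ring U :: (('s \<Rightarrow>\<^sub>0 nat) \<Rightarrow>\<^sub>0 'k) set) UNIV"

text \<open>The whole type \<open>'s\<close> is the symmetric algebra of its finite-dimensional subspace \<open>E\<close>
  (its degree-one part): it is the polynomial ring on a basis of \<open>E\<close>.\<close>

locale symmetric_algebra = vector_space scale
  for scale :: "'k::field \<Rightarrow> 's::comm_ring_1 \<Rightarrow> 's" +
  fixes E :: "'s set"
  assumes scale_mult: "scale c (x * y) = scale c x * y"
    and free_on_basis: "\<exists>U. basis_of scale E U \<and> monomials_form_basis scale U"

definition sym_power :: "('k::field \<Rightarrow> 's \<Rightarrow> 's) \<Rightarrow> 's::comm_ring_1 set \<Rightarrow> nat \<Rightarrow> 's set" where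
  "sym_power scale E m =
     module.span scale {prod_list xs | xs. length xs = m \<and> set xs \<subseteq> E}"

definition homogeneous_generators ::
  "('k::field \<Rightarrow> 's \<Rightarrow> 's) \<Rightarrow> 's::comm_ring_1 set \<Rightarrow> nat \<Rightarrow> (nat \<Rightarrow> 's) \<Rightarrow> bool" where
  "homogeneous_generators scale E r b \<longleftrightarrow>
     inj_on b {..<r} \<and>
     (\<forall>j<r. b j \<noteq> 0 \<and> (\<exists>m. b j \<in> sym_power scale E m)) \<and>
     (\<forall>f. \<exists>P\<in>poly_ring {..<r}. poly_val scale b P = f)"

section \<open>Toric vector bundles and Khovanskii bases\<close>

text \<open>A valuation with values in piecewise linear functions. The convention that 0 has value
  $\infty$ is encoded by never referring to \<open>v 0\<close>.\<close>

definition PL_valuation ::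
  "('k::field \<Rightarrow> 's \<Rightarrow> 's) \<Rightarrow> nat \<Rightarrow> (nat \<Rightarrow> rat) set set \<Rightarrow>
     ('s::comm_ring_1 \<Rightarrow> (nat \<Rightarrow> rat) \<Rightarrow> rat) \<Rightarrow> bool" where
  "PL_valuation scale d \<Sigma> v \<longleftrightarrow>
     (\<forall>f. f \<noteq> 0 \<longrightarrow> integral_PL d \<Sigma> (v f)) \<and>
     (\<forall>x\<in>\<Union>\<Sigma>.
        (\<forall>f g. f \<noteq> 0 \<longrightarrow> g \<noteq> 0 \<longrightarrow> v (f * g) x = v f x + v g x) \<and>
        (\<forall>f g. f \<noteq> 0 \<longrightarrow> g \<noteq> 0 \<longrightarrow> f + g \<noteq> 0 \<longrightarrow> min (v f x) (v g x) \<le> v (f + g) x) \<and>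
        (\<forall>c f. c \<noteq> 0 \<longrightarrow> f \<noteq> 0 \<longrightarrow> v (scale c f) x = v f x))"

definition toric_vector_bundle ::
  "('k::field \<Rightarrow> 's \<Rightarrow> 's) \<Rightarrow> 's set \<Rightarrow> nat \<Rightarrow> (nat \<Rightarrow> rat) set set \<Rightarrow>
     ('s::comm_ring_1 \<Rightarrow> (nat \<Rightarrow> rat) \<Rightarrow> rat) \<Rightarrow> bool" where
  "toric_vector_bundle scale E d \<Sigma> v \<longleftrightarrow> PL_valuation scale d \<Sigma> v \<and>
     (\<forall>\<sigma>\<in>\<Sigma>. \<exists>U. basis_of scale E U \<and> monomials_form_basis scale U \<and>
        (\<forall>P\<in>poly_ring U. P \<noteq> 0 \<longrightarrow> (\<forall>x\<in>\<sigma>.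
           v (poly_val scale (\<lambda>u. u) P) x =
             Min ((\<lambda>\<alpha>. v (monomial_val (\<lambda>u. u) \<alpha>) x) ` Poly_Mapping.keys P))) \<and>
        (\<forall>u\<in>U. \<exists>m\<in>qspace {..<d}. \<forall>x\<in>\<sigma>. v u x = qdot {..<d} m x))"

text \<open>The associated graded algebra of the valuation \<open>f \<mapsto> v f x\<close> is the direct sum over all
  rational \<open>a\<close> of the quotients $F_{\ge a}/F_{>a}$. It is presented as the quotient of
  \<open>gr_numerator v x\<close>, the sum of all $F_{\ge a} t^a$, by its ideal \<open>gr_denominator v x\<close>, the sum
  of all $F_{>a} t^a$; both are subsets of the monoid algebra \<open>rat \<Rightarrow>\<^sub>0 's\<close>. The class of
  \<open>f \<noteq> 0\<close> is represented by $f t^{v(f)(x)}$.\<close>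

definition gr_numerator ::
  "('s::comm_ring_1 \<Rightarrow> (nat \<Rightarrow> rat) \<Rightarrow> rat) \<Rightarrow> (nat \<Rightarrow> rat) \<Rightarrow> (rat \<Rightarrow>\<^sub>0 's) set" where
  "gr_numerator v x = {F. \<forall>a\<in>Poly_Mapping.keys F. a \<le> v (Poly_Mapping.lookup F a) x}"

definition gr_denominator ::
  "('s::comm_ring_1 \<Rightarrow> (nat \<Rightarrow> rat) \<Rightarrow> rat) \<Rightarrow> (nat \<Rightarrow> rat) \<Rightarrow> (rat \<Rightarrow>\<^sub>0 's) set" where
  "gr_denominator v x = {F. \<forall>a\<in>Poly_Mapping.keys F. a < v (Poly_Mapping.lookup F a) x}"

definition gr_class ::
  "('s::comm_ring_1 \<Rightarrow> (nat \<Rightarrow> rat) \<Rightarrow> rat) \<Rightarrow> (nat \<Rightarrow> rat) \<Rightarrow> 's \<Rightarrow> (rat \<Rightarrow>\<^sub>0 's)" where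
  "gr_class v x f = Poly_Mapping.single (v f x) f"

definition Khovanskii_basis ::
  "('k::field \<Rightarrow> 's \<Rightarrow> 's) \<Rightarrow> (nat \<Rightarrow> rat) set set \<Rightarrow>
     ('s::comm_ring_1 \<Rightarrow> (nat \<Rightarrow> rat) \<Rightarrow> rat) \<Rightarrow> nat \<Rightarrow> (nat \<Rightarrow> 's) \<Rightarrow> bool" where
  "Khovanskii_basis scale \<Sigma> v r b \<longleftrightarrow>
     (\<forall>x\<in>\<Union>\<Sigma>. \<forall>F\<in>gr_numerator v x. \<exists>P\<in>poly_ring {..<r}.
        F - poly_val (\<lambda>c. Poly_Mapping.map (scale c)) (\<lambda>j. gr_class v x (b j)) P
          \<in> gr_denominator v x)"

section \<open>Weight quasivaluations and diagrams\<close>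

text \<open>\<open>has_weight_value scale X g w f m\<close>: for the presentation sending the variable \<open>j \<in> X\<close> to
  \<open>g j\<close>, the maximum defining the weight quasivaluation of \<open>f \<noteq> 0\<close> exists and equals \<open>m\<close>.\<close>

definition has_weight_value ::
  "('k::field \<Rightarrow> 's \<Rightarrow> 's) \<Rightarrow> 'x set \<Rightarrow> ('x \<Rightarrow> 's::comm_ring_1) \<Rightarrow> ('x \<Rightarrow> rat) \<Rightarrow> 's \<Rightarrow> rat \<Rightarrow> bool"
where
  "has_weight_value scale X g w f m \<longleftrightarrow>
     (\<exists>P\<in>poly_ring X. P \<noteq> 0 \<and> poly_val scale g P = f \<and> min_weight w P = m) \<and>
     (\<forall>P\<in>poly_ring X. P \<noteq> 0 \<and> poly_val scale g P = f \<longrightarrow> min_weight w P \<le> m)"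

definition linear_part :: "'s set \<Rightarrow> nat \<Rightarrow> (nat \<Rightarrow> 's) \<Rightarrow> nat set" where
  "linear_part E r b = {j. j < r \<and> b j \<in> E}"

definition Trop_star ::
  "('k::field \<Rightarrow> 's \<Rightarrow> 's) \<Rightarrow> 's set \<Rightarrow> nat \<Rightarrow> (nat \<Rightarrow> 's::comm_ring_1) \<Rightarrow> (nat \<Rightarrow> rat) set" where
  "Trop_star scale E r b = {y \<in> qspace {..<r}.
     \<exists>w\<in>Trop (linear_part E r b) (relation_ideal scale (linear_part E r b) b).
       \<forall>j<r. has_weight_value scale (linear_part E r b) b w (b j) (y j)}"

text \<open>The support of the fan $\mathcal{K}(I_{\mathcal{B}})$.\<close>

definition K_support ::
  "('k::field \<Rightarrow> 's \<Rightarrow> 's) \<Rightarrow> nat \<Rightarrow> (nat \<Rightarrow> 's::comm_ring_1) \<Rightarrow> (nat \<Rightarrow> rat) set" where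
  "K_support scale r b = {y \<in> qspace {..<r}.
     \<exists>w\<in>qspace {..<r}. \<forall>j<r. has_weight_value scale {..<r} b w (b j) (y j)}"

definition apartments ::
  "('k::field \<Rightarrow> 's \<Rightarrow> 's) \<Rightarrow> nat \<Rightarrow> (nat \<Rightarrow> 's::comm_ring_1) \<Rightarrow> (nat \<Rightarrow> rat) set set" where
  "apartments scale r b =
     (\<lambda>\<tau>. K_support scale r b \<inter> \<tau>) `
       maximal_cones (Groebner_fan {..<r} (relation_ideal scale {..<r} b))"

definition mat_row :: "(nat \<times> nat \<Rightarrow> rat) \<Rightarrow> nat \<Rightarrow> nat \<Rightarrow> rat" where
  "mat_row M i = (\<lambda>j. M (i, j))"

definition adapted_matrix ::
  "('k::field \<Rightarrow> 's \<Rightarrow> 's) \<Rightarrow> nat \<Rightarrow> (nat \<Rightarrow> rat) set set \<Rightarrow> nat \<Rightarrow> (nat \<Rightarrow> nat \<Rightarrow> rat) \<Rightarrow>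
     nat \<Rightarrow> (nat \<Rightarrow> 's::comm_ring_1) \<Rightarrow> (nat \<times> nat \<Rightarrow> rat) \<Rightarrow> bool" where
  "adapted_matrix scale d \<Sigma> n \<rho> r b M \<longleftrightarrow>
     (\<forall>\<sigma>\<in>\<Sigma>. \<exists>A\<in>apartments scale r b.
        \<forall>i<n. cone_face {..<d} (cone_gen {\<rho> i}) \<sigma> \<longrightarrow> mat_row M i \<in> A)"

definition diagrams ::
  "('k::field \<Rightarrow> 's \<Rightarrow> 's) \<Rightarrow> 's set \<Rightarrow> nat \<Rightarrow> (nat \<Rightarrow> rat) set set \<Rightarrow> nat \<Rightarrow>
     (nat \<Rightarrow> nat \<Rightarrow> rat) \<Rightarrow> nat \<Rightarrow> (nat \<Rightarrow> 's::comm_ring_1) \<Rightarrow> (nat \<times> nat \<Rightarrow> rat) set" where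
  "diagrams scale E d \<Sigma> n \<rho> r b = {M \<in> qspace ({..<n} \<times> {..<r}).
     (\<forall>i<n. mat_row M i \<in> Trop_star scale E r b) \<and> adapted_matrix scale d \<Sigma> n \<rho> r b M}"

end

theory Submission
  imports Defs "HOL-Library.Product_Lexorder"
begin

text \<open>
  The point is that membership of a matrix \<open>M\<close> in the set of diagrams depends only on which of
  finitely many rational linear forms are nonnegative at \<open>M\<close>, and depends on it monotonically: if
  \<open>M\<close> is a diagram and every form that is nonnegative at \<open>M\<close> is nonnegative at \<open>N\<close>, then \<open>N\<close> is a
  diagram. Such a set (\<open>union_of_halfspace_cones\<close>) is a union of closed cells of a central hyperplane
  arrangement, and these cells form a polyhedral fan
  (\<open>union_of_halfspace_cones_is_fan_support\<close>). The property passes from sets of rows to sets of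
  matrices defined by conditions on the rows, so it has to be shown for \<open>Trop_star\<close> and, with a
  common finite set of forms, for all apartments.

  Three facts provide it. First, if membership in a set is determined by the signs of
  finitely many forms, then the closure of the set has the property (\<open>qclosure_sign_determined\<close>).

  Second, for every ideal of a polynomial ring in finitely many variables the signs of finitely many
  forms on \<open>w\<close> determine the initial ideal at \<open>w\<close> (\<open>initial_ideal_sign_determined\<close>). Constants
  among the generators produce relations that are not homogeneous for any positive grading, so the
  ideal is filtered by total degree. In degree at most \<open>d\<close>, the span
  of the initial forms depends only on the signs of the differences of monomials of degree at
  most \<open>d\<close>. If no finite set of signs sufficed for all \<open>d\<close>, one could choose a decreasing sequence of
  sets of weights, none of which is settled by finitely many signs, such that
  the spans up to degree \<open>d\<close> are constant on the set number \<open>d + 1\<close>. By Dickson's lemma the leading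
  monomials of the limiting spans are generated in some degree \<open>D\<close>, and a dimension
  count then shows that the spans of all degrees are constant on the set number \<open>D + 1\<close>,
  a contradiction. As a consequence, closures of Groebner classes, and sets of weights
  at which prescribed monomials stay out of the initial ideal, have the property. Tropical varieties
  are of the second kind, and so is the support of \<open>\<K>\<close>, which consists of the \<open>y\<close> at which no
  variable lies in the initial ideal (\<open>K_support_iff\<close>): a weight vector of the form
  \<open>(\<v>\<^sub>w(b\<^sub>1), \<dots>, \<v>\<^sub>w(b\<^sub>r))\<close> reproduces itself as its own vector of weight values.

  Third, a point \<open>w\<close> of the tropical linear space is recovered from its weight values, because
  \<open>\<v>\<^sub>w(b\<^sub>j) = w\<^sub>j\<close> on the linear part (\<open>Trop_weight_value\<close>). So \<open>Trop_star\<close> consists of the \<open>y\<close> whose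
  restriction \<open>w\<close> to the linear part is tropical and which satisfy \<open>\<v>\<^sub>w(b\<^sub>j) = y\<^sub>j\<close> for all \<open>j\<close>, and no
  projection of polyhedral sets is involved. Since \<open>b\<^sub>j\<close> is homogeneous, only monomials of its
  degree matter for \<open>\<v>\<^sub>w(b\<^sub>j)\<close> (\<open>has_weight_value_iff_homogeneous_supports\<close>), which makes the last
  equations conditions on finitely many linear forms.
\<close>

section \<open>Fans supported on unions of half-space cones\<close>

lemma qdot_add_scaled: "qdot I u (\<lambda>i. x i + t * y i) = qdot I u x + t * qdot I u y"
  unfolding qdot_def by (simp add: algebra_simps sum.distrib sum_distrib_left)

lemma qdot_uminus_left: "qdot I (\<lambda>i. - u i) x = - qdot I u x"
  unfolding qdot_def by (simp add: sum_negf)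

lemma qdot_sum_left: "qdot I (\<lambda>i. \<Sum>u\<in>A. u i) x = (\<Sum>u\<in>A. qdot I u x)"
  unfolding qdot_def by (simp add: sum_distrib_right) (rule sum.swap)

lemma qspace_add_scaled: "x \<in> qspace I \<Longrightarrow> y \<in> qspace I \<Longrightarrow> (\<lambda>i. x i + t * y i) \<in> qspace I"
  by (simp add: qspace_def)

definition negation_closure :: "('i \<Rightarrow> rat) set \<Rightarrow> ('i \<Rightarrow> rat) set" where
  "negation_closure A = A \<union> (\<lambda>u i. - u i) ` A"

lemma negation_closureE:
  assumes "u \<in> negation_closure A"
  obtains "u \<in> A" | u' where "u' \<in> A" "u = (\<lambda>i. - u' i)"
  using assms unfolding negation_closure_def by auto

lemma uminus_in_negation_closure:
  "u \<in> negation_closure A \<Longrightarrow> (\<lambda>i. - u i) \<in> negation_closure A"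
  by (erule negation_closureE) (auto simp: negation_closure_def)

lemma negation_closure_mono: "A \<subseteq> B \<Longrightarrow> negation_closure A \<subseteq> negation_closure B"
  unfolding negation_closure_def by blast

lemma finite_negation_closure: "finite A \<Longrightarrow> finite (negation_closure A)"
  by (simp add: negation_closure_def)

lemma negation_closure_qspace: "A \<subseteq> qspace I \<Longrightarrow> negation_closure A \<subseteq> qspace I"
  by (auto simp: negation_closure_def qspace_def)

text \<open>Equivalently, \<open>S\<close> is a union of intersections of half-spaces \<open>0 \<le> qdot I u x\<close> with \<open>u \<in> A\<close>.
  The monotone form used here makes the stability under intersections, unions and linear
  substitutions immediate, and it survives enlarging \<open>A\<close>.\<close>
definition union_of_halfspace_cones :: "'i set \<Rightarrow> ('i \<Rightarrow> rat) set \<Rightarrow> ('i \<Rightarrow> rat) set \<Rightarrow> bool" where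
  "union_of_halfspace_cones I A S \<longleftrightarrow> S \<subseteq> qspace I \<and>
     (\<forall>y\<in>S. \<forall>x\<in>qspace I. (\<forall>u\<in>A. 0 \<le> qdot I u y \<longrightarrow> 0 \<le> qdot I u x) \<longrightarrow> x \<in> S)"

lemma union_of_halfspace_conesD:
  assumes "union_of_halfspace_cones I A S" "y \<in> S" "x \<in> qspace I"
    and "\<And>u. u \<in> A \<Longrightarrow> 0 \<le> qdot I u y \<Longrightarrow> 0 \<le> qdot I u x"
  shows "x \<in> S"
  using assms unfolding union_of_halfspace_cones_def by blast

lemma union_of_halfspace_cones_mono:
  "union_of_halfspace_cones I A S \<Longrightarrow> A \<subseteq> B \<Longrightarrow> union_of_halfspace_cones I B S"
  unfolding union_of_halfspace_cones_def by blast

lemma small_step_keeps_positive: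
  assumes "finite A" "\<And>u. u \<in> A \<Longrightarrow> 0 < qdot I u z"
  obtains t where "0 < t" "\<And>u. u \<in> A \<Longrightarrow> 0 < qdot I u (\<lambda>i. z i + t * x i)"
    "\<And>u. u \<in> A \<Longrightarrow> 0 < qdot I u (\<lambda>i. z i - t * x i)"
proof -
  have "\<exists>t>0. \<forall>u\<in>A. t * \<bar>qdot I u x\<bar> < qdot I u z"
    using assms
  proof (induction A rule: finite_induct)
    case empty
    show ?case by (auto intro: exI[of _ 1])
  next
    case (insert a A)
    then obtain t where t: "t > 0" "\<forall>u\<in>A. t * \<bar>qdot I u x\<bar> < qdot I u z" by auto
    define s where "s = qdot I a z / (\<bar>qdot I a x\<bar> + 1)"
    have pa: "0 < qdot I a z" using insert.prems by simp
    have s: "0 < s" unfolding s_def using pa by (intro divide_pos_pos) auto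
    have "s * (\<bar>qdot I a x\<bar> + 1) = qdot I a z"
      unfolding s_def by (simp add: add_nonneg_eq_0_iff)
    hence s2: "s * \<bar>qdot I a x\<bar> < qdot I a z" using s by (simp add: algebra_simps)
    have le: "min s t * \<bar>c\<bar> \<le> s * \<bar>c\<bar>" "min s t * \<bar>c\<bar> \<le> t * \<bar>c\<bar>" for c :: rat
      by (auto intro!: mult_right_mono)
    show ?case
    proof (intro exI[of _ "min s t"] conjI ballI)
      show "0 < min s t" using s t by simp
      fix u assume u: "u \<in> insert a A"
      show "min s t * \<bar>qdot I u x\<bar> < qdot I u z"
        using u s2 t(2) le[of "qdot I u x"] by (auto intro: le_less_trans)
    qed
  qed
  then obtain t where t: "t > 0" "\<And>u. u \<in> A \<Longrightarrow> t * \<bar>qdot I u x\<bar> < qdot I u z" by auto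
  have ab: "- (t * \<bar>c\<bar>) \<le> t * c" "t * c \<le> t * \<bar>c\<bar>" for c
    using t(1) by (auto simp: abs_if mult_less_0_iff)
  show ?thesis
  proof
    show "0 < t" by fact
    fix u assume u: "u \<in> A"
    show "0 < qdot I u (\<lambda>i. z i + t * x i)"
      using t(2)[OF u] ab[of "qdot I u x"] unfolding qdot_add_scaled by linarith
    have "qdot I u (\<lambda>i. z i - t * x i) = qdot I u z - t * qdot I u x"
      using qdot_add_scaled[of I u z "-t" x] by simp
    thus "0 < qdot I u (\<lambda>i. z i - t * x i)"
      using t(2)[OF u] ab[of "qdot I u x"] by linarith
  qed
qed

text \<open>For \<open>A\<close> closed under negation this is the smallest closed cell of the arrangement of the
  hyperplanes orthogonal to \<open>A\<close> that contains \<open>y\<close>.\<close>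
definition halfspace_cell :: "'i set \<Rightarrow> ('i \<Rightarrow> rat) set \<Rightarrow> ('i \<Rightarrow> rat) \<Rightarrow> ('i \<Rightarrow> rat) set" where
  "halfspace_cell I A y = {x \<in> qspace I. \<forall>u\<in>A. 0 \<le> qdot I u y \<longrightarrow> 0 \<le> qdot I u x}"

lemma polyhedral_cone_halfspace_cell:
  assumes "finite A" "A \<subseteq> qspace I"
  shows "polyhedral_cone I (halfspace_cell I A y)"
  unfolding polyhedral_cone_def halfspace_cell_def
  by (rule exI[of _ "{u \<in> A. 0 \<le> qdot I u y}"]) (use assms in auto)

text \<open>The intersection is cut out of the first cell by the forms that are nonnegative at \<open>y\<close> and
  nonpositive at \<open>y'\<close>. All of them are nonnegative on the first cell, so their sum is a supporting
  functional which vanishes exactly where each of them does.\<close>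
lemma cone_face_halfspace_cell_Int:
  assumes "finite A" "A \<subseteq> qspace I" and sym: "negation_closure A \<subseteq> A"
  shows "cone_face I (halfspace_cell I A y \<inter> halfspace_cell I A y') (halfspace_cell I A y)"
proof -
  define T where "T = {u \<in> A. 0 \<le> qdot I u y \<and> qdot I u y' \<le> 0}"
  define v where "v = (\<lambda>i. \<Sum>u\<in>T. u i)"
  have finT: "finite T" using assms(1) by (simp add: T_def)
  have neg: "(\<lambda>i. - u i) \<in> A" if "u \<in> A" for u
    using sym that unfolding negation_closure_def by blast
  have nonneg: "0 \<le> qdot I u x" if "x \<in> halfspace_cell I A y" "u \<in> T" for x u
    using that by (auto simp: halfspace_cell_def T_def)
  have zero_iff: "qdot I v x = 0 \<longleftrightarrow> (\<forall>u\<in>T. qdot I u x = 0)" if "x \<in> halfspace_cell I A y" for x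
    unfolding v_def qdot_sum_left by (rule sum_nonneg_eq_0_iff[OF finT]) (rule nonneg[OF that])
  show ?thesis
    unfolding cone_face_def
  proof (intro bexI[of _ v] conjI ballI)
    show "v \<in> qspace I" using assms(2) by (auto simp: v_def qspace_def T_def intro!: sum.neutral)
    show "0 \<le> qdot I v x" if "x \<in> halfspace_cell I A y" for x
      unfolding v_def qdot_sum_left using nonneg[OF that] by (rule sum_nonneg)
    show "halfspace_cell I A y \<inter> halfspace_cell I A y' =
      {x \<in> halfspace_cell I A y. qdot I v x = 0}"
    proof (intro equalityI subsetI)
      fix x assume x: "x \<in> halfspace_cell I A y \<inter> halfspace_cell I A y'"
      have "qdot I u x = 0" if u: "u \<in> T" for u
      proof -
        have "0 \<le> qdot I u x" using x nonneg u by blast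
        moreover have "0 \<le> qdot I (\<lambda>i. - u i) x"
          using x u neg[of u] by (auto simp: halfspace_cell_def T_def qdot_uminus_left)
        ultimately show ?thesis by (simp add: qdot_uminus_left)
      qed
      thus "x \<in> {x \<in> halfspace_cell I A y. qdot I v x = 0}" using x zero_iff by auto
    next
      fix x assume x: "x \<in> {x \<in> halfspace_cell I A y. qdot I v x = 0}"
      hence xT: "qdot I u x = 0" if "u \<in> T" for u using zero_iff that by blast
      have "0 \<le> qdot I u x" if u: "u \<in> A" "0 \<le> qdot I u y'" for u
      proof (cases "0 \<le> qdot I u y")
        case True
        thus ?thesis using x u by (auto simp: halfspace_cell_def)
      next
        case False
        hence "(\<lambda>i. - u i) \<in> T" using u neg[of u] by (auto simp: T_def qdot_uminus_left)
        from xT[OF this] show ?thesis by (simp add: qdot_uminus_left)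
      qed
      thus "x \<in> halfspace_cell I A y \<inter> halfspace_cell I A y'"
        using x by (auto simp: halfspace_cell_def)
    qed
  qed
qed

text \<open>A face is convex, so it contains a point \<open>z\<close> at which as many as possible of the forms defining
  the cell are positive. This \<open>z\<close> lies in the relative interior of the face, and the face
  is the cell of \<open>z\<close>: a point \<open>x\<close> of that cell can be subtracted from \<open>z\<close> in a small amount without
  leaving the cell of \<open>y\<close>, so the supporting functional cannot be positive at \<open>x\<close>.\<close>
lemma cone_face_of_halfspace_cell:
  assumes "finite A" and sym: "negation_closure A \<subseteq> A"
    and face: "cone_face I F (halfspace_cell I A y)"
  obtains z where "z \<in> halfspace_cell I A y" "F = halfspace_cell I A z"
proof -
  obtain v where v: "v \<in> qspace I" "\<And>x. x \<in> halfspace_cell I A y \<Longrightarrow> 0 \<le> qdot I v x"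
    and F: "F = {x \<in> halfspace_cell I A y. qdot I v x = 0}"
    using face unfolding cone_face_def by auto
  define B where "B = {u \<in> A. 0 \<le> qdot I u y}"
  define P where "P z = {u \<in> B. 0 < qdot I u z}" for z
  have finB: "finite B" using assms(1) by (simp add: B_def)
  have neg: "(\<lambda>i. - u i) \<in> A" if "u \<in> A" for u
    using sym that unfolding negation_closure_def by blast
  have cell_iff: "x \<in> halfspace_cell I A y \<longleftrightarrow> x \<in> qspace I \<and> (\<forall>u\<in>B. 0 \<le> qdot I u x)" for x
    by (auto simp: halfspace_cell_def B_def)
  have F0: "(\<lambda>_. 0) \<in> F"
    by (auto simp: F halfspace_cell_def qspace_def qdot_def)
  have Pcard: "card (P z) \<le> card B" for z
    unfolding P_def by (rule card_mono) (use finB in auto)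
  obtain z where zF: "z \<in> F" and zmax: "\<And>x. x \<in> F \<Longrightarrow> card (P x) \<le> card (P z)"
    using ex_has_greatest_nat[of "\<lambda>z. z \<in> F", OF F0, of "\<lambda>z. card (P z)" "Suc (card B)"] Pcard
    by (auto simp: less_Suc_eq_le)
  have Psub: "P x \<subseteq> P z" if x: "x \<in> F" for x
  proof -
    have xz: "x \<in> halfspace_cell I A y" "z \<in> halfspace_cell I A y"
      "qdot I v x = 0" "qdot I v z = 0" using x zF by (auto simp: F)
    \<comment> \<open>the form of \<open>qdot_add_scaled\<close> with scalar 1\<close>
    define s where "s = (\<lambda>i. x i + 1 * z i)"
    have q: "qdot I u s = qdot I u x + qdot I u z" for u
      unfolding s_def qdot_add_scaled by simp
    have sF: "s \<in> F"
      using xz qspace_add_scaled[of x I z 1] unfolding F cell_iff s_def[symmetric] by (auto simp: q)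
    have sup: "P x \<union> P z \<subseteq> P s"
      using xz unfolding cell_iff P_def q by (auto intro: add_pos_nonneg add_nonneg_pos)
    have "P s = P z"
      using card_seteq[of "P s" "P z"] sup zmax[OF sF] finB by (simp add: P_def)
    thus ?thesis using sup by blast
  qed
  have zc: "z \<in> halfspace_cell I A y" "qdot I v z = 0" using zF by (auto simp: F)
  have "F = halfspace_cell I A z"
  proof (intro equalityI subsetI)
    fix x assume x: "x \<in> F"
    hence xc: "x \<in> halfspace_cell I A y" by (simp add: F)
    have "0 \<le> qdot I u x" if u: "u \<in> A" "0 \<le> qdot I u z" for u
    proof (cases "u \<in> B")
      case True
      thus ?thesis using xc by (auto simp: cell_iff)
    next
      case False
      hence uB: "(\<lambda>i. - u i) \<in> B" using u neg[OF u(1)] by (auto simp: B_def qdot_uminus_left)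
      hence "(\<lambda>i. - u i) \<notin> P x" using u Psub[OF x] by (auto simp: P_def qdot_uminus_left)
      thus ?thesis using uB by (auto simp: P_def qdot_uminus_left)
    qed
    thus "x \<in> halfspace_cell I A z" using xc by (auto simp: halfspace_cell_def)
  next
    fix x assume x: "x \<in> halfspace_cell I A z"
    have "0 \<le> qdot I u x" if "u \<in> B" for u
    proof -
      have "u \<in> A" "0 \<le> qdot I u z" using that zc(1) by (auto simp: cell_iff B_def)
      thus ?thesis using x by (auto simp: halfspace_cell_def)
    qed
    hence xc: "x \<in> halfspace_cell I A y"
      using x unfolding cell_iff by (simp add: halfspace_cell_def)
    obtain t where t: "0 < t" "\<And>u. u \<in> P z \<Longrightarrow> 0 < qdot I u (\<lambda>i. z i - t * x i)"
    proof (rule small_step_keeps_positive[of "P z" I z x])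
      show "finite (P z)" using finB by (simp add: P_def)
      show "0 < qdot I u z" if "u \<in> P z" for u using that by (simp add: P_def)
    qed blast
    define s where "s = (\<lambda>i. z i + (- t) * x i)"
    have q: "qdot I u s = qdot I u z - t * qdot I u x" for u
      unfolding s_def qdot_add_scaled by simp
    have "0 \<le> qdot I u s" if u: "u \<in> B" for u
    proof (cases "u \<in> P z")
      case True
      thus ?thesis using t(2)[OF True] by (simp add: s_def)
    next
      case False
      hence z0: "qdot I u z = 0" using u zc(1) by (auto simp: P_def cell_iff)
      hence "0 \<le> qdot I (\<lambda>i. - u i) x"
        using x u neg[of u] by (auto simp: halfspace_cell_def B_def qdot_uminus_left)
      thus ?thesis using z0 t(1) by (simp add: q qdot_uminus_left mult_nonneg_nonpos)
    qed
    moreover have "s \<in> qspace I"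
      unfolding s_def by (rule qspace_add_scaled) (use x zc in \<open>auto simp: halfspace_cell_def\<close>)
    ultimately have "0 \<le> qdot I v s" using v(2) by (auto simp: cell_iff)
    hence "qdot I v x \<le> 0" using t(1) zc(2) by (simp add: q mult_le_0_iff)
    thus "x \<in> F" using xc v(2)[OF xc] by (simp add: F)
  qed
  thus ?thesis using that zc by blast
qed

theorem union_of_halfspace_cones_is_fan_support:
  assumes "finite A" "A \<subseteq> qspace I" "union_of_halfspace_cones I A S"
  shows "\<exists>\<F>. polyhedral_fan I \<F> \<and> \<Union>\<F> = S"
proof -
  define B where "B = negation_closure A"
  have B: "finite B" "B \<subseteq> qspace I" "negation_closure B \<subseteq> B"
    unfolding B_def using finite_negation_closure[OF assms(1)] negation_closure_qspace[OF assms(2)]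
      uminus_in_negation_closure[of _ A]
    by (simp, simp, simp add: negation_closure_def[of "negation_closure A"] image_subset_iff)
  have S: "union_of_halfspace_cones I B S"
    using assms(3) by (rule union_of_halfspace_cones_mono) (auto simp: B_def negation_closure_def)
  hence SI: "S \<subseteq> qspace I" by (simp add: union_of_halfspace_cones_def)
  have cellS: "halfspace_cell I B y \<subseteq> S" if "y \<in> S" for y
    using union_of_halfspace_conesD[OF S that] by (auto simp: halfspace_cell_def)
  define \<F> where "\<F> = halfspace_cell I B ` S"
  have "\<F> \<subseteq> (\<lambda>T. {x \<in> qspace I. \<forall>u\<in>T. 0 \<le> qdot I u x}) ` Pow B"
  proof
    fix C assume "C \<in> \<F>"
    then obtain y where "C = halfspace_cell I B y" by (auto simp: \<F>_def)
    hence "C = {x \<in> qspace I. \<forall>u\<in>{u \<in> B. 0 \<le> qdot I u y}. 0 \<le> qdot I u x}"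
      by (auto simp: halfspace_cell_def)
    thus "C \<in> (\<lambda>T. {x \<in> qspace I. \<forall>u\<in>T. 0 \<le> qdot I u x}) ` Pow B" by blast
  qed
  hence "finite \<F>" using B(1) by (meson finite_Pow_iff finite_imageI finite_subset)
  moreover have "F \<in> \<F>" if C: "C \<in> \<F>" "cone_face I F C" for C F
  proof -
    obtain y where y: "y \<in> S" "C = halfspace_cell I B y" using C by (auto simp: \<F>_def)
    then obtain z where "z \<in> C" "F = halfspace_cell I B z"
      using cone_face_of_halfspace_cell[OF B(1,3)] C(2) by metis
    thus ?thesis using cellS[OF y(1)] y(2) by (auto simp: \<F>_def)
  qed
  moreover have "cone_face I (C \<inter> D) C \<and> cone_face I (C \<inter> D) D"
    if CD: "C \<in> \<F>" "D \<in> \<F>" for C D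
  proof -
    obtain y y' where "C = halfspace_cell I B y" "D = halfspace_cell I B y'"
      using CD unfolding \<F>_def by (elim imageE)
    thus ?thesis
      using cone_face_halfspace_cell_Int[OF B, of y y'] cone_face_halfspace_cell_Int[OF B, of y' y]
      by (simp only: Int_commute[of "halfspace_cell I B y'"] simp_thms)
  qed
  moreover have "polyhedral_cone I C" if "C \<in> \<F>" for C
    using that polyhedral_cone_halfspace_cell[OF B(1,2)] by (auto simp: \<F>_def)
  ultimately have "polyhedral_fan I \<F>"
    unfolding polyhedral_fan_def by blast
  moreover have "\<Union>\<F> = S"
    using cellS SI by (auto simp: \<F>_def halfspace_cell_def)
  ultimately show ?thesis by blast
qed

section \<open>Closures of sets determined by signs\<close>

definition sign_determined :: "'i set \<Rightarrow> ('i \<Rightarrow> rat) set \<Rightarrow> ('i \<Rightarrow> rat) set \<Rightarrow> bool" where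
  "sign_determined I A S \<longleftrightarrow> S \<subseteq> qspace I \<and>
     (\<forall>y\<in>S. \<forall>x\<in>qspace I. (\<forall>u\<in>A. sgn (qdot I u x) = sgn (qdot I u y)) \<longrightarrow> x \<in> S)"

text \<open>Finitely many strict linear inequalities define an open neighbourhood of \<open>x\<close>.\<close>
lemma qclosure_pos_witness:
  assumes "x \<in> qclosure I S" "finite A" "\<And>u. u \<in> A \<Longrightarrow> 0 < qdot I u x"
  obtains z where "z \<in> S" "\<And>u. u \<in> A \<Longrightarrow> 0 < qdot I u z"
proof -
  have "\<exists>e>0. \<forall>z. (\<forall>i\<in>I. \<bar>x i - z i\<bar> < e) \<longrightarrow> (\<forall>u\<in>A. 0 < qdot I u z)"
    using assms(2,3)
  proof (induction A rule: finite_induct)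
    case empty
    show ?case by (auto intro: exI[of _ 1])
  next
    case (insert a A)
    then obtain e where e: "e > 0"
      "\<And>z. (\<forall>i\<in>I. \<bar>x i - z i\<bar> < e) \<Longrightarrow> (\<forall>u\<in>A. 0 < qdot I u z)" by auto
    \<comment> \<open>a bound for the norm of \<open>a\<close>; adding 1 keeps it positive\<close>
    define K where "K = (\<Sum>i\<in>I. \<bar>a i\<bar>) + 1"
    have K: "K > 0" unfolding K_def by (simp add: add_nonneg_pos sum_nonneg)
    have pa: "0 < qdot I a x" using insert.prems by simp
    define e' where "e' = min e (qdot I a x / K)"
    have e': "e' > 0" unfolding e'_def using e(1) pa K by simp
    show ?case
    proof (intro exI[of _ e'] conjI allI impI)
      fix z assume z: "\<forall>i\<in>I. \<bar>x i - z i\<bar> < e'"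
      have "qdot I a x - qdot I a z = (\<Sum>i\<in>I. a i * (x i - z i))"
        unfolding qdot_def by (simp add: algebra_simps sum_subtractf)
      also have "\<dots> \<le> (\<Sum>i\<in>I. \<bar>a i\<bar> * e')"
      proof (rule sum_mono)
        fix i assume "i \<in> I"
        have "a i * (x i - z i) \<le> \<bar>a i\<bar> * \<bar>x i - z i\<bar>"
          by (simp add: abs_mult[symmetric])
        also have "\<dots> \<le> \<bar>a i\<bar> * e'"
          using z \<open>i \<in> I\<close> by (intro mult_left_mono) (auto intro: less_imp_le)
        finally show "a i * (x i - z i) \<le> \<bar>a i\<bar> * e'" .
      qed
      also have "\<dots> < K * e'" using e' by (simp add: K_def sum_distrib_left[symmetric] sum_distrib_right[symmetric] algebra_simps)
      also have "\<dots> \<le> K * (qdot I a x / K)"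
        by (rule mult_left_mono) (use K in \<open>auto simp: e'_def\<close>)
      also have "\<dots> = qdot I a x" using K by simp
      finally have "0 < qdot I a z" by simp
      moreover have "\<forall>u\<in>A. 0 < qdot I u z"
        by (rule e(2)) (use z in \<open>auto simp: e'_def\<close>)
      ultimately show "\<forall>u\<in>insert a A. 0 < qdot I u z" by simp
    qed (rule e')
  qed
  then obtain e where "e > 0" "\<And>z. (\<forall>i\<in>I. \<bar>x i - z i\<bar> < e) \<Longrightarrow> (\<forall>u\<in>A. 0 < qdot I u z)" by blast
  moreover from this(1) obtain z where "z \<in> S" "\<forall>i\<in>I. \<bar>x i - z i\<bar> < e"
    using assms(1) unfolding qclosure_def by blast
  ultimately show ?thesis using that by blast
qed

text \<open>Let \<open>y\<close> be in the closure and let \<open>x\<close> satisfy all weak inequalities that hold at \<open>y\<close>. A point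
  \<open>z\<close> of \<open>S\<close> close to \<open>y\<close> has the signs of \<open>y\<close> wherever these are not zero. Hence every point
  \<open>x + t z\<close> with \<open>t > 0\<close> has the signs of \<open>z\<close>, so it belongs to \<open>S\<close>, and it tends to \<open>x\<close>.\<close>
theorem qclosure_sign_determined:
  assumes "finite I" "finite A" "sign_determined I A S"
  shows "union_of_halfspace_cones I (negation_closure A) (qclosure I S)"
  unfolding union_of_halfspace_cones_def
proof (intro conjI ballI impI)
  show "qclosure I S \<subseteq> qspace I" by (auto simp: qclosure_def)
  fix y x
  assume y: "y \<in> qclosure I S" and x: "x \<in> qspace I"
    and spec: "\<forall>u\<in>negation_closure A. 0 \<le> qdot I u y \<longrightarrow> 0 \<le> qdot I u x"
  obtain z where zS: "z \<in> S"
    and zpos: "\<And>u. u \<in> {u \<in> negation_closure A. 0 < qdot I u y} \<Longrightarrow> 0 < qdot I u z"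
    by (rule qclosure_pos_witness[OF y, of "{u \<in> negation_closure A. 0 < qdot I u y}"])
      (use assms finite_negation_closure[OF assms(2)] in auto)
  have zI: "z \<in> qspace I" using zS assms(3) by (auto simp: sign_determined_def)
  have weak: "0 \<le> qdot I u x" if u: "u \<in> negation_closure A" "0 \<le> qdot I u z" for u
  proof -
    have "\<not> 0 < qdot I (\<lambda>i. - u i) y"
      using zpos[of "\<lambda>i. - u i"] uminus_in_negation_closure[OF u(1)] u(2)
      by (auto simp: qdot_uminus_left)
    thus ?thesis using spec u(1) by (auto simp: qdot_uminus_left)
  qed
  have near: "(\<lambda>i. x i + t * z i) \<in> S" if "t > 0" for t
  proof -
    have "sgn (qdot I u (\<lambda>i. x i + t * z i)) = sgn (qdot I u z)" if u: "u \<in> A" for u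
    proof -
      have uu: "u \<in> negation_closure A" "(\<lambda>i. - u i) \<in> negation_closure A"
        using u by (auto simp: negation_closure_def)
      consider "qdot I u z > 0" | "qdot I u z = 0" | "qdot I u z < 0" by linarith
      thus ?thesis
      proof cases
        case 1
        thus ?thesis using weak[OF uu(1)] \<open>t > 0\<close>
          by (simp add: qdot_add_scaled add_nonneg_pos)
      next
        case 2
        thus ?thesis using weak[OF uu(1)] weak[OF uu(2)] by (simp add: qdot_add_scaled qdot_uminus_left)
      next
        case 3
        hence "qdot I u x \<le> 0" using weak[OF uu(2)] by (simp add: qdot_uminus_left)
        moreover have "t * qdot I u z < 0" using 3 \<open>t > 0\<close> by (simp add: mult_less_0_iff)
        ultimately show ?thesis using 3 by (simp add: qdot_add_scaled add_nonpos_neg)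
      qed
    qed
    thus ?thesis using assms(3) zS qspace_add_scaled[OF x zI] unfolding sign_determined_def by blast
  qed
  show "x \<in> qclosure I S"
    unfolding qclosure_def
  proof (intro CollectI conjI allI impI)
    fix e :: rat assume e: "e > 0"
    \<comment> \<open>a step of length \<open>e / K\<close> along \<open>z\<close> changes every coordinate by less than \<open>e\<close>\<close>
    define K where "K = (\<Sum>i\<in>I. \<bar>z i\<bar>) + 1"
    have K: "K > 0" unfolding K_def by (simp add: add_nonneg_pos sum_nonneg)
    have "\<bar>x i - (x i + e / K * z i)\<bar> < e" if i: "i \<in> I" for i
    proof -
      have "\<bar>z i\<bar> < K"
        using member_le_sum[OF i, of "\<lambda>i. \<bar>z i\<bar>"] assms(1) by (simp add: K_def)
      hence "e / K * \<bar>z i\<bar> < e / K * K" using e K by (intro mult_strict_left_mono) auto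
      thus ?thesis using e K by (simp add: abs_mult)
    qed
    thus "\<exists>y\<in>S. \<forall>i\<in>I. \<bar>x i - y i\<bar> < e"
      using near[of "e / K"] e K by (intro bexI[of _ "\<lambda>i. x i + e / K * z i"]) auto
  qed (rule x)
qed

section \<open>Dickson's lemma\<close>

text \<open>A decreasing sequence of natural numbers is eventually constant.\<close>
lemma monotone_subsequence_nat:
  fixes g :: "nat \<Rightarrow> nat"
  obtains \<psi> where "strict_mono \<psi>" "incseq (g \<circ> \<psi>)"
proof -
  obtain \<phi> where \<phi>: "strict_mono \<phi>" "monoseq (\<lambda>n. g (\<phi> n))" using seq_monosub by blast
  show ?thesis
  proof (cases "incseq (\<lambda>n. g (\<phi> n))")
    case True
    thus ?thesis using that \<phi>(1) by (simp add: comp_def)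
  next
    case False
    hence dec: "decseq (\<lambda>n. g (\<phi> n))" using \<phi>(2) by (simp add: monoseq_iff)
    obtain N where N: "\<And>n. g (\<phi> N) \<le> g (\<phi> n)"
      using ex_has_least_nat[of "\<lambda>_. True" 0 "\<lambda>n. g (\<phi> n)"] by auto
    have const: "g (\<phi> (N + n)) = g (\<phi> N)" for n
      using N[of "N + n"] decseqD[OF dec, of N "N + n"] by simp
    show ?thesis
      by (rule that[of "\<lambda>n. \<phi> (N + n)"]) (use \<phi>(1) in \<open>auto simp: strict_mono_def const incseq_def\<close>)
  qed
qed

lemma Dickson_subsequence:
  fixes h :: "nat \<Rightarrow> 'i \<Rightarrow> nat"
  assumes "finite X"
  shows "\<exists>\<phi>. strict_mono \<phi> \<and> (\<forall>i\<in>X. incseq (\<lambda>n. h (\<phi> n) i))"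
  using assms
proof (induction X rule: finite_induct)
  case empty
  show ?case by (auto intro: exI[of _ id] simp: strict_mono_def)
next
  case (insert x X)
  then obtain \<phi> where \<phi>: "strict_mono \<phi>" "\<forall>i\<in>X. incseq (\<lambda>n. h (\<phi> n) i)" by blast
  obtain \<psi> where \<psi>: "strict_mono \<psi>" "incseq ((\<lambda>n. h (\<phi> n) x) \<circ> \<psi>)"
    by (rule monotone_subsequence_nat)
  have "incseq (\<lambda>n. h (\<phi> (\<psi> n)) i)" if "i \<in> insert x X" for i
    using that \<phi>(2) \<psi> strict_mono_mono[OF \<psi>(1)] by (auto simp: incseq_def mono_def)
  thus ?case using \<phi>(1) \<psi>(1) by (intro exI[of _ "\<phi> \<circ> \<psi>"]) (auto simp: strict_mono_def)
qed

text \<open>If no finite subset of \<open>S\<close> dominates \<open>S\<close> from below, then choosing again and again an element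
  that is not above any earlier one gives a sequence without an increasing pair, which
  contradicts \<open>Dickson_subsequence\<close>. The map \<open>h\<close> assigns exponent vectors to arbitrary labels.\<close>
lemma Dickson:
  fixes h :: "'a \<Rightarrow> 'i \<Rightarrow> nat"
  assumes "finite X"
  shows "\<exists>F. finite F \<and> F \<subseteq> S \<and> (\<forall>s\<in>S. \<exists>t\<in>F. \<forall>i\<in>X. h t i \<le> h s i)"
proof (rule ccontr)
  assume contra: "\<not> ?thesis"
  define pick where "pick F = (SOME s. s \<in> S \<and> \<not> (\<exists>t\<in>F. \<forall>i\<in>X. h t i \<le> h s i))" for F
  have pick: "pick F \<in> S \<and> \<not> (\<exists>t\<in>F. \<forall>i\<in>X. h t i \<le> h (pick F) i)" if "finite F" "F \<subseteq> S" for F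
    unfolding pick_def by (rule someI_ex) (use contra that in blast)
  define F where "F n = ((\<lambda>F. insert (pick F) F) ^^ n) {}" for n
  have FS: "F (Suc n) = insert (pick (F n)) (F n)" for n by (simp add: F_def)
  have F: "finite (F n) \<and> F n \<subseteq> S" for n
  proof (induction n)
    case 0
    show ?case by (simp add: F_def)
  next
    case (Suc n)
    thus ?case using pick[of "F n"] by (simp add: FS)
  qed
  have mem: "pick (F m) \<in> F n" if "m < n" for m n
    using that by (induction n) (auto simp: FS less_Suc_eq)
  obtain \<phi> where \<phi>: "strict_mono \<phi>" "\<forall>i\<in>X. incseq (\<lambda>n. h (pick (F (\<phi> n))) i)"
    using Dickson_subsequence[OF assms, of "\<lambda>n. h (pick (F n))"] by blast
  have "\<forall>i\<in>X. h (pick (F (\<phi> 0))) i \<le> h (pick (F (\<phi> 1))) i"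
    using \<phi>(2) by (auto simp: incseq_def)
  moreover have "pick (F (\<phi> 0)) \<in> F (\<phi> 1)" by (rule mem) (use \<phi>(1) in \<open>auto simp: strict_mono_def\<close>)
  ultimately show False using pick[of "F (\<phi> 1)"] F by blast
qed

section \<open>Leading monomials of spaces of polynomials\<close>

lemma lookup_single_mult:
  fixes f :: "'m::cancel_comm_monoid_add \<Rightarrow>\<^sub>0 'k::semiring_0"
  shows "Poly_Mapping.lookup (Poly_Mapping.single \<gamma> c * f) (\<gamma> + \<alpha>) = c * Poly_Mapping.lookup f \<alpha>"
  by (simp add: lookup_mult lookup_single when_mult)

lemma keys_single_mult:
  fixes f :: "'m::cancel_comm_monoid_add \<Rightarrow>\<^sub>0 'k::semiring_0"
  shows "Poly_Mapping.keys (Poly_Mapping.single \<gamma> c * f) \<subseteq> (+) \<gamma> ` Poly_Mapping.keys f"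
proof -
  have "Poly_Mapping.keys (Poly_Mapping.single \<gamma> c) \<subseteq> {\<gamma>}" by simp
  thus ?thesis using keys_mult[of "Poly_Mapping.single \<gamma> c" f] by blast
qed

lemma lookup_const_mult:
  fixes f :: "'m::cancel_comm_monoid_add \<Rightarrow>\<^sub>0 'k::semiring_0"
  shows "Poly_Mapping.lookup (Poly_Mapping.single 0 c * f) \<alpha> = c * Poly_Mapping.lookup f \<alpha>"
  using lookup_single_mult[of 0 c f \<alpha>] by simp

text \<open>Multiplication by a constant polynomial as scalar multiplication: it satisfies the vector space
  axioms by the ring laws alone.\<close>
interpretation pm: vector_space
  "\<lambda>c (f :: 'm::cancel_comm_monoid_add \<Rightarrow>\<^sub>0 'k::field). Poly_Mapping.single 0 c * f"
  by unfold_locales (simp_all add: algebra_simps single_add mult_single)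

text \<open>The monomial order is given by a map \<open>\<phi>\<close> into a linear order. Two choices of \<open>\<phi>\<close> are
  compared later: the bare order on exponents, and the order by weight with ties broken by the bare
  order.\<close>
definition leading_monomials :: "('m \<Rightarrow> 'o::linorder) \<Rightarrow> ('m \<Rightarrow>\<^sub>0 'k::zero) set \<Rightarrow> 'm set" where
  "leading_monomials \<phi> V =
     {\<alpha>. \<exists>f\<in>V. \<alpha> \<in> Poly_Mapping.keys f \<and> (\<forall>\<beta>\<in>Poly_Mapping.keys f. \<phi> \<beta> \<le> \<phi> \<alpha>)}"

lemma subspace_eliminate:
  fixes f g :: "'m::cancel_comm_monoid_add \<Rightarrow>\<^sub>0 'k::field"
  assumes "pm.subspace W" "f \<in> W" "g \<in> W"
  shows "f - Poly_Mapping.single 0 c * g \<in> W"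
  using assms by (intro pm.subspace_diff pm.subspace_scale)

text \<open>Gaussian elimination: subtracting an element of \<open>V\<close> with the same leading monomial lowers the
  rank of the leading monomial of an element of \<open>W\<close>.\<close>
lemma subset_of_leading_monomials_subset:
  fixes V W :: "('m::cancel_comm_monoid_add \<Rightarrow>\<^sub>0 'k::field) set"
  assumes V: "pm.subspace V" and W: "pm.subspace W" and VW: "V \<subseteq> W"
    and M: "finite M" "\<And>f. f \<in> W \<Longrightarrow> Poly_Mapping.keys f \<subseteq> M"
    and inj: "inj_on \<phi> M"
    and leads: "leading_monomials \<phi> W \<subseteq> leading_monomials \<phi> V"
  shows "W \<subseteq> V"
proof -
  define rank where "rank \<beta> = card {\<gamma> \<in> M. \<phi> \<gamma> < \<phi> \<beta>}" for \<beta>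
  have rank_less: "rank \<alpha> < rank \<beta>" if "\<phi> \<alpha> < \<phi> \<beta>" "\<alpha> \<in> M" for \<alpha> \<beta>
    unfolding rank_def by (rule psubset_card_mono) (use that M(1) in \<open>auto intro: less_trans\<close>)
  have "f \<in> V" if "f \<in> W" "\<forall>\<beta>\<in>Poly_Mapping.keys f. rank \<beta> < n" for f n
    using that
  proof (induction n arbitrary: f)
    case 0
    hence "f = 0" by simp
    thus ?case using pm.subspace_0[OF V] by simp
  next
    case (Suc n)
    show ?case
    proof (cases "f = 0")
      case True
      thus ?thesis using pm.subspace_0[OF V] by simp
    next
      case False
      hence ne: "\<phi> ` Poly_Mapping.keys f \<noteq> {}" by simp
      have "Max (\<phi> ` Poly_Mapping.keys f) \<in> \<phi> ` Poly_Mapping.keys f"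
        by (rule Max_in) (use ne in auto)
      then obtain \<alpha> where \<alpha>: "\<alpha> \<in> Poly_Mapping.keys f" "\<phi> \<alpha> = Max (\<phi> ` Poly_Mapping.keys f)"
        by (metis imageE)
      have top: "\<phi> \<beta> \<le> \<phi> \<alpha>" if "\<beta> \<in> Poly_Mapping.keys f" for \<beta>
        using that \<alpha>(2) by simp
      have "\<alpha> \<in> leading_monomials \<phi> V"
        using leads \<alpha>(1) top Suc.prems(1) unfolding leading_monomials_def by blast
      then obtain g where g: "g \<in> V" "\<alpha> \<in> Poly_Mapping.keys g"
        "\<forall>\<beta>\<in>Poly_Mapping.keys g. \<phi> \<beta> \<le> \<phi> \<alpha>" unfolding leading_monomials_def by blast
      define c where "c = Poly_Mapping.lookup f \<alpha> / Poly_Mapping.lookup g \<alpha>"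
      define f' where "f' = f - Poly_Mapping.single 0 c * g"
      have f'W: "f' \<in> W" unfolding f'_def using W Suc.prems(1) g(1) VW by (intro subspace_eliminate) auto
      have "rank \<beta> < n" if \<beta>: "\<beta> \<in> Poly_Mapping.keys f'" for \<beta>
      proof -
        have l: "Poly_Mapping.lookup f' \<beta> = Poly_Mapping.lookup f \<beta> - c * Poly_Mapping.lookup g \<beta>"
          by (simp add: f'_def lookup_minus lookup_const_mult)
        have "Poly_Mapping.lookup f' \<alpha> = 0"
          using g(2) by (simp add: f'_def lookup_minus lookup_const_mult c_def in_keys_iff)
        hence "\<beta> \<noteq> \<alpha>" using \<beta> by (auto simp: in_keys_iff)
        moreover have "\<beta> \<in> Poly_Mapping.keys f \<or> \<beta> \<in> Poly_Mapping.keys g"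
          using \<beta> l by (auto simp: in_keys_iff)
        hence "\<phi> \<beta> \<le> \<phi> \<alpha>" using top g(3) by blast
        moreover have "\<alpha> \<in> M" "\<beta> \<in> M" using \<alpha>(1) \<beta> M(2) Suc.prems(1) f'W by blast+
        ultimately have "\<phi> \<beta> < \<phi> \<alpha>" using inj by (metis inj_onD order_le_less)
        hence "rank \<beta> < rank \<alpha>" using rank_less \<open>\<beta> \<in> M\<close> by blast
        thus ?thesis using Suc.prems(2) \<alpha>(1) by force
      qed
      hence "f' \<in> V" using Suc.IH f'W by blast
      moreover have "f = f' + Poly_Mapping.single 0 c * g" by (simp add: f'_def)
      ultimately show ?thesis using V g(1) by (simp add: pm.subspace_add pm.subspace_scale)
    qed
  qed
  moreover have "\<forall>\<beta>\<in>Poly_Mapping.keys f. rank \<beta> < Suc (card M)" for f :: "'m \<Rightarrow>\<^sub>0 'k"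
    unfolding rank_def less_Suc_eq_le by (auto intro!: card_mono M(1))
  ultimately show ?thesis by blast
qed

text \<open>Elements of \<open>V\<close> with pairwise distinct leading monomials, one for each of them, form a
  basis. In particular the number of leading monomials does not depend on the order; this is how
  dimensions of spaces with different initial forms are compared.\<close>
lemma card_leading_monomials:
  fixes V :: "('m::cancel_comm_monoid_add \<Rightarrow>\<^sub>0 'k::field) set"
  assumes V: "pm.subspace V"
    and M: "finite M" "\<And>f. f \<in> V \<Longrightarrow> Poly_Mapping.keys f \<subseteq> M"
    and inj: "inj_on \<phi> M"
  shows "card (leading_monomials \<phi> V) = pm.dim V"
proof -
  define L where "L = leading_monomials \<phi> V"
  have LM: "L \<subseteq> M" using M(2) by (auto simp: L_def leading_monomials_def)
  hence finL: "finite L" using M(1) finite_subset by blast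
  have "\<forall>\<alpha>\<in>L. \<exists>f\<in>V. \<alpha> \<in> Poly_Mapping.keys f \<and> (\<forall>\<beta>\<in>Poly_Mapping.keys f. \<phi> \<beta> \<le> \<phi> \<alpha>)"
    by (auto simp: L_def leading_monomials_def)
  then obtain F where F: "\<And>\<alpha>. \<alpha> \<in> L \<Longrightarrow> F \<alpha> \<in> V"
    "\<And>\<alpha>. \<alpha> \<in> L \<Longrightarrow> \<alpha> \<in> Poly_Mapping.keys (F \<alpha>)"
    "\<And>\<alpha> \<beta>. \<alpha> \<in> L \<Longrightarrow> \<beta> \<in> Poly_Mapping.keys (F \<alpha>) \<Longrightarrow> \<phi> \<beta> \<le> \<phi> \<alpha>" by metis
  have injF: "inj_on F L"
  proof (rule inj_onI)
    fix \<alpha> \<beta> assume *: "\<alpha> \<in> L" "\<beta> \<in> L" "F \<alpha> = F \<beta>"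
    hence "\<phi> \<alpha> = \<phi> \<beta>" using F(2,3) by (metis order_antisym)
    thus "\<alpha> = \<beta>" using inj LM * by (auto dest: inj_onD)
  qed
  have "pm.independent (F ` L)"
    unfolding pm.dependent_finite[OF finite_imageI[OF finL]]
  proof
    assume "\<exists>u. (\<exists>v\<in>F ` L. u v \<noteq> 0) \<and> (\<Sum>v\<in>F ` L. Poly_Mapping.single 0 (u v) * v) = 0"
    then obtain u where u: "\<exists>v\<in>F ` L. u v \<noteq> 0" "(\<Sum>v\<in>F ` L. Poly_Mapping.single 0 (u v) * v) = 0"
      by blast
    define K where "K = {\<alpha> \<in> L. u (F \<alpha>) \<noteq> 0}"
    have K: "finite K" "K \<noteq> {}" using finL u(1) by (auto simp: K_def)
    have "Max (\<phi> ` K) \<in> \<phi> ` K" by (rule Max_in) (use K in auto)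
    then obtain \<alpha> where \<alpha>: "\<alpha> \<in> K" "\<phi> \<alpha> = Max (\<phi> ` K)" by (metis imageE)
    have top: "\<phi> \<beta> \<le> \<phi> \<alpha>" if "\<beta> \<in> K" for \<beta> using that \<alpha>(2) K by simp
    have \<alpha>L: "\<alpha> \<in> L" "u (F \<alpha>) \<noteq> 0" using \<alpha>(1) by (auto simp: K_def)
    have "0 = Poly_Mapping.lookup (\<Sum>\<beta>\<in>L. Poly_Mapping.single 0 (u (F \<beta>)) * F \<beta>) \<alpha>"
      using u(2) by (simp add: sum.reindex[OF injF])
    also have "\<dots> = (\<Sum>\<beta>\<in>L. u (F \<beta>) * Poly_Mapping.lookup (F \<beta>) \<alpha>)"
      by (simp add: lookup_sum lookup_const_mult)
    also have "\<dots> = (\<Sum>\<beta>\<in>{\<alpha>}. u (F \<beta>) * Poly_Mapping.lookup (F \<beta>) \<alpha>)"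
    proof (rule sum.mono_neutral_right[OF finL], use \<alpha>L in simp, intro ballI)
      fix \<beta> assume \<beta>: "\<beta> \<in> L - {\<alpha>}"
      show "u (F \<beta>) * Poly_Mapping.lookup (F \<beta>) \<alpha> = 0"
      proof (rule ccontr)
        assume "\<not> ?thesis"
        hence nz: "u (F \<beta>) \<noteq> 0" "\<alpha> \<in> Poly_Mapping.keys (F \<beta>)" by (auto simp: in_keys_iff)
        hence "\<phi> \<beta> \<le> \<phi> \<alpha>" "\<phi> \<alpha> \<le> \<phi> \<beta>" using top F(3) \<beta> by (auto simp: K_def)
        hence "\<alpha> = \<beta>" using inj LM \<beta> \<alpha>L by (auto dest: inj_onD)
        thus False using \<beta> by simp
      qed
    qed
    finally show False using \<alpha>L F(2) by (auto simp: in_keys_iff)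
  qed
  moreover have "pm.span (F ` L) = V"
  proof (rule antisym)
    show sub: "pm.span (F ` L) \<subseteq> V" by (rule pm.span_minimal) (use F(1) V in auto)
    show "V \<subseteq> pm.span (F ` L)"
    proof (rule subset_of_leading_monomials_subset[OF _ V sub M inj])
      show "leading_monomials \<phi> V \<subseteq> leading_monomials \<phi> (pm.span (F ` L))"
      proof
        fix \<alpha> assume "\<alpha> \<in> leading_monomials \<phi> V"
        hence "\<alpha> \<in> L" by (simp add: L_def)
        thus "\<alpha> \<in> leading_monomials \<phi> (pm.span (F ` L))"
          unfolding leading_monomials_def using F(2,3) pm.span_base[of "F \<alpha>" "F ` L"] by blast
      qed
    qed auto
  qed
  ultimately have "pm.dim V = card (F ` L)"
    using pm.dim_eq_card[of "F ` L" V] V by (simp add: pm.span_eq_iff[THEN iffD2])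
  thus ?thesis using card_image[OF injF] by (simp add: L_def)
qed

section \<open>Weights of monomials\<close>

definition total_degree :: "('x \<Rightarrow>\<^sub>0 nat) \<Rightarrow> nat" where
  "total_degree \<alpha> = (\<Sum>i\<in>Poly_Mapping.keys \<alpha>. Poly_Mapping.lookup \<alpha> i)"

lemma total_degree_add: "total_degree (\<alpha> + \<beta>) = total_degree \<alpha> + total_degree \<beta>"
  unfolding total_degree_def by (rule setsum_keys_plus_distrib) auto

lemma weight_add: "weight w (\<alpha> + \<beta>) = weight w \<alpha> + weight w \<beta>"
  unfolding weight_def by (rule setsum_keys_plus_distrib) (auto simp: algebra_simps)

lemma keys_add_nat:
  "Poly_Mapping.keys (\<alpha> + \<beta> :: 'x \<Rightarrow>\<^sub>0 nat) = Poly_Mapping.keys \<alpha> \<union> Poly_Mapping.keys \<beta>"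
  by (auto simp: in_keys_iff lookup_add)

lemma lookup_le_total_degree: "Poly_Mapping.lookup \<alpha> i \<le> total_degree \<alpha>"
proof (cases "i \<in> Poly_Mapping.keys \<alpha>")
  case True
  thus ?thesis unfolding total_degree_def by (intro member_le_sum) auto
qed (simp add: in_keys_iff)

definition monomials_upto :: "'x set \<Rightarrow> nat \<Rightarrow> ('x \<Rightarrow>\<^sub>0 nat) set" where
  "monomials_upto X d = {\<alpha>. Poly_Mapping.keys \<alpha> \<subseteq> X \<and> total_degree \<alpha> \<le> d}"

lemma finite_monomials_upto: "finite X \<Longrightarrow> finite (monomials_upto X d)"
proof -
  assume X: "finite X"
  have "Poly_Mapping.lookup ` monomials_upto X d \<subseteq>
    {f. \<forall>x. (x \<in> X \<longrightarrow> f x \<in> {..d}) \<and> (x \<notin> X \<longrightarrow> f x = 0)}"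
  proof (intro subsetI CollectI allI)
    fix f x assume "f \<in> Poly_Mapping.lookup ` monomials_upto X d"
    then obtain \<alpha> where \<alpha>: "Poly_Mapping.keys \<alpha> \<subseteq> X" "total_degree \<alpha> \<le> d" "f = Poly_Mapping.lookup \<alpha>"
      by (auto simp: monomials_upto_def)
    moreover have "f x \<le> d" using lookup_le_total_degree[of \<alpha> x] \<alpha> by simp
    ultimately show "(x \<in> X \<longrightarrow> f x \<in> {..d}) \<and> (x \<notin> X \<longrightarrow> f x = 0)"
      by (auto simp: in_keys_iff subset_iff)
  qed
  hence "finite (Poly_Mapping.lookup ` monomials_upto X d)"
    by (rule finite_subset) (rule finite_set_of_finite_funs, use X in auto)
  thus ?thesis by (rule finite_imageD) (simp add: inj_on_def poly_mapping_eqI)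
qed

text \<open>The linear form on weights whose sign compares the weights of two monomials.\<close>
definition exponent_difference :: "('x \<Rightarrow>\<^sub>0 nat) \<Rightarrow> ('x \<Rightarrow>\<^sub>0 nat) \<Rightarrow> 'x \<Rightarrow> rat" where
  "exponent_difference \<alpha> \<beta> =
     (\<lambda>i. of_nat (Poly_Mapping.lookup \<alpha> i) - of_nat (Poly_Mapping.lookup \<beta> i))"

lemma weight_eq_sum:
  assumes "finite X" "Poly_Mapping.keys \<alpha> \<subseteq> X"
  shows "weight w \<alpha> = (\<Sum>i\<in>X. w i * of_nat (Poly_Mapping.lookup \<alpha> i))"
  unfolding weight_def using assms by (intro sum.mono_neutral_left) (auto simp: in_keys_iff)

lemma qdot_exponent_difference:
  assumes "finite X" "Poly_Mapping.keys \<alpha> \<subseteq> X" "Poly_Mapping.keys \<beta> \<subseteq> X"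
  shows "qdot X (exponent_difference \<alpha> \<beta>) w = weight w \<alpha> - weight w \<beta>"
  unfolding weight_eq_sum[OF assms(1,2)] weight_eq_sum[OF assms(1,3)]
  by (simp add: qdot_def exponent_difference_def algebra_simps sum_subtractf)

lemma exponent_difference_qspace:
  "Poly_Mapping.keys \<alpha> \<subseteq> X \<Longrightarrow> Poly_Mapping.keys \<beta> \<subseteq> X \<Longrightarrow> exponent_difference \<alpha> \<beta> \<in> qspace X"
  unfolding qspace_def exponent_difference_def
  by (auto simp: subset_iff) (metis in_keys_iff)

section \<open>Spans of initial forms\<close>

text \<open>The span of the initial forms of a linear space \<open>J\<close>, described one weight at a time: the
  part of \<open>g\<close> of weight \<open>a\<close> is the lowest part of some element of \<open>J\<close>, or zero. In this form the
  linearity is easy to see, whereas sums of initial forms of different weights are not initial forms.\<close>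
definition initial_space ::
  "('x \<Rightarrow> rat) \<Rightarrow> (('x \<Rightarrow>\<^sub>0 nat) \<Rightarrow>\<^sub>0 'k::zero) set \<Rightarrow> (('x \<Rightarrow>\<^sub>0 nat) \<Rightarrow>\<^sub>0 'k) set" where
  "initial_space w J = {g. \<forall>a. \<exists>f\<in>J. (\<forall>\<alpha>\<in>Poly_Mapping.keys f. a \<le> weight w \<alpha>) \<and>
     (\<forall>\<alpha>. weight w \<alpha> = a \<longrightarrow> Poly_Mapping.lookup f \<alpha> = Poly_Mapping.lookup g \<alpha>)}"

lemma initial_spaceE:
  assumes "g \<in> initial_space w J"
  obtains f where "f \<in> J" "\<And>\<alpha>. \<alpha> \<in> Poly_Mapping.keys f \<Longrightarrow> a \<le> weight w \<alpha>"
    "\<And>\<alpha>. weight w \<alpha> = a \<Longrightarrow> Poly_Mapping.lookup f \<alpha> = Poly_Mapping.lookup g \<alpha>"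
  using assms unfolding initial_space_def by blast

lemma initial_space_mono: "J \<subseteq> K \<Longrightarrow> initial_space w J \<subseteq> initial_space w K"
  unfolding initial_space_def by blast

lemma keys_initial_space:
  assumes "g \<in> initial_space w J" "\<And>f. f \<in> J \<Longrightarrow> Poly_Mapping.keys f \<subseteq> M"
  shows "Poly_Mapping.keys g \<subseteq> M"
proof
  fix \<alpha> assume \<alpha>: "\<alpha> \<in> Poly_Mapping.keys g"
  obtain f where "f \<in> J" "Poly_Mapping.lookup f \<alpha> = Poly_Mapping.lookup g \<alpha>"
    using initial_spaceE[OF assms(1), of "weight w \<alpha>"] by metis
  thus "\<alpha> \<in> M" using \<alpha> assms(2) by (fastforce simp: in_keys_iff)
qed

lemma lookup_initial_form:
  "Poly_Mapping.lookup (initial_form w f) \<alpha> =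
     (if \<alpha> \<in> Poly_Mapping.keys f \<and> weight w \<alpha> = min_weight w f then Poly_Mapping.lookup f \<alpha> else 0)"
  unfolding initial_form_def lookup_sum lookup_single when_def
  by (simp add: sum.delta' if_distrib cong: if_cong)

lemma min_weight_le:
  "\<alpha> \<in> Poly_Mapping.keys f \<Longrightarrow> min_weight w f \<le> weight w \<alpha>"
  unfolding min_weight_def by simp

lemma min_weight_attained:
  assumes "f \<noteq> 0"
  obtains \<alpha> where "\<alpha> \<in> Poly_Mapping.keys f" "weight w \<alpha> = min_weight w f"
proof -
  have "min_weight w f \<in> weight w ` Poly_Mapping.keys f"
    unfolding min_weight_def by (rule Min_in) (use assms in auto)
  thus ?thesis using that by (metis imageE)
qed

lemma initial_form_in_initial_space:
  assumes "f \<in> J" "0 \<in> J"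
  shows "initial_form w f \<in> initial_space w J"
  unfolding initial_space_def
proof (intro CollectI allI)
  fix a
  show "\<exists>h\<in>J. (\<forall>\<alpha>\<in>Poly_Mapping.keys h. a \<le> weight w \<alpha>) \<and>
    (\<forall>\<alpha>. weight w \<alpha> = a \<longrightarrow> Poly_Mapping.lookup h \<alpha> = Poly_Mapping.lookup (initial_form w f) \<alpha>)"
  proof (cases "a = min_weight w f")
    case True
    thus ?thesis using assms(1)
      by (intro bexI[of _ f]) (auto simp: min_weight_le lookup_initial_form in_keys_iff)
  next
    case False
    thus ?thesis using assms(2) by (intro bexI[of _ 0]) (auto simp: lookup_initial_form)
  qed
qed

lemma subspace_initial_space:
  fixes J :: "(('x \<Rightarrow>\<^sub>0 nat) \<Rightarrow>\<^sub>0 'k::field) set"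
  assumes J: "pm.subspace J"
  shows "pm.subspace (initial_space w J)"
proof (rule pm.subspaceI)
  show "0 \<in> initial_space w J"
    unfolding initial_space_def using pm.subspace_0[OF J] by (auto intro!: bexI[of _ 0])
next
  fix g h assume g: "g \<in> initial_space w J" and h: "h \<in> initial_space w J"
  show "g + h \<in> initial_space w J"
    unfolding initial_space_def
  proof (intro CollectI allI)
    fix a
    obtain f where f: "f \<in> J" "\<And>\<alpha>. \<alpha> \<in> Poly_Mapping.keys f \<Longrightarrow> a \<le> weight w \<alpha>"
      "\<And>\<alpha>. weight w \<alpha> = a \<Longrightarrow> Poly_Mapping.lookup f \<alpha> = Poly_Mapping.lookup g \<alpha>"
      using initial_spaceE[OF g, of a] by blast
    obtain f' where f': "f' \<in> J" "\<And>\<alpha>. \<alpha> \<in> Poly_Mapping.keys f' \<Longrightarrow> a \<le> weight w \<alpha>"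
      "\<And>\<alpha>. weight w \<alpha> = a \<Longrightarrow> Poly_Mapping.lookup f' \<alpha> = Poly_Mapping.lookup h \<alpha>"
      using initial_spaceE[OF h, of a] by blast
    show "\<exists>k\<in>J. (\<forall>\<alpha>\<in>Poly_Mapping.keys k. a \<le> weight w \<alpha>) \<and>
      (\<forall>\<alpha>. weight w \<alpha> = a \<longrightarrow> Poly_Mapping.lookup k \<alpha> = Poly_Mapping.lookup (g + h) \<alpha>)"
    proof (intro bexI conjI ballI allI impI)
      show "f + f' \<in> J" using J f(1) f'(1) by (rule pm.subspace_add)
      show "a \<le> weight w \<alpha>" if "\<alpha> \<in> Poly_Mapping.keys (f + f')" for \<alpha>
        using that f(2) f'(2) keys_add[of f f'] by blast
      show "Poly_Mapping.lookup (f + f') \<alpha> = Poly_Mapping.lookup (g + h) \<alpha>" if "weight w \<alpha> = a" for \<alpha>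
        using that f(3) f'(3) by (simp add: lookup_add)
    qed
  qed
next
  fix c g assume g: "g \<in> initial_space w J"
  show "Poly_Mapping.single 0 c * g \<in> initial_space w J"
    unfolding initial_space_def
  proof (intro CollectI allI)
    fix a
    obtain f where f: "f \<in> J" "\<And>\<alpha>. \<alpha> \<in> Poly_Mapping.keys f \<Longrightarrow> a \<le> weight w \<alpha>"
      "\<And>\<alpha>. weight w \<alpha> = a \<Longrightarrow> Poly_Mapping.lookup f \<alpha> = Poly_Mapping.lookup g \<alpha>"
      using initial_spaceE[OF g, of a] by blast
    show "\<exists>k\<in>J. (\<forall>\<alpha>\<in>Poly_Mapping.keys k. a \<le> weight w \<alpha>) \<and>
      (\<forall>\<alpha>. weight w \<alpha> = a \<longrightarrow>
        Poly_Mapping.lookup k \<alpha> = Poly_Mapping.lookup (Poly_Mapping.single 0 c * g) \<alpha>)"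
      using J f by (intro bexI[of _ "Poly_Mapping.single 0 c * f"])
        (auto simp: lookup_const_mult pm.subspace_scale in_keys_iff)
  qed
qed

lemma initial_space_monomial_mult:
  fixes J K :: "(('x \<Rightarrow>\<^sub>0 nat) \<Rightarrow>\<^sub>0 'k::field) set"
  assumes g: "g \<in> initial_space w J"
    and JK: "\<And>f. f \<in> J \<Longrightarrow> Poly_Mapping.single \<gamma> c * f \<in> K"
  shows "Poly_Mapping.single \<gamma> c * g \<in> initial_space w K"
  unfolding initial_space_def
proof (intro CollectI allI)
  fix a
  obtain f where f: "f \<in> J" "\<And>\<alpha>. \<alpha> \<in> Poly_Mapping.keys f \<Longrightarrow> a - weight w \<gamma> \<le> weight w \<alpha>"
    "\<And>\<alpha>. weight w \<alpha> = a - weight w \<gamma> \<Longrightarrow> Poly_Mapping.lookup f \<alpha> = Poly_Mapping.lookup g \<alpha>"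
    using initial_spaceE[OF g, of "a - weight w \<gamma>"] by blast
  show "\<exists>k\<in>K. (\<forall>\<alpha>\<in>Poly_Mapping.keys k. a \<le> weight w \<alpha>) \<and>
    (\<forall>\<alpha>. weight w \<alpha> = a \<longrightarrow>
      Poly_Mapping.lookup k \<alpha> = Poly_Mapping.lookup (Poly_Mapping.single \<gamma> c * g) \<alpha>)"
  proof (intro bexI conjI ballI allI impI)
    show "Poly_Mapping.single \<gamma> c * f \<in> K" using f(1) by (rule JK)
    show "a \<le> weight w \<alpha>" if "\<alpha> \<in> Poly_Mapping.keys (Poly_Mapping.single \<gamma> c * f)" for \<alpha>
    proof -
      obtain \<beta> where "\<beta> \<in> Poly_Mapping.keys f" "\<alpha> = \<gamma> + \<beta>"
        using \<open>\<alpha> \<in> _\<close> keys_single_mult[of \<gamma> c f] by blast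
      thus ?thesis using f(2)[of \<beta>] by (simp add: weight_add)
    qed
    show "Poly_Mapping.lookup (Poly_Mapping.single \<gamma> c * f) \<alpha> =
      Poly_Mapping.lookup (Poly_Mapping.single \<gamma> c * g) \<alpha>" if a: "weight w \<alpha> = a" for \<alpha>
    proof (cases "\<alpha> \<in> range ((+) \<gamma>)")
      case True
      then obtain \<beta> where \<beta>: "\<alpha> = \<gamma> + \<beta>" by blast
      thus ?thesis using f(3)[of \<beta>] a by (simp add: weight_add lookup_single_mult)
    next
      case False
      hence "\<alpha> \<notin> Poly_Mapping.keys (Poly_Mapping.single \<gamma> c * f)"
        "\<alpha> \<notin> Poly_Mapping.keys (Poly_Mapping.single \<gamma> c * g)"
        using keys_single_mult by blast+
      thus ?thesis by (simp add: in_keys_iff)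
    qed
  qed
qed

text \<open>Taking the initial form keeps the leading monomial for the order by weight (small
  weights lead) refined by the bare order. So the passage from \<open>J\<close> to its initial forms preserves the
  dimension of finite-dimensional spaces, by \<open>card_leading_monomials\<close>.\<close>
lemma leading_monomials_initial_space:
  fixes J :: "(('x::linorder \<Rightarrow>\<^sub>0 nat) \<Rightarrow>\<^sub>0 'k::field) set"
  assumes "0 \<in> J"
  shows "leading_monomials id (initial_space w J) = leading_monomials (\<lambda>\<alpha>. (- weight w \<alpha>, \<alpha>)) J"
proof (intro equalityI subsetI)
  fix \<alpha> assume "\<alpha> \<in> leading_monomials id (initial_space w J)"
  then obtain g where g: "g \<in> initial_space w J" "\<alpha> \<in> Poly_Mapping.keys g"
    "\<And>\<beta>. \<beta> \<in> Poly_Mapping.keys g \<Longrightarrow> \<beta> \<le> \<alpha>" by (auto simp: leading_monomials_def)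
  obtain f where f: "f \<in> J" "\<And>\<beta>. \<beta> \<in> Poly_Mapping.keys f \<Longrightarrow> weight w \<alpha> \<le> weight w \<beta>"
    "\<And>\<beta>. weight w \<beta> = weight w \<alpha> \<Longrightarrow> Poly_Mapping.lookup f \<beta> = Poly_Mapping.lookup g \<beta>"
    using initial_spaceE[OF g(1), of "weight w \<alpha>"] by blast
  have "(- weight w \<beta>, \<beta>) \<le> (- weight w \<alpha>, \<alpha>)" if \<beta>: "\<beta> \<in> Poly_Mapping.keys f" for \<beta>
    using f(2)[OF \<beta>] f(3)[of \<beta>] g(3)[of \<beta>] \<beta>
    by (cases "weight w \<beta> = weight w \<alpha>") (auto simp: in_keys_iff)
  moreover have "\<alpha> \<in> Poly_Mapping.keys f" using f(3)[of \<alpha>] g(2) by (simp add: in_keys_iff)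
  ultimately show "\<alpha> \<in> leading_monomials (\<lambda>\<alpha>. (- weight w \<alpha>, \<alpha>)) J"
    using f(1) unfolding leading_monomials_def by blast
next
  fix \<alpha> assume "\<alpha> \<in> leading_monomials (\<lambda>\<alpha>. (- weight w \<alpha>, \<alpha>)) J"
  then obtain f where f: "f \<in> J" "\<alpha> \<in> Poly_Mapping.keys f"
    "\<And>\<beta>. \<beta> \<in> Poly_Mapping.keys f \<Longrightarrow> (- weight w \<beta>, \<beta>) \<le> (- weight w \<alpha>, \<alpha>)"
    unfolding leading_monomials_def by blast
  have "weight w \<alpha> \<le> weight w \<beta>" if "\<beta> \<in> Poly_Mapping.keys f" for \<beta>
    using f(3)[OF that] by auto
  moreover obtain \<beta> where "\<beta> \<in> Poly_Mapping.keys f" "weight w \<beta> = min_weight w f"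
    using min_weight_attained[of f w] f(2) by force
  ultimately have m: "weight w \<alpha> = min_weight w f"
    using min_weight_le[OF f(2), of w] by force
  have "\<beta> \<le> \<alpha>" if "\<beta> \<in> Poly_Mapping.keys (initial_form w f)" for \<beta>
  proof -
    have "\<beta> \<in> Poly_Mapping.keys f" "weight w \<beta> = min_weight w f"
      using that by (auto simp: in_keys_iff lookup_initial_form split: if_splits)
    thus ?thesis using f(3)[of \<beta>] m by simp
  qed
  moreover have "\<alpha> \<in> Poly_Mapping.keys (initial_form w f)"
    using f(2) m by (simp add: in_keys_iff lookup_initial_form)
  ultimately show "\<alpha> \<in> leading_monomials id (initial_space w J)"
    using initial_form_in_initial_space[OF f(1) assms] by (auto simp: leading_monomials_def)
qed

text \<open>The summands are initial forms of different weights, so they are pairwise distinct and the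
  sum can be taken over a set.\<close>
lemma initial_space_sum_of_initial_forms:
  fixes J :: "(('x \<Rightarrow>\<^sub>0 nat) \<Rightarrow>\<^sub>0 'k::field) set"
  assumes g: "g \<in> initial_space w J"
  obtains N where "finite N" "N \<subseteq> initial_form w ` J" "g = \<Sum>N"
proof -
  define A where "A = weight w ` Poly_Mapping.keys g"
  have "\<forall>a\<in>A. \<exists>f\<in>J. (\<forall>\<alpha>\<in>Poly_Mapping.keys f. a \<le> weight w \<alpha>) \<and>
     (\<forall>\<alpha>. weight w \<alpha> = a \<longrightarrow> Poly_Mapping.lookup f \<alpha> = Poly_Mapping.lookup g \<alpha>)"
    using g unfolding initial_space_def by blast
  then obtain F where F: "\<And>a. a \<in> A \<Longrightarrow> F a \<in> J"
    "\<And>a \<alpha>. a \<in> A \<Longrightarrow> \<alpha> \<in> Poly_Mapping.keys (F a) \<Longrightarrow> a \<le> weight w \<alpha>"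
    "\<And>a \<alpha>. a \<in> A \<Longrightarrow> weight w \<alpha> = a \<Longrightarrow> Poly_Mapping.lookup (F a) \<alpha> = Poly_Mapping.lookup g \<alpha>"
    by metis
  have minF: "min_weight w (F a) = a" if a: "a \<in> A" for a
  proof -
    obtain \<alpha> where \<alpha>: "\<alpha> \<in> Poly_Mapping.keys g" "weight w \<alpha> = a" using a by (auto simp: A_def)
    hence k: "\<alpha> \<in> Poly_Mapping.keys (F a)" using F(3)[OF a, of \<alpha>] by (simp add: in_keys_iff)
    hence "F a \<noteq> 0" by auto
    then obtain \<beta> where "\<beta> \<in> Poly_Mapping.keys (F a)" "weight w \<beta> = min_weight w (F a)"
      by (rule min_weight_attained)
    thus ?thesis using F(2)[OF a, of \<beta>] min_weight_le[OF k, of w] \<alpha>(2) by simp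
  qed
  have inF: "Poly_Mapping.lookup (initial_form w (F a)) \<alpha> =
      (if weight w \<alpha> = a then Poly_Mapping.lookup g \<alpha> else 0)" if "a \<in> A" for a \<alpha>
    using minF[OF that] F(3)[OF that] by (auto simp: lookup_initial_form in_keys_iff)
  have "g = (\<Sum>a\<in>A. initial_form w (F a))"
  proof (rule poly_mapping_eqI)
    fix \<alpha>
    have "Poly_Mapping.lookup (\<Sum>a\<in>A. initial_form w (F a)) \<alpha> =
      (\<Sum>a\<in>A. if weight w \<alpha> = a then Poly_Mapping.lookup g \<alpha> else 0)"
      unfolding lookup_sum by (rule sum.cong) (use inF in auto)
    also have "\<dots> = (if weight w \<alpha> \<in> A then Poly_Mapping.lookup g \<alpha> else 0)"
      by (simp add: A_def)
    also have "\<dots> = Poly_Mapping.lookup g \<alpha>" by (auto simp: A_def in_keys_iff)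
    finally show "Poly_Mapping.lookup g \<alpha> = Poly_Mapping.lookup (\<Sum>a\<in>A. initial_form w (F a)) \<alpha>"
      by simp
  qed
  moreover have "inj_on (\<lambda>a. initial_form w (F a)) A"
  proof (rule inj_onI)
    fix a a' assume aa: "a \<in> A" "a' \<in> A" "initial_form w (F a) = initial_form w (F a')"
    then obtain \<alpha> where "\<alpha> \<in> Poly_Mapping.keys g" "weight w \<alpha> = a" by (auto simp: A_def)
    thus "a = a'" using inF[OF aa(1), of \<alpha>] inF[OF aa(2), of \<alpha>] aa(3)
      by (auto simp: in_keys_iff split: if_splits)
  qed
  ultimately have "g = \<Sum>((\<lambda>a. initial_form w (F a)) ` A)" by (simp add: sum.reindex)
  moreover have "finite ((\<lambda>a. initial_form w (F a)) ` A)" by (simp add: A_def)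
  moreover have "(\<lambda>a. initial_form w (F a)) ` A \<subseteq> initial_form w ` J" using F(1) by blast
  ultimately show ?thesis using that by blast
qed

section \<open>Ideals and their parts of bounded degree\<close>

lemma poly_mapping_sum_monomials:
  "P = (\<Sum>\<alpha>\<in>Poly_Mapping.keys P. Poly_Mapping.single \<alpha> (Poly_Mapping.lookup P \<alpha>))"
  by (rule poly_mapping_eqI)
    (simp add: lookup_sum lookup_single when_def in_keys_iff if_distrib cong: if_cong)

lemma poly_ring_add: "P \<in> poly_ring X \<Longrightarrow> Q \<in> poly_ring X \<Longrightarrow> P + Q \<in> poly_ring X"
  using keys_add[of P Q] by (auto simp: poly_ring_def)

lemma poly_ring_diff: "P \<in> poly_ring X \<Longrightarrow> Q \<in> poly_ring X \<Longrightarrow> P - Q \<in> poly_ring X"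
  using keys_diff[of P Q] by (force simp: poly_ring_def)

lemma poly_ring_0: "0 \<in> poly_ring X" by (simp add: poly_ring_def)

lemma poly_ring_1: "1 \<in> poly_ring X" by (simp add: poly_ring_def)

lemma poly_ring_single: "Poly_Mapping.keys \<alpha> \<subseteq> X \<Longrightarrow> Poly_Mapping.single \<alpha> c \<in> poly_ring X"
  by (simp add: poly_ring_def)

lemma poly_ring_mult: "P \<in> poly_ring X \<Longrightarrow> Q \<in> poly_ring X \<Longrightarrow> P * Q \<in> poly_ring X"
  using keys_mult[of P Q] by (fastforce simp: poly_ring_def keys_add_nat)

locale polynomial_ideal =
  fixes X :: "'x set" and J :: "(('x \<Rightarrow>\<^sub>0 nat) \<Rightarrow>\<^sub>0 'k::field) set"
  assumes sub_poly_ring: "J \<subseteq> poly_ring X"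
    and zero_mem: "0 \<in> J"
    and add_mem: "f \<in> J \<Longrightarrow> g \<in> J \<Longrightarrow> f + g \<in> J"
    and mult_mem: "P \<in> poly_ring X \<Longrightarrow> f \<in> J \<Longrightarrow> P * f \<in> J"
begin

lemma subspace: "pm.subspace J"
  by (rule pm.subspaceI) (auto intro!: zero_mem add_mem mult_mem poly_ring_single)

text \<open>The span of the initial forms is already an ideal, because multiplication by a monomial shifts
  all weights by the same amount.\<close>
lemma initial_ideal_eq_initial_space: "initial_ideal X J w = initial_space w J"
proof (intro equalityI subsetI)
  note sub = subspace_initial_space[OF subspace, of w]
  have mult: "P * g \<in> initial_space w J" if P: "P \<in> poly_ring X" and g: "g \<in> initial_space w J" for P g
  proof -
    have "P * g = (\<Sum>\<alpha>\<in>Poly_Mapping.keys P. Poly_Mapping.single \<alpha> (Poly_Mapping.lookup P \<alpha>) * g)"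
      by (subst poly_mapping_sum_monomials[of P]) (simp add: sum_distrib_right)
    also have "\<dots> \<in> initial_space w J"
    proof (intro pm.subspace_sum[OF sub] initial_space_monomial_mult[OF g] mult_mem poly_ring_single)
      show "Poly_Mapping.keys \<alpha> \<subseteq> X" if "\<alpha> \<in> Poly_Mapping.keys P" for \<alpha>
        using P that by (simp add: poly_ring_def)
    qed
    finally show ?thesis .
  qed
  fix g assume "g \<in> initial_ideal X J w"
  then obtain A q where "g = (\<Sum>a\<in>A. q a * a)" "A \<subseteq> initial_form w ` J" "\<forall>a\<in>A. q a \<in> poly_ring X"
    unfolding initial_ideal_def ideal_generated_def by blast
  thus "g \<in> initial_space w J"
    using initial_form_in_initial_space[OF _ zero_mem]
    by (auto intro!: pm.subspace_sum[OF sub] mult)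
next
  fix g assume "g \<in> initial_space w J"
  then obtain N where "finite N" "N \<subseteq> initial_form w ` J" "g = \<Sum>N"
    by (rule initial_space_sum_of_initial_forms)
  thus "g \<in> initial_ideal X J w"
    unfolding initial_ideal_def ideal_generated_def
    by (intro CollectI exI[of _ N] exI[of _ "\<lambda>_. 1"]) (simp add: poly_ring_1)
qed

text \<open>Total degree, rather than a grading, keeps these spaces finite-dimensional for ideals that are
  not homogeneous. The pair of a monomial and a degree bound plays the role of a homogenised
  monomial.\<close>
definition bounded_part :: "nat \<Rightarrow> (('x \<Rightarrow>\<^sub>0 nat) \<Rightarrow>\<^sub>0 'k) set" where
  "bounded_part d = {f \<in> J. Poly_Mapping.keys f \<subseteq> monomials_upto X d}"

definition bounded_initial_space :: "('x \<Rightarrow> rat) \<Rightarrow> nat \<Rightarrow> (('x \<Rightarrow>\<^sub>0 nat) \<Rightarrow>\<^sub>0 'k) set" where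
  "bounded_initial_space w d = initial_space w (bounded_part d)"

lemma subspace_bounded_part: "pm.subspace (bounded_part d)"
proof (rule pm.subspaceI)
  show "0 \<in> bounded_part d" by (simp add: bounded_part_def zero_mem)
  show "f + g \<in> bounded_part d" if "f \<in> bounded_part d" "g \<in> bounded_part d" for f g
    using that keys_add[of f g] by (auto simp: bounded_part_def add_mem)
  show "Poly_Mapping.single 0 c * f \<in> bounded_part d" if "f \<in> bounded_part d" for f c
    using that keys_single_mult[of 0 c f] pm.subspace_scale[OF subspace, of f c]
    by (auto simp: bounded_part_def)
qed

lemma zero_in_bounded_part: "0 \<in> bounded_part d"
  using pm.subspace_0[OF subspace_bounded_part] .

lemma subspace_bounded_initial_space: "pm.subspace (bounded_initial_space w d)"
  unfolding bounded_initial_space_def by (rule subspace_initial_space[OF subspace_bounded_part])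

lemma keys_bounded_initial_space:
  "g \<in> bounded_initial_space w d \<Longrightarrow> Poly_Mapping.keys g \<subseteq> monomials_upto X d"
  unfolding bounded_initial_space_def by (erule keys_initial_space) (simp add: bounded_part_def)

lemma bounded_part_exhausts: "f \<in> J \<Longrightarrow> \<exists>d. f \<in> bounded_part d"
proof -
  assume f: "f \<in> J"
  have "Poly_Mapping.keys f \<subseteq> monomials_upto X (\<Sum>\<alpha>\<in>Poly_Mapping.keys f. total_degree \<alpha>)"
    using f sub_poly_ring by (auto simp: monomials_upto_def poly_ring_def intro: member_le_sum)
  thus ?thesis using f by (auto simp: bounded_part_def)
qed

lemma bounded_initial_space_mult:
  assumes "g \<in> bounded_initial_space w e" "Poly_Mapping.keys \<gamma> \<subseteq> X" "e + total_degree \<gamma> \<le> d"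
  shows "Poly_Mapping.single \<gamma> c * g \<in> bounded_initial_space w d"
  using assms(1) unfolding bounded_initial_space_def
proof (rule initial_space_monomial_mult)
  fix f assume "f \<in> bounded_part e"
  thus "Poly_Mapping.single \<gamma> c * f \<in> bounded_part d"
    using keys_single_mult[of \<gamma> c f] assms(2,3)
    by (fastforce simp: bounded_part_def monomials_upto_def keys_add_nat total_degree_add
        intro: mult_mem poly_ring_single)
qed

lemma initial_ideal_cong:
  assumes "\<And>d. bounded_initial_space w d = bounded_initial_space w' d"
  shows "initial_ideal X J w = initial_ideal X J w'"
proof -
  have "initial_space v J \<subseteq> initial_space v' J"
    if eq: "\<And>d. bounded_initial_space v d = bounded_initial_space v' d" for v v'
  proof
    fix g assume "g \<in> initial_space v J"
    then obtain N where N: "finite N" "N \<subseteq> initial_form v ` J" "g = \<Sum>N"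
      by (rule initial_space_sum_of_initial_forms)
    have "initial_form v f \<in> initial_space v' J" if f: "f \<in> J" for f
    proof -
      obtain d where "f \<in> bounded_part d" using bounded_part_exhausts[OF f] by blast
      hence "initial_form v f \<in> bounded_initial_space v' d"
        unfolding eq[symmetric] unfolding bounded_initial_space_def
        by (rule initial_form_in_initial_space) (rule zero_in_bounded_part)
      thus ?thesis
        unfolding bounded_initial_space_def
        using initial_space_mono[of "bounded_part d" J] by (auto simp: bounded_part_def)
    qed
    thus "g \<in> initial_space v' J"
      using N unfolding N(3) by (intro pm.subspace_sum subspace_initial_space subspace) auto
  qed
  thus ?thesis using assms by (simp add: initial_ideal_eq_initial_space set_eq_subset)
qed

text \<open>The finitely many forms that decide all comparisons of weights in degree at most \<open>d\<close>.\<close>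
definition degree_tests :: "nat \<Rightarrow> ('x \<Rightarrow> rat) set" where
  "degree_tests d =
     (\<lambda>(\<alpha>, \<beta>). exponent_difference \<alpha> \<beta>) ` (monomials_upto X d \<times> monomials_upto X d)"

lemma degree_tests_qspace: "degree_tests d \<subseteq> qspace X"
  by (auto simp: degree_tests_def monomials_upto_def intro!: exponent_difference_qspace)

text \<open>The definition of an initial space compares weights with an arbitrary rational number \<open>a\<close>. Only
  those \<open>a\<close> that are weights of monomials of \<open>g\<close> matter, and these are compared with
  monomials of degree at most \<open>d\<close>.\<close>
lemma bounded_initial_space_sign_determined:
  assumes X: "finite X"
    and signs: "\<And>u. u \<in> degree_tests d \<Longrightarrow> sgn (qdot X u w) = sgn (qdot X u w')"
  shows "bounded_initial_space w d = bounded_initial_space w' d"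
proof -
  have "bounded_initial_space v d \<subseteq> bounded_initial_space v' d"
    if signs: "\<And>u. u \<in> degree_tests d \<Longrightarrow> sgn (qdot X u v) = sgn (qdot X u v')" for v v'
  proof
    have cmp: "sgn (weight v \<alpha> - weight v \<beta>) = sgn (weight v' \<alpha> - weight v' \<beta>)"
      if "\<alpha> \<in> monomials_upto X d" "\<beta> \<in> monomials_upto X d" for \<alpha> \<beta>
      using signs[of "exponent_difference \<alpha> \<beta>"] that
      by (auto simp: degree_tests_def qdot_exponent_difference[OF X] monomials_upto_def)
    have cmp_le: "weight v \<alpha> \<le> weight v \<beta> \<longleftrightarrow> weight v' \<alpha> \<le> weight v' \<beta>"
      and cmp_eq: "weight v \<alpha> = weight v \<beta> \<longleftrightarrow> weight v' \<alpha> = weight v' \<beta>"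
      if "\<alpha> \<in> monomials_upto X d" "\<beta> \<in> monomials_upto X d" for \<alpha> \<beta>
      using cmp[OF that] by (auto simp: sgn_if split: if_splits)
    fix g assume g: "g \<in> bounded_initial_space v d"
    note gM = keys_bounded_initial_space[OF g]
    show "g \<in> bounded_initial_space v' d"
      unfolding bounded_initial_space_def initial_space_def
    proof (intro CollectI allI)
      fix a
      show "\<exists>f\<in>bounded_part d. (\<forall>\<alpha>\<in>Poly_Mapping.keys f. a \<le> weight v' \<alpha>) \<and>
        (\<forall>\<alpha>. weight v' \<alpha> = a \<longrightarrow> Poly_Mapping.lookup f \<alpha> = Poly_Mapping.lookup g \<alpha>)"
      proof (cases "\<exists>\<alpha>\<in>Poly_Mapping.keys g. weight v' \<alpha> = a")
        case False
        thus ?thesis by (intro bexI[of _ 0]) (auto simp: zero_in_bounded_part in_keys_iff)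
      next
        case True
        then obtain \<alpha>0 where \<alpha>0: "\<alpha>0 \<in> Poly_Mapping.keys g" "weight v' \<alpha>0 = a" by blast
        have \<alpha>0M: "\<alpha>0 \<in> monomials_upto X d" using \<alpha>0 gM by blast
        obtain f where f: "f \<in> bounded_part d"
          "\<And>\<alpha>. \<alpha> \<in> Poly_Mapping.keys f \<Longrightarrow> weight v \<alpha>0 \<le> weight v \<alpha>"
          "\<And>\<alpha>. weight v \<alpha> = weight v \<alpha>0 \<Longrightarrow> Poly_Mapping.lookup f \<alpha> = Poly_Mapping.lookup g \<alpha>"
          using initial_spaceE[OF g[unfolded bounded_initial_space_def], of "weight v \<alpha>0"] by blast
        have fM: "Poly_Mapping.keys f \<subseteq> monomials_upto X d" using f(1) by (simp add: bounded_part_def)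
        show ?thesis
        proof (intro bexI[of _ f] conjI ballI allI impI)
          show "f \<in> bounded_part d" by fact
          show "a \<le> weight v' \<alpha>" if "\<alpha> \<in> Poly_Mapping.keys f" for \<alpha>
            using f(2)[OF that] cmp_le[OF \<alpha>0M, of \<alpha>] that fM \<alpha>0(2) by blast
          show "Poly_Mapping.lookup f \<alpha> = Poly_Mapping.lookup g \<alpha>" if "weight v' \<alpha> = a" for \<alpha>
          proof (cases "\<alpha> \<in> monomials_upto X d")
            case True
            thus ?thesis using f(3)[of \<alpha>] cmp_eq[OF True \<alpha>0M] that \<alpha>0(2) by simp
          next
            case False
            hence "\<alpha> \<notin> Poly_Mapping.keys f" "\<alpha> \<notin> Poly_Mapping.keys g" using fM gM by blast+
            thus ?thesis by (simp add: in_keys_iff)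
          qed
        qed
      qed
    qed
  qed
  from this[of w w'] this[of w' w] show ?thesis using signs by auto
qed

end

lemma card_leading_monomials_bounded_initial_space:
  fixes J :: "(('x::linorder \<Rightarrow>\<^sub>0 nat) \<Rightarrow>\<^sub>0 'k::field) set"
  assumes "polynomial_ideal X J" and X: "finite X"
  shows "card (leading_monomials id (polynomial_ideal.bounded_initial_space X J w d)) =
    pm.dim (polynomial_ideal.bounded_part X J d)"
proof -
  interpret polynomial_ideal X J by fact
  show ?thesis
    unfolding bounded_initial_space_def leading_monomials_initial_space[OF zero_in_bounded_part]
    by (rule card_leading_monomials[OF subspace_bounded_part finite_monomials_upto[OF X]])
      (auto simp: bounded_part_def inj_on_def)
qed

section \<open>Finiteness of the set of initial ideals\<close>

text \<open>A pigeonhole step. The signs of the forms in \<open>B\<close> split \<open>C\<close> into finitely many cells. If on each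
  cell the signs of finitely many forms determined \<open>h\<close>, then those of all these forms together with
  \<open>B\<close> would determine \<open>h\<close> on \<open>C\<close>.\<close>
lemma cell_refinement:
  fixes B :: "('x \<Rightarrow> rat) set"
  assumes B: "finite B" "B \<subseteq> qspace X"
    and bad: "\<nexists>A. finite A \<and> A \<subseteq> qspace X \<and>
      (\<forall>w\<in>C. \<forall>w'\<in>C. (\<forall>u\<in>A. sgn (qdot X u w) = sgn (qdot X u w')) \<longrightarrow> h w = h w')"
  obtains C' where "C' \<subseteq> C"
    and "\<And>w w' u. w \<in> C' \<Longrightarrow> w' \<in> C' \<Longrightarrow> u \<in> B \<Longrightarrow> sgn (qdot X u w) = sgn (qdot X u w')"
    and "\<nexists>A. finite A \<and> A \<subseteq> qspace X \<and>
      (\<forall>w\<in>C'. \<forall>w'\<in>C'. (\<forall>u\<in>A. sgn (qdot X u w) = sgn (qdot X u w')) \<longrightarrow> h w = h w')"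
proof -
  define sig where "sig w = (\<lambda>u. if u \<in> B then sgn (qdot X u w) else 0)" for w
  have sgn_cases: "sgn q \<in> {-1, 0, 1}" for q :: rat by (simp add: sgn_if)
  have "sig ` C \<subseteq> {f. \<forall>u. (u \<in> B \<longrightarrow> f u \<in> {-1, 0, 1}) \<and> (u \<notin> B \<longrightarrow> f u = 0)}"
  proof (intro subsetI CollectI allI)
    fix f u assume "f \<in> sig ` C"
    then obtain w where f: "f = sig w" by blast
    show "(u \<in> B \<longrightarrow> f u \<in> {-1, 0, 1}) \<and> (u \<notin> B \<longrightarrow> f u = 0)"
      unfolding f sig_def using sgn_cases[of "qdot X u w"] by simp
  qed
  hence fin: "finite (sig ` C)"
    by (rule finite_subset) (rule finite_set_of_finite_funs, use B(1) in auto)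
  define Good where "Good A C' \<longleftrightarrow> finite A \<and> A \<subseteq> qspace X \<and>
      (\<forall>w\<in>C'. \<forall>w'\<in>C'. (\<forall>u\<in>A. sgn (qdot X u w) = sgn (qdot X u w')) \<longrightarrow> h w = h w')" for A C'
  have "\<exists>s\<in>sig ` C. \<nexists>A. Good A {w \<in> C. sig w = s}"
  proof (rule ccontr)
    assume "\<not> ?thesis"
    hence "\<forall>s\<in>sig ` C. \<exists>A. Good A {w \<in> C. sig w = s}" by blast
    then obtain A where A: "\<And>s. s \<in> sig ` C \<Longrightarrow> Good (A s) {w \<in> C. sig w = s}"
      unfolding bchoice_iff by blast
    have A1: "finite (A s)" "A s \<subseteq> qspace X" if "s \<in> sig ` C" for s
      using A[OF that] unfolding Good_def by blast+
    define A' where "A' = B \<union> (\<Union>s\<in>sig ` C. A s)"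
    have "Good A' C"
      unfolding Good_def
    proof (intro conjI ballI impI)
      show "finite A'" unfolding A'_def by (intro finite_UnI finite_UN_I B(1) fin A1(1))
      show "A' \<subseteq> qspace X" unfolding A'_def by (intro Un_least UN_least B(2) A1(2))
      fix w w' assume w: "w \<in> C" "w' \<in> C" and eq: "\<forall>u\<in>A'. sgn (qdot X u w) = sgn (qdot X u w')"
      have "sig w' = sig w" using eq by (auto simp: sig_def A'_def)
      moreover have "\<forall>u\<in>A (sig w). sgn (qdot X u w) = sgn (qdot X u w')"
        using eq w(1) by (auto simp: A'_def)
      ultimately show "h w = h w'" using A[of "sig w"] w unfolding Good_def by blast
    qed
    thus False using bad unfolding Good_def by blast
  qed
  then obtain s where s: "\<nexists>A. Good A {w \<in> C. sig w = s}" by blast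
  show ?thesis
  proof (rule that[of "{w \<in> C. sig w = s}"])
    fix w w' u assume *: "w \<in> {w \<in> C. sig w = s}" "w' \<in> {w \<in> C. sig w = s}" "u \<in> B"
    hence "sig w u = sig w' u" by simp
    thus "sgn (qdot X u w) = sgn (qdot X u w')" using *(3) unfolding sig_def by simp
  qed (use s in \<open>auto simp: Good_def\<close>)
qed

text \<open>Suppose that no finite set of forms works. Then \<open>cell_refinement\<close> yields sets of weights
  \<open>C 0 \<supseteq> C 1 \<supseteq> \<dots>\<close>, none of them settled by finitely many forms, such that the signs of
  \<open>degree_tests d\<close> are constant on \<open>C (Suc d)\<close>. Hence on \<open>C (Suc d)\<close> the initial space of degree
  at most \<open>d\<close> is a fixed space, with a set \<open>Lead d\<close> of leading monomials. The pairs of an element of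
  \<open>Lead d\<close> and the bound \<open>d\<close>, read as homogenised monomials, are generated by finitely many of them,
  with bounds at most \<open>D\<close>. For a weight in \<open>C (Suc D)\<close> the generators are available, so its
  initial spaces contain the fixed ones in all degrees, and the dimensions agree. Therefore all
  weights in \<open>C (Suc D)\<close> have the same initial ideal, which contradicts the choice of this set.\<close>
theorem initial_ideal_sign_determined:
  fixes J :: "(('x::linorder \<Rightarrow>\<^sub>0 nat) \<Rightarrow>\<^sub>0 'k::field) set"
  assumes "polynomial_ideal X J" and X: "finite X"
  obtains A where "finite A" "A \<subseteq> qspace X"
    and "\<forall>w w'. (\<forall>u\<in>A. sgn (qdot X u w) = sgn (qdot X u w')) \<longrightarrow>
      initial_ideal X J w = initial_ideal X J w'"
proof -
  interpret polynomial_ideal X J by fact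
  define Bad where "Bad C \<longleftrightarrow> (\<nexists>A. finite A \<and> A \<subseteq> qspace X \<and>
    (\<forall>w\<in>C. \<forall>w'\<in>C. (\<forall>u\<in>A. sgn (qdot X u w) = sgn (qdot X u w')) \<longrightarrow>
      initial_ideal X J w = initial_ideal X J w'))" for C
  have "\<not> Bad UNIV"
  proof
    assume bad: "Bad UNIV"
    have "\<exists>C'. Bad C' \<and> C' \<subseteq> C \<and>
      (\<forall>w\<in>C'. \<forall>w'\<in>C'. \<forall>u\<in>degree_tests d. sgn (qdot X u w) = sgn (qdot X u w'))"
      if "Bad C" for C d
    proof -
      have "finite (degree_tests d)"
        using finite_monomials_upto[OF X] by (simp add: degree_tests_def)
      note refine = cell_refinement[where h = "initial_ideal X J" and C = C, OF this degree_tests_qspace,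
          folded Bad_def, OF \<open>Bad C\<close>]
      show ?thesis
      proof (rule refine)
        fix C' assume "C' \<subseteq> C" "Bad C'"
          "\<And>w w' u. w \<in> C' \<Longrightarrow> w' \<in> C' \<Longrightarrow> u \<in> degree_tests d \<Longrightarrow>
            sgn (qdot X u w) = sgn (qdot X u w')"
        thus ?thesis by blast
      qed
    qed
    hence "\<exists>C. \<forall>d. Bad (C d) \<and> (C (Suc d) \<subseteq> C d \<and>
      (\<forall>w\<in>C (Suc d). \<forall>w'\<in>C (Suc d). \<forall>u\<in>degree_tests d. sgn (qdot X u w) = sgn (qdot X u w')))"
      using bad by (intro dependent_nat_choice) blast+
    then obtain C where C: "\<And>d. Bad (C d)" "\<And>d. C (Suc d) \<subseteq> C d"
      "\<And>d w w' u. w \<in> C (Suc d) \<Longrightarrow> w' \<in> C (Suc d) \<Longrightarrow> u \<in> degree_tests d \<Longrightarrow>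
         sgn (qdot X u w) = sgn (qdot X u w')" by blast
    have anti: "C d \<subseteq> C e" if "e \<le> d" for d e
      using lift_Suc_antimono_le[of C, OF C(2) that] .
    have same: "bounded_initial_space w e = bounded_initial_space w' e"
      if "w \<in> C (Suc d)" "w' \<in> C (Suc d')" "e \<le> d" "e \<le> d'" for w w' d d' e
      by (rule bounded_initial_space_sign_determined[OF X], rule C(3)[of _ e])
        (use that anti[of "Suc e" "Suc d"] anti[of "Suc e" "Suc d'"] in auto)
    have nonempty: "\<exists>w. w \<in> C d" for d
      using C(1)[of d] unfolding Bad_def by (metis empty_iff empty_subsetI finite.emptyI)
    \<comment> \<open>a weight that represents the initial space of degree at most \<open>d\<close>\<close>
    define p where "p d = (SOME w. w \<in> C (Suc d))" for d
    have p: "p d \<in> C (Suc d)" for d unfolding p_def by (rule someI_ex[OF nonempty])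
    define Lead where "Lead d = leading_monomials id (bounded_initial_space (p d) d)" for d
    define S where "S = {(\<alpha>, d). \<alpha> \<in> Lead d}"
    \<comment> \<open>the homogenising variable, indexed by \<open>None\<close>, has the missing degree as its exponent\<close>
    define hom where "hom s i = (case i of None \<Rightarrow> snd s - total_degree (fst s)
       | Some x \<Rightarrow> Poly_Mapping.lookup (fst s) x)" for s :: "('x \<Rightarrow>\<^sub>0 nat) \<times> nat" and i
    have Lead: "\<alpha> \<in> monomials_upto X d" if "\<alpha> \<in> Lead d" for \<alpha> d
      using that keys_bounded_initial_space by (auto simp: Lead_def leading_monomials_def)
    obtain F where F: "finite F" "F \<subseteq> S"
      "\<forall>s\<in>S. \<exists>t\<in>F. \<forall>i\<in>insert None (Some ` X). hom t i \<le> hom s i"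
      using Dickson[of "insert None (Some ` X)" S hom] X by auto
    define D where "D = Max (insert 0 (snd ` F))"
    have D: "e \<le> D" if "(\<beta>, e) \<in> F" for \<beta> e
      unfolding D_def by (rule Max_ge) (use F(1) that in force)+
    have stable: "bounded_initial_space w d = bounded_initial_space (p d) d" if w: "w \<in> C (Suc D)" for w d
    proof -
      define U where "U = bounded_initial_space (p d) d"
      define W where "W = bounded_initial_space w d"
      have subs: "pm.subspace U" "pm.subspace W" "pm.subspace (U \<inter> W)"
        unfolding U_def W_def by (intro pm.subspace_inter subspace_bounded_initial_space)+
      have keys: "Poly_Mapping.keys f \<subseteq> monomials_upto X d" if "f \<in> U \<or> f \<in> W" for f
        using that keys_bounded_initial_space by (auto simp: U_def W_def)
      have "leading_monomials id U \<subseteq> leading_monomials id (U \<inter> W)"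
      proof
        fix \<alpha> assume \<alpha>: "\<alpha> \<in> leading_monomials id U"
        hence s: "(\<alpha>, d) \<in> S" by (simp add: S_def Lead_def U_def)
        then obtain \<beta> e where \<beta>: "(\<beta>, e) \<in> F"
          and le: "\<And>i. i \<in> insert None (Some ` X) \<Longrightarrow> hom (\<beta>, e) i \<le> hom (\<alpha>, d) i" using F(3) by fast
        have \<alpha>M: "\<alpha> \<in> monomials_upto X d" and \<beta>M: "\<beta> \<in> monomials_upto X e"
          using s \<beta> F(2) Lead by (auto simp: S_def)
        define \<gamma> where "\<gamma> = \<alpha> - \<beta>"
        have "Poly_Mapping.lookup \<beta> i \<le> Poly_Mapping.lookup \<alpha> i" for i
        proof (cases "i \<in> X")
          case True
          thus ?thesis using le[of "Some i"] by (simp add: hom_def)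
        next
          case False
          hence "i \<notin> Poly_Mapping.keys \<beta>" using \<beta>M by (auto simp: monomials_upto_def)
          thus ?thesis by (simp add: in_keys_iff)
        qed
        hence \<gamma>: "\<alpha> = \<gamma> + \<beta>" unfolding \<gamma>_def by (intro poly_mapping_eqI) (simp add: lookup_add lookup_minus)
        have deg: "e + total_degree \<gamma> \<le> d"
          using le[of None] \<alpha>M \<beta>M by (auto simp: hom_def monomials_upto_def \<gamma> total_degree_add)
        have \<gamma>X: "Poly_Mapping.keys \<gamma> \<subseteq> X" using \<alpha>M by (auto simp: monomials_upto_def \<gamma> keys_add_nat)
        have "\<beta> \<in> Lead e" using \<beta> F(2) by (auto simp: S_def)
        then obtain g where g: "g \<in> bounded_initial_space (p e) e" "\<beta> \<in> Poly_Mapping.keys g"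
          "\<And>\<delta>. \<delta> \<in> Poly_Mapping.keys g \<Longrightarrow> \<delta> \<le> \<beta>"
          by (auto simp: Lead_def leading_monomials_def)
        have "g \<in> bounded_initial_space (p d) e" "g \<in> bounded_initial_space w e"
          using g(1) same[OF p[of e] p[of d], of e] same[OF p[of e] w, of e] D[OF \<beta>] deg by auto
        hence mem: "Poly_Mapping.single \<gamma> 1 * g \<in> U \<inter> W"
          unfolding U_def W_def using bounded_initial_space_mult[OF _ \<gamma>X deg] by blast
        have "\<alpha> \<in> Poly_Mapping.keys (Poly_Mapping.single \<gamma> 1 * g)"
          using g(2) by (simp add: in_keys_iff \<gamma> lookup_single_mult)
        moreover have "\<delta> \<le> \<alpha>" if "\<delta> \<in> Poly_Mapping.keys (Poly_Mapping.single \<gamma> 1 * g)" for \<delta>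
          using that keys_single_mult[of \<gamma> 1 g] g(3) by (auto simp: \<gamma> add_left_mono)
        ultimately show "\<alpha> \<in> leading_monomials id (U \<inter> W)"
          using mem unfolding leading_monomials_def by auto
      qed
      \<comment> \<open>elimination inside \<open>U\<close> only uses elements that also belong to \<open>W\<close>\<close>
      hence "U \<subseteq> U \<inter> W"
        by (rule subset_of_leading_monomials_subset[OF subs(3,1) _ finite_monomials_upto[OF X], of d id, rotated 3])
          (use keys in auto)
      hence UW: "U \<subseteq> W" by blast
      have "card (leading_monomials id U) = card (leading_monomials id W)"
        unfolding U_def W_def card_leading_monomials_bounded_initial_space[OF assms] ..
      moreover have "leading_monomials id U \<subseteq> leading_monomials id W"
        using UW by (auto simp: leading_monomials_def)
      moreover have "finite (leading_monomials id W)"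
        by (rule finite_subset[OF _ finite_monomials_upto[OF X, of d]])
          (use keys in \<open>auto simp: leading_monomials_def\<close>)
      ultimately have "leading_monomials id U = leading_monomials id W"
        using card_subset_eq by blast
      hence "W \<subseteq> U"
        by (intro subset_of_leading_monomials_subset[OF subs(1,2) UW finite_monomials_upto[OF X], of d id])
          (use keys in auto)
      thus ?thesis using UW by (simp add: U_def W_def)
    qed
    have "initial_ideal X J w = initial_ideal X J w'" if "w \<in> C (Suc D)" "w' \<in> C (Suc D)" for w w'
      by (rule initial_ideal_cong) (simp add: stable that)
    hence "\<not> Bad (C (Suc D))" unfolding Bad_def by blast
    thus False using C(1) by blast
  qed
  then obtain A where A: "finite A" "A \<subseteq> qspace X"
    "\<forall>w\<in>UNIV. \<forall>w'\<in>UNIV. (\<forall>u\<in>A. sgn (qdot X u w) = sgn (qdot X u w')) \<longrightarrow>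
      initial_ideal X J w = initial_ideal X J w'"
    unfolding Bad_def by blast
  show ?thesis by (rule that[OF A(1,2)]) (use A(3) in blast)
qed

section \<open>Cones of weights defined by initial ideals\<close>

context polynomial_ideal
begin

text \<open>Some element of the ideal has the monomial as its initial form, and the weights at which this
  element has that initial form are given by strict inequalities.\<close>
lemma monomial_in_initial_ideal_open:
  assumes X: "finite X" and \<gamma>: "Poly_Mapping.keys \<gamma> \<subseteq> X"
    and mem: "Poly_Mapping.single \<gamma> 1 \<in> initial_ideal X J w"
  obtains A where "finite A" "\<forall>u\<in>A. 0 < qdot X u w"
    and "\<forall>z. (\<forall>u\<in>A. 0 < qdot X u z) \<longrightarrow> Poly_Mapping.single \<gamma> 1 \<in> initial_ideal X J z"
proof -
  obtain f where f: "f \<in> J" "\<And>\<alpha>. \<alpha> \<in> Poly_Mapping.keys f \<Longrightarrow> weight w \<gamma> \<le> weight w \<alpha>"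
    "\<And>\<alpha>. weight w \<alpha> = weight w \<gamma> \<Longrightarrow>
       Poly_Mapping.lookup f \<alpha> = Poly_Mapping.lookup (Poly_Mapping.single \<gamma> 1) \<alpha>"
    using initial_spaceE[OF mem[unfolded initial_ideal_eq_initial_space], of "weight w \<gamma>"] by blast
  define A where "A = (\<lambda>\<alpha>. exponent_difference \<alpha> \<gamma>) ` (Poly_Mapping.keys f - {\<gamma>})"
  have q: "qdot X (exponent_difference \<alpha> \<gamma>) z = weight z \<alpha> - weight z \<gamma>"
    if "\<alpha> \<in> Poly_Mapping.keys f" for \<alpha> z
    using that f(1) sub_poly_ring by (intro qdot_exponent_difference[OF X _ \<gamma>]) (auto simp: poly_ring_def)
  show ?thesis
  proof (rule that[of A]; (intro ballI allI impI)?)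
    show "finite A" by (simp add: A_def)
    fix u assume "u \<in> A"
    then obtain \<alpha> where \<alpha>: "\<alpha> \<in> Poly_Mapping.keys f" "\<alpha> \<noteq> \<gamma>" "u = exponent_difference \<alpha> \<gamma>"
      by (auto simp: A_def)
    have "weight w \<alpha> \<noteq> weight w \<gamma>"
      using f(3)[of \<alpha>] \<alpha>(1,2) by (auto simp: in_keys_iff lookup_single)
    thus "0 < qdot X u w" using f(2)[OF \<alpha>(1)] by (simp add: \<alpha>(3) q[OF \<alpha>(1)])
  next
    fix z assume z: "\<forall>u\<in>A. 0 < qdot X u z"
    have gt: "weight z \<gamma> < weight z \<alpha>" if "\<alpha> \<in> Poly_Mapping.keys f" "\<alpha> \<noteq> \<gamma>" for \<alpha>
      using bspec[OF z, of "exponent_difference \<alpha> \<gamma>"] q[OF that(1), of z] that by (auto simp: A_def)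
    have f\<gamma>: "Poly_Mapping.lookup f \<gamma> = 1" using f(3)[of \<gamma>] by simp
    show "Poly_Mapping.single \<gamma> 1 \<in> initial_ideal X J z"
      unfolding initial_ideal_eq_initial_space initial_space_def
    proof (intro CollectI allI)
      fix a
      show "\<exists>f\<in>J. (\<forall>\<alpha>\<in>Poly_Mapping.keys f. a \<le> weight z \<alpha>) \<and> (\<forall>\<alpha>. weight z \<alpha> = a \<longrightarrow>
        Poly_Mapping.lookup f \<alpha> = Poly_Mapping.lookup (Poly_Mapping.single \<gamma> 1) \<alpha>)"
      proof (cases "a = weight z \<gamma>")
        case True
        show ?thesis
        proof (intro bexI[of _ f] conjI ballI allI impI)
          show "f \<in> J" by fact
          show "a \<le> weight z \<alpha>" if "\<alpha> \<in> Poly_Mapping.keys f" for \<alpha>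
            using gt[OF that] True by (cases "\<alpha> = \<gamma>") auto
          show "Poly_Mapping.lookup f \<alpha> = Poly_Mapping.lookup (Poly_Mapping.single \<gamma> 1) \<alpha>"
            if "weight z \<alpha> = a" for \<alpha>
            using gt[of \<alpha>] that True f\<gamma> by (cases "\<alpha> = \<gamma>") (auto simp: in_keys_iff lookup_single)
        qed
      next
        case False
        thus ?thesis by (intro bexI[of _ 0] zero_mem) (auto simp: lookup_single when_def)
      qed
    qed
  qed
qed

text \<open>The set is sign-determined because the initial ideal is, and closed by
  \<open>monomial_in_initial_ideal_open\<close>.\<close>
lemma avoiding_monomials_is_union_of_cones:
  assumes X: "finite X" and A: "finite A"
    and det: "\<forall>w w'. (\<forall>u\<in>A. sgn (qdot X u w) = sgn (qdot X u w')) \<longrightarrow>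
      initial_ideal X J w = initial_ideal X J w'"
    and \<Gamma>: "\<And>\<gamma>. \<gamma> \<in> \<Gamma> \<Longrightarrow> Poly_Mapping.keys \<gamma> \<subseteq> X"
  shows "union_of_halfspace_cones X (negation_closure A)
    {w \<in> qspace X. \<forall>\<gamma>\<in>\<Gamma>. Poly_Mapping.single \<gamma> 1 \<notin> initial_ideal X J w}"
    (is "union_of_halfspace_cones _ _ ?S")
proof -
  have "sign_determined X A ?S"
    unfolding sign_determined_def using det by blast
  hence "union_of_halfspace_cones X (negation_closure A) (qclosure X ?S)"
    by (rule qclosure_sign_determined[OF X A])
  moreover have "?S \<subseteq> qclosure X ?S" by (force simp: qclosure_def)
  moreover have "qclosure X ?S \<subseteq> ?S"
  proof
    fix w assume w: "w \<in> qclosure X ?S"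
    have "Poly_Mapping.single \<gamma> 1 \<notin> initial_ideal X J w" if \<gamma>: "\<gamma> \<in> \<Gamma>" for \<gamma>
    proof
      assume "Poly_Mapping.single \<gamma> 1 \<in> initial_ideal X J w"
      then obtain B where B: "finite B" "\<forall>u\<in>B. 0 < qdot X u w"
        "\<forall>z. (\<forall>u\<in>B. 0 < qdot X u z) \<longrightarrow> Poly_Mapping.single \<gamma> 1 \<in> initial_ideal X J z"
        by (rule monomial_in_initial_ideal_open[OF X \<Gamma>[OF \<gamma>]])
      obtain z where "z \<in> ?S" "\<forall>u\<in>B. 0 < qdot X u z"
        by (rule qclosure_pos_witness[OF w B(1) bspec[OF B(2)]]) blast+
      thus False using B(3) \<gamma> by blast
    qed
    thus "w \<in> ?S" using w by (simp add: qclosure_def)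
  qed
  ultimately show ?thesis by (simp add: subset_antisym)
qed

lemma Groebner_cone_is_union_of_cones:
  assumes X: "finite X" and A: "finite A"
    and det: "\<forall>w w'. (\<forall>u\<in>A. sgn (qdot X u w) = sgn (qdot X u w')) \<longrightarrow>
      initial_ideal X J w = initial_ideal X J w'"
    and C: "C \<in> Groebner_fan X J"
  shows "union_of_halfspace_cones X (negation_closure A) C"
proof -
  obtain w where "C = qclosure X {w' \<in> qspace X. initial_ideal X J w' = initial_ideal X J w}"
    using C unfolding Groebner_fan_def by blast
  moreover have "sign_determined X A {w' \<in> qspace X. initial_ideal X J w' = initial_ideal X J w}"
    unfolding sign_determined_def using det by blast
  ultimately show ?thesis using qclosure_sign_determined[OF X A] by blast
qed

end

section \<open>Relation ideals and weight values\<close>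

locale commutative_algebra = vector_space scale
  for scale :: "'k::field \<Rightarrow> 's::comm_ring_1 \<Rightarrow> 's" +
  assumes scale_mult: "scale c (x * y) = scale c x * y"
begin

lemma scale_mult_scale: "scale c x * scale d y = scale (c * d) (x * y)"
  by (metis mult.commute scale_mult scale_scale)

lemma monomial_val_superset:
  assumes "finite S" "Poly_Mapping.keys \<alpha> \<subseteq> S"
  shows "monomial_val g \<alpha> = (\<Prod>i\<in>S. g i ^ Poly_Mapping.lookup \<alpha> i)"
  unfolding monomial_val_def using assms by (intro prod.mono_neutral_left) (auto simp: in_keys_iff)

lemma monomial_val_add: "monomial_val g (\<alpha> + \<beta>) = monomial_val g \<alpha> * monomial_val g \<beta>"
proof -
  let ?S = "Poly_Mapping.keys \<alpha> \<union> Poly_Mapping.keys \<beta>"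
  have "monomial_val g (\<alpha> + \<beta>) = (\<Prod>i\<in>?S. g i ^ Poly_Mapping.lookup (\<alpha> + \<beta>) i)"
    by (rule monomial_val_superset) (auto simp: keys_add_nat)
  also have "\<dots> = (\<Prod>i\<in>?S. g i ^ Poly_Mapping.lookup \<alpha> i) * (\<Prod>i\<in>?S. g i ^ Poly_Mapping.lookup \<beta> i)"
    by (simp add: lookup_add power_add prod.distrib)
  also have "\<dots> = monomial_val g \<alpha> * monomial_val g \<beta>"
    using monomial_val_superset[of ?S \<alpha> g] monomial_val_superset[of ?S \<beta> g] by simp
  finally show ?thesis .
qed

lemma poly_val_superset:
  assumes "finite S" "Poly_Mapping.keys P \<subseteq> S"
  shows "poly_val scale g P = (\<Sum>\<alpha>\<in>S. scale (Poly_Mapping.lookup P \<alpha>) (monomial_val g \<alpha>))"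
  unfolding poly_val_def using assms by (intro sum.mono_neutral_left) (auto simp: in_keys_iff)

lemma poly_val_0: "poly_val scale g 0 = 0"
  by (simp add: poly_val_def)

lemma poly_val_add: "poly_val scale g (P + Q) = poly_val scale g P + poly_val scale g Q"
  using keys_add[of P Q]
  by (simp add: poly_val_superset[of "Poly_Mapping.keys P \<union> Poly_Mapping.keys Q"] lookup_add
      scale_left_distrib sum.distrib)

lemma poly_val_diff: "poly_val scale g (P - Q) = poly_val scale g P - poly_val scale g Q"
  using poly_val_add[of g "P - Q" Q] by simp

lemma poly_val_sum: "poly_val scale g (\<Sum>a\<in>A. F a) = (\<Sum>a\<in>A. poly_val scale g (F a))"
  by (induction A rule: infinite_finite_induct) (simp_all add: poly_val_0 poly_val_add)

lemma poly_val_single: "poly_val scale g (Poly_Mapping.single \<alpha> c) = scale c (monomial_val g \<alpha>)"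
  by (simp add: poly_val_superset[of "{\<alpha>}"])

lemma poly_val_variable: "poly_val scale g (Poly_Mapping.single (Poly_Mapping.single j 1) 1) = g j"
  by (simp add: poly_val_single monomial_val_def)

lemma poly_val_mult: "poly_val scale g (P * Q) = poly_val scale g P * poly_val scale g Q"
proof -
  have "P * Q = (\<Sum>\<alpha>\<in>Poly_Mapping.keys P. \<Sum>\<beta>\<in>Poly_Mapping.keys Q.
    Poly_Mapping.single (\<alpha> + \<beta>) (Poly_Mapping.lookup P \<alpha> * Poly_Mapping.lookup Q \<beta>))"
    by (subst poly_mapping_sum_monomials[of P], subst poly_mapping_sum_monomials[of Q])
      (simp add: sum_product mult_single)
  thus ?thesis
    by (simp add: poly_val_sum poly_val_single monomial_val_add poly_val_def[of scale g P]
        poly_val_def[of scale g Q] sum_product scale_mult_scale)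
qed

lemma relation_ideal_is_ideal: "polynomial_ideal X (relation_ideal scale X g)"
  by unfold_locales
    (auto simp: relation_ideal_def poly_ring_0 poly_val_0 poly_ring_add poly_val_add poly_ring_mult
      poly_val_mult)

lemma weight_variable: "weight w (Poly_Mapping.single j 1) = w j"
  by (simp add: weight_def)

text \<open>If \<open>x\<^sub>j\<close> is the initial form of a relation \<open>f\<close>, then \<open>P = x\<^sub>j - f\<close> is another presentation of
  \<open>g j\<close>, and all its monomials have weight greater than \<open>w j\<close>; and conversely. So the variable lies in
  the initial ideal iff the quasivaluation of \<open>g j\<close> exceeds \<open>w j\<close>.\<close>
lemma variable_in_initial_ideal_iff:
  assumes j: "j \<in> X"
  shows "Poly_Mapping.single (Poly_Mapping.single j 1) 1 \<in> initial_ideal X (relation_ideal scale X g) w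
    \<longleftrightarrow> (\<exists>P\<in>poly_ring X. poly_val scale g P = g j \<and> (\<forall>\<alpha>\<in>Poly_Mapping.keys P. w j < weight w \<alpha>))"
    (is "?x \<in> _ \<longleftrightarrow> _")
proof -
  interpret I: polynomial_ideal X "relation_ideal scale X g" by (rule relation_ideal_is_ideal)
  have xX: "?x \<in> poly_ring X" using j by (intro poly_ring_single) simp
  show ?thesis
  proof
    assume "?x \<in> initial_ideal X (relation_ideal scale X g) w"
    then obtain f where f: "f \<in> relation_ideal scale X g"
      "\<And>\<alpha>. \<alpha> \<in> Poly_Mapping.keys f \<Longrightarrow> w j \<le> weight w \<alpha>"
      "\<And>\<alpha>. weight w \<alpha> = w j \<Longrightarrow> Poly_Mapping.lookup f \<alpha> = Poly_Mapping.lookup ?x \<alpha>"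
      using initial_spaceE[of ?x w _ "w j"] unfolding I.initial_ideal_eq_initial_space by metis
    show "\<exists>P\<in>poly_ring X. poly_val scale g P = g j \<and> (\<forall>\<alpha>\<in>Poly_Mapping.keys P. w j < weight w \<alpha>)"
    proof (intro bexI[of _ "?x - f"] conjI ballI)
      show "?x - f \<in> poly_ring X"
        using f(1) xX by (intro poly_ring_diff) (auto simp: relation_ideal_def)
      show "poly_val scale g (?x - f) = g j"
        using f(1) by (simp add: poly_val_diff poly_val_variable relation_ideal_def del: One_nat_def)
      fix \<alpha> assume \<alpha>: "\<alpha> \<in> Poly_Mapping.keys (?x - f)"
      hence ne: "weight w \<alpha> \<noteq> w j" using f(3)[of \<alpha>] by (auto simp: in_keys_iff lookup_minus)
      hence "\<alpha> \<noteq> Poly_Mapping.single j 1" using weight_variable[of w j] by auto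
      hence "\<alpha> \<in> Poly_Mapping.keys f"
        using \<alpha> by (auto simp: in_keys_iff lookup_minus lookup_single when_def)
      thus "w j < weight w \<alpha>" using f(2)[of \<alpha>] ne by simp
    qed
  next
    assume "\<exists>P\<in>poly_ring X. poly_val scale g P = g j \<and> (\<forall>\<alpha>\<in>Poly_Mapping.keys P. w j < weight w \<alpha>)"
    then obtain P where P: "P \<in> poly_ring X" "poly_val scale g P = g j"
      "\<And>\<alpha>. \<alpha> \<in> Poly_Mapping.keys P \<Longrightarrow> w j < weight w \<alpha>" by blast
    have f: "?x - P \<in> relation_ideal scale X g"
      using P xX by (simp add: relation_ideal_def poly_ring_diff poly_val_diff poly_val_variable del: One_nat_def)
    show "?x \<in> initial_ideal X (relation_ideal scale X g) w"
      unfolding I.initial_ideal_eq_initial_space initial_space_def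
    proof (intro CollectI allI)
      fix a
      show "\<exists>f\<in>relation_ideal scale X g. (\<forall>\<alpha>\<in>Poly_Mapping.keys f. a \<le> weight w \<alpha>) \<and>
        (\<forall>\<alpha>. weight w \<alpha> = a \<longrightarrow> Poly_Mapping.lookup f \<alpha> = Poly_Mapping.lookup ?x \<alpha>)"
      proof (cases "a = w j")
        case True
        show ?thesis
        proof (intro bexI[of _ "?x - P"] conjI ballI allI impI f)
          fix \<alpha> assume "\<alpha> \<in> Poly_Mapping.keys (?x - P)"
          hence "\<alpha> = Poly_Mapping.single j 1 \<or> \<alpha> \<in> Poly_Mapping.keys P"
            using keys_diff[of ?x P] by auto
          thus "a \<le> weight w \<alpha>" using P(3)[of \<alpha>] True weight_variable[of w j] by auto
        next
          fix \<alpha> assume "weight w \<alpha> = a"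
          hence "\<alpha> \<notin> Poly_Mapping.keys P" using P(3)[of \<alpha>] True by auto
          thus "Poly_Mapping.lookup (?x - P) \<alpha> = Poly_Mapping.lookup ?x \<alpha>"
            by (simp add: lookup_minus in_keys_iff)
        qed
      next
        case False
        thus ?thesis using weight_variable[of w j]
          by (intro bexI[of _ 0] I.zero_mem) (auto simp: lookup_single when_def)
      qed
    qed
  qed
qed

text \<open>Both conjuncts speak about the set of monomials of \<open>P\<close> only, and no minimum occurs in them, so
  the weight value is described by linear inequalities in \<open>w\<close> and \<open>m\<close>.\<close>
lemma has_weight_value_iff:
  assumes "f \<noteq> 0"
  shows "has_weight_value scale X g w f m \<longleftrightarrow>
    (\<exists>P\<in>poly_ring X. poly_val scale g P = f \<and> (\<forall>\<alpha>\<in>Poly_Mapping.keys P. m \<le> weight w \<alpha>)) \<and>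
    (\<forall>P\<in>poly_ring X. poly_val scale g P = f \<longrightarrow> (\<exists>\<alpha>\<in>Poly_Mapping.keys P. weight w \<alpha> \<le> m))"
    (is "?L \<longleftrightarrow> ?R")
proof
  have nz: "P \<noteq> 0" if "poly_val scale g P = f" for P
    using that assms by (auto simp: poly_val_0)
  have ex: "\<exists>\<alpha>\<in>Poly_Mapping.keys P. weight w \<alpha> = min_weight w P" if "poly_val scale g P = f" for P
    using min_weight_attained[OF nz[OF that], of w] by metis
  {
    assume L: ?L
    then obtain P where P: "P \<in> poly_ring X" "poly_val scale g P = f" "min_weight w P = m"
      by (auto simp: has_weight_value_def)
    show ?R
    proof (intro conjI ballI impI)
      show "\<exists>P\<in>poly_ring X. poly_val scale g P = f \<and> (\<forall>\<alpha>\<in>Poly_Mapping.keys P. m \<le> weight w \<alpha>)"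
        using P by (intro bexI[of _ P]) (auto simp: min_weight_le)
      fix Q assume Q: "Q \<in> poly_ring X" "poly_val scale g Q = f"
      hence "min_weight w Q \<le> m" using L nz by (auto simp: has_weight_value_def)
      thus "\<exists>\<alpha>\<in>Poly_Mapping.keys Q. weight w \<alpha> \<le> m" using ex[OF Q(2)] by metis
    qed
  next
    assume R: ?R
    then obtain P where P: "P \<in> poly_ring X" "poly_val scale g P = f"
      "\<And>\<alpha>. \<alpha> \<in> Poly_Mapping.keys P \<Longrightarrow> m \<le> weight w \<alpha>" by blast
    have le: "min_weight w Q \<le> m" if Q: "Q \<in> poly_ring X" "poly_val scale g Q = f" for Q
    proof -
      obtain \<alpha> where "\<alpha> \<in> Poly_Mapping.keys Q" "weight w \<alpha> \<le> m" using R Q by blast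
      thus ?thesis using min_weight_le[of \<alpha> Q w] by simp
    qed
    have "m \<le> min_weight w P" using ex[OF P(2)] P(3) by metis
    hence "min_weight w P = m" using le[OF P(1,2)] by simp
    thus ?L using P(1,2) nz le unfolding has_weight_value_def by blast
  }
qed

text \<open>The elements of quasivaluation at least \<open>a\<close>, whether or not the maximum in the definition of the
  quasivaluation exists.\<close>
definition weight_filtration :: "'x set \<Rightarrow> ('x \<Rightarrow> 's) \<Rightarrow> ('x \<Rightarrow> rat) \<Rightarrow> rat \<Rightarrow> 's set" where
  "weight_filtration X g w a =
     poly_val scale g ` {P \<in> poly_ring X. \<forall>\<alpha>\<in>Poly_Mapping.keys P. a \<le> weight w \<alpha>}"

lemma weight_filtration_subspace: "subspace (weight_filtration X g w a)"
proof (rule subspaceI)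
  show "0 \<in> weight_filtration X g w a"
    unfolding weight_filtration_def
    by (rule image_eqI[of _ _ 0]) (simp_all add: poly_val_0 poly_ring_0)
next
  fix x y assume "x \<in> weight_filtration X g w a" "y \<in> weight_filtration X g w a"
  then obtain P Q where PQ: "x = poly_val scale g P" "y = poly_val scale g Q"
    "P \<in> poly_ring X" "Q \<in> poly_ring X"
    "\<forall>\<alpha>\<in>Poly_Mapping.keys P. a \<le> weight w \<alpha>" "\<forall>\<alpha>\<in>Poly_Mapping.keys Q. a \<le> weight w \<alpha>"
    unfolding weight_filtration_def by blast
  show "x + y \<in> weight_filtration X g w a"
    unfolding weight_filtration_def
    by (rule image_eqI[of _ _ "P + Q"]) (use PQ keys_add[of P Q] in \<open>auto simp: poly_val_add poly_ring_add\<close>)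
next
  fix c x assume "x \<in> weight_filtration X g w a"
  then obtain P where P: "x = poly_val scale g P"
    "P \<in> poly_ring X" "\<forall>\<alpha>\<in>Poly_Mapping.keys P. a \<le> weight w \<alpha>"
    unfolding weight_filtration_def by blast
  have "poly_val scale g (Poly_Mapping.single 0 c * P) = scale c x"
    using scale_mult[of c 1 x] by (simp add: poly_val_mult poly_val_single P(1) monomial_val_def)
  thus "scale c x \<in> weight_filtration X g w a"
    unfolding weight_filtration_def
    by (intro image_eqI[of _ _ "Poly_Mapping.single 0 c * P"])
      (use P keys_single_mult[of 0 c P] in \<open>auto intro!: poly_ring_mult poly_ring_single\<close>)
qed

lemma weight_filtration_mult:
  assumes "x \<in> weight_filtration X g w a" "y \<in> weight_filtration X g w c"
  shows "x * y \<in> weight_filtration X g w (a + c)"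
proof -
  obtain P Q where PQ: "x = poly_val scale g P" "y = poly_val scale g Q"
    "P \<in> poly_ring X" "Q \<in> poly_ring X"
    "\<And>\<alpha>. \<alpha> \<in> Poly_Mapping.keys P \<Longrightarrow> a \<le> weight w \<alpha>"
    "\<And>\<alpha>. \<alpha> \<in> Poly_Mapping.keys Q \<Longrightarrow> c \<le> weight w \<alpha>"
    using assms unfolding weight_filtration_def by blast
  have "a + c \<le> weight w \<alpha>" if "\<alpha> \<in> Poly_Mapping.keys (P * Q)" for \<alpha>
    using that keys_mult[of P Q] PQ(5,6) by (fastforce simp: weight_add intro: add_mono)
  thus ?thesis
    unfolding weight_filtration_def
    by (intro image_eqI[of _ _ "P * Q"]) (use PQ(1-4) in \<open>auto simp: poly_val_mult poly_ring_mult\<close>)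
qed

lemma one_in_weight_filtration: "1 \<in> weight_filtration X g w 0"
  unfolding weight_filtration_def
  by (rule image_eqI[of _ _ "Poly_Mapping.single 0 1"])
    (auto simp: poly_val_single monomial_val_def poly_ring_single weight_def simp del: single_one)

lemma monomial_val_in_weight_filtration:
  assumes "\<And>i. i \<in> Poly_Mapping.keys \<alpha> \<Longrightarrow> g i \<in> weight_filtration X h w (y i)"
  shows "monomial_val g \<alpha> \<in> weight_filtration X h w (weight y \<alpha>)"
proof -
  have pow: "x ^ n \<in> weight_filtration X h w (a * of_nat n)" if "x \<in> weight_filtration X h w a" for x a n
  proof (induction n)
    case 0
    show ?case using one_in_weight_filtration by simp
  next
    case (Suc n)
    show ?case using weight_filtration_mult[OF that Suc.IH] by (simp add: algebra_simps)
  qed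
  have "(\<Prod>i\<in>S. g i ^ Poly_Mapping.lookup \<alpha> i) \<in>
      weight_filtration X h w (\<Sum>i\<in>S. y i * of_nat (Poly_Mapping.lookup \<alpha> i))"
    if "finite S" "S \<subseteq> Poly_Mapping.keys \<alpha>" for S
    using that
  proof (induction S rule: finite_induct)
    case empty
    show ?case using one_in_weight_filtration by simp
  next
    case (insert i S)
    thus ?case
      using weight_filtration_mult[OF pow[OF assms[of i]], where y = "\<Prod>i\<in>S. g i ^ Poly_Mapping.lookup \<alpha> i"] by simp
  qed
  from this[OF finite_keys order_refl] show ?thesis unfolding monomial_val_def weight_def .
qed

text \<open>If \<open>y\<close> is the vector of weight values of the \<open>b\<^sub>j\<close> for some \<open>w\<close>, then a presentation of \<open>b\<^sub>j\<close> with all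
  \<open>y\<close>-weights greater than \<open>y\<^sub>j\<close> would, after substituting optimal presentations of the generators,
  become one with all \<open>w\<close>-weights greater than \<open>y\<^sub>j\<close>. The multiplicative filtration replaces the
  substitution. So there is no such presentation, which by \<open>variable_in_initial_ideal_iff\<close> is
  the condition on the right; and any \<open>y\<close> satisfying it is its own vector of weight values.\<close>
lemma K_support_iff:
  assumes nz: "\<forall>j<r. b j \<noteq> 0"
  shows "K_support scale r b = {y \<in> qspace {..<r}. \<forall>\<gamma>\<in>(\<lambda>j. Poly_Mapping.single j 1) ` {..<r}.
    Poly_Mapping.single \<gamma> 1 \<notin> initial_ideal {..<r} (relation_ideal scale {..<r} b) y}"
    (is "_ = ?S")
proof (intro equalityI subsetI)
  fix y assume "y \<in> K_support scale r b"
  then obtain w where y: "y \<in> qspace {..<r}"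
    and val: "\<And>j. j < r \<Longrightarrow> has_weight_value scale {..<r} b w (b j) (y j)"
    by (auto simp: K_support_def)
  have bF: "b j \<in> weight_filtration {..<r} b w (y j)" if j: "j < r" for j
  proof -
    obtain P where "P \<in> poly_ring {..<r}" "poly_val scale b P = b j"
      "\<forall>\<alpha>\<in>Poly_Mapping.keys P. y j \<le> weight w \<alpha>"
      using val[OF j] unfolding has_weight_value_iff[OF nz[rule_format, OF j]] by blast
    thus ?thesis unfolding weight_filtration_def by (intro image_eqI[of _ _ P]) auto
  qed
  have "\<not> (\<exists>P\<in>poly_ring {..<r}. poly_val scale b P = b j \<and> (\<forall>\<alpha>\<in>Poly_Mapping.keys P. y j < weight y \<alpha>))"
    if j: "j < r" for j
  proof
    assume "\<exists>P\<in>poly_ring {..<r}. poly_val scale b P = b j \<and> (\<forall>\<alpha>\<in>Poly_Mapping.keys P. y j < weight y \<alpha>)"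
    then obtain P where P: "P \<in> poly_ring {..<r}" "poly_val scale b P = b j"
      "\<forall>\<alpha>\<in>Poly_Mapping.keys P. y j < weight y \<alpha>" by blast
    have "P \<noteq> 0" using P(2) nz[rule_format, OF j] by (auto simp: poly_val_0)
    then obtain \<beta> where "\<beta> \<in> Poly_Mapping.keys P" "weight y \<beta> = min_weight y P"
      by (rule min_weight_attained)
    hence gt: "y j < min_weight y P" using P(3) by force
    have "poly_val scale b P \<in> weight_filtration {..<r} b w (min_weight y P)"
      unfolding poly_val_def
    proof (intro subspace_sum[OF weight_filtration_subspace] subspace_scale[OF weight_filtration_subspace])
      fix \<alpha> assume \<alpha>: "\<alpha> \<in> Poly_Mapping.keys P"
      have "monomial_val b \<alpha> \<in> weight_filtration {..<r} b w (weight y \<alpha>)"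
        by (rule monomial_val_in_weight_filtration) (use bF P(1) \<alpha> in \<open>auto simp: poly_ring_def\<close>)
      thus "monomial_val b \<alpha> \<in> weight_filtration {..<r} b w (min_weight y P)"
        using min_weight_le[OF \<alpha>, of y] unfolding weight_filtration_def by force
    qed
    then obtain Q where Q: "Q \<in> poly_ring {..<r}" "poly_val scale b Q = b j"
      "\<forall>\<alpha>\<in>Poly_Mapping.keys Q. min_weight y P \<le> weight w \<alpha>"
      unfolding P(2) weight_filtration_def by force
    then obtain \<alpha> where "\<alpha> \<in> Poly_Mapping.keys Q" "weight w \<alpha> \<le> y j"
      using val[OF j] unfolding has_weight_value_iff[OF nz[rule_format, OF j]] by blast
    thus False using Q(3) gt by force
  qed
  thus "y \<in> ?S" using y variable_in_initial_ideal_iff[of _ "{..<r}" b y] by auto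
next
  fix y assume y: "y \<in> ?S"
  have "has_weight_value scale {..<r} b y (b j) (y j)" if j: "j < r" for j
    unfolding has_weight_value_iff[OF nz[rule_format, OF j]]
  proof (intro conjI ballI impI)
    show "\<exists>P\<in>poly_ring {..<r}. poly_val scale b P = b j \<and> (\<forall>\<alpha>\<in>Poly_Mapping.keys P. y j \<le> weight y \<alpha>)"
      using j weight_variable[of y j]
      by (intro bexI[of _ "Poly_Mapping.single (Poly_Mapping.single j 1) 1"] conjI poly_val_variable
          poly_ring_single) auto
    fix P assume P: "P \<in> poly_ring {..<r}" "poly_val scale b P = b j"
    show "\<exists>\<alpha>\<in>Poly_Mapping.keys P. weight y \<alpha> \<le> y j"
    proof (rule ccontr)
      assume "\<not> ?thesis"
      hence "\<forall>\<alpha>\<in>Poly_Mapping.keys P. y j < weight y \<alpha>" by (simp add: not_le)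
      thus False using y j P variable_in_initial_ideal_iff[of j "{..<r}" b y] by auto
    qed
  qed
  thus "y \<in> K_support scale r b" using y unfolding K_support_def by blast
qed

text \<open>A larger value would put the variable \<open>x\<^sub>j\<close> into the initial ideal.\<close>
lemma Trop_weight_value:
  assumes w: "w \<in> Trop X (relation_ideal scale X g)" and j: "j \<in> X" "g j \<noteq> 0"
    and val: "has_weight_value scale X g w (g j) m"
  shows "m = w j"
proof (rule antisym)
  have "Poly_Mapping.single (Poly_Mapping.single j 1) 1 \<notin> initial_ideal X (relation_ideal scale X g) w"
    using w j(1) by (auto simp: Trop_def)
  hence no: "\<not> (\<exists>P\<in>poly_ring X. poly_val scale g P = g j \<and> (\<forall>\<alpha>\<in>Poly_Mapping.keys P. w j < weight w \<alpha>))"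
    using variable_in_initial_ideal_iff[OF j(1)] by blast
  obtain P where P: "P \<in> poly_ring X" "poly_val scale g P = g j" "\<forall>\<alpha>\<in>Poly_Mapping.keys P. m \<le> weight w \<alpha>"
    using val unfolding has_weight_value_iff[OF j(2)] by blast
  then obtain \<alpha> where "\<alpha> \<in> Poly_Mapping.keys P" "weight w \<alpha> \<le> w j" using no by force
  thus "m \<le> w j" using P(3) by force
  have "Poly_Mapping.single (Poly_Mapping.single j 1) (1 :: 'k) \<in> poly_ring X"
    by (rule poly_ring_single) (use j(1) in simp)
  then obtain \<alpha> where "\<alpha> \<in> Poly_Mapping.keys (Poly_Mapping.single (Poly_Mapping.single j 1) (1 :: 'k))"
    "weight w \<alpha> \<le> m"
    using val poly_val_variable[of g j] unfolding has_weight_value_iff[OF j(2)] by blast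
  thus "w j \<le> m" using weight_variable[of w j] by simp
qed

end

section \<open>Homogeneous presentations in a symmetric algebra\<close>

definition homogeneous_part :: "(('x \<Rightarrow>\<^sub>0 nat) \<Rightarrow>\<^sub>0 'k::comm_ring_1) \<Rightarrow> nat \<Rightarrow> (('x \<Rightarrow>\<^sub>0 nat) \<Rightarrow>\<^sub>0 'k)" where
  "homogeneous_part P m = (\<Sum>\<alpha>\<in>{\<alpha> \<in> Poly_Mapping.keys P. total_degree \<alpha> = m}.
     Poly_Mapping.single \<alpha> (Poly_Mapping.lookup P \<alpha>))"

lemma lookup_homogeneous_part:
  "Poly_Mapping.lookup (homogeneous_part P m) \<alpha> =
     (if total_degree \<alpha> = m then Poly_Mapping.lookup P \<alpha> else 0)"
  unfolding homogeneous_part_def lookup_sum lookup_single when_def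
  by (simp add: sum.delta' if_distrib in_keys_iff cong: if_cong)

lemma keys_homogeneous_part:
  "Poly_Mapping.keys (homogeneous_part P m) = {\<alpha> \<in> Poly_Mapping.keys P. total_degree \<alpha> = m}"
  by (auto simp: in_keys_iff lookup_homogeneous_part split: if_splits)

lemma homogeneous_part_poly_ring: "P \<in> poly_ring X \<Longrightarrow> homogeneous_part P m \<in> poly_ring X"
  by (auto simp: poly_ring_def keys_homogeneous_part)

lemma sum_homogeneous_parts:
  assumes "finite K" "total_degree ` Poly_Mapping.keys P \<subseteq> K"
  shows "P = (\<Sum>m\<in>K. homogeneous_part P m)"
proof (rule poly_mapping_eqI)
  fix \<alpha>
  have "Poly_Mapping.lookup (\<Sum>m\<in>K. homogeneous_part P m) \<alpha> =
      (if total_degree \<alpha> \<in> K then Poly_Mapping.lookup P \<alpha> else 0)"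
    using assms(1) by (simp add: lookup_sum lookup_homogeneous_part)
  thus "Poly_Mapping.lookup P \<alpha> = Poly_Mapping.lookup (\<Sum>m\<in>K. homogeneous_part P m) \<alpha>"
    using assms(2) by (cases "\<alpha> \<in> Poly_Mapping.keys P") (auto simp: in_keys_iff)
qed

sublocale symmetric_algebra \<subseteq> commutative_algebra scale
  by unfold_locales (rule scale_mult)

context commutative_algebra
begin

text \<open>For a basis \<open>U\<close> of the degree-one part, the homogeneous elements of degree \<open>m\<close>, in terms of
  their expansion in monomials of \<open>U\<close>.\<close>
definition homogeneous_values :: "'s set \<Rightarrow> nat \<Rightarrow> 's set" where
  "homogeneous_values U m =
     poly_val scale (\<lambda>u. u) ` {Q \<in> poly_ring U. \<forall>\<alpha>\<in>Poly_Mapping.keys Q. total_degree \<alpha> = m}"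

lemma homogeneous_valuesI:
  "Q \<in> poly_ring U \<Longrightarrow> (\<And>\<alpha>. \<alpha> \<in> Poly_Mapping.keys Q \<Longrightarrow> total_degree \<alpha> = m) \<Longrightarrow>
    poly_val scale (\<lambda>u. u) Q \<in> homogeneous_values U m"
  unfolding homogeneous_values_def by blast

lemma homogeneous_valuesE:
  assumes "x \<in> homogeneous_values U m"
  obtains Q where "Q \<in> poly_ring U" "\<forall>\<alpha>\<in>Poly_Mapping.keys Q. total_degree \<alpha> = m"
    "x = poly_val scale (\<lambda>u. u) Q"
  using assms unfolding homogeneous_values_def by blast

lemma homogeneous_values_mult:
  assumes "x \<in> homogeneous_values U m" "y \<in> homogeneous_values U n"
  shows "x * y \<in> homogeneous_values U (m + n)"
proof -
  obtain P where P: "P \<in> poly_ring U" "\<forall>\<alpha>\<in>Poly_Mapping.keys P. total_degree \<alpha> = m"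
    "x = poly_val scale (\<lambda>u. u) P" using assms(1) by (rule homogeneous_valuesE)
  obtain Q where Q: "Q \<in> poly_ring U" "\<forall>\<alpha>\<in>Poly_Mapping.keys Q. total_degree \<alpha> = n"
    "y = poly_val scale (\<lambda>u. u) Q" using assms(2) by (rule homogeneous_valuesE)
  show ?thesis
    unfolding P(3) Q(3) poly_val_mult[symmetric]
  proof (rule homogeneous_valuesI)
    show "P * Q \<in> poly_ring U" using P(1) Q(1) by (rule poly_ring_mult)
    fix \<alpha> assume "\<alpha> \<in> Poly_Mapping.keys (P * Q)"
    then obtain \<beta> \<gamma> where "\<beta> \<in> Poly_Mapping.keys P" "\<gamma> \<in> Poly_Mapping.keys Q" "\<alpha> = \<beta> + \<gamma>"
      using keys_mult[of P Q] by blast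
    thus "total_degree \<alpha> = m + n" using P(2) Q(2) by (simp add: total_degree_add)
  qed
qed

lemma one_in_homogeneous_values: "1 \<in> homogeneous_values U 0"
proof -
  have "poly_val scale (\<lambda>u. u) (Poly_Mapping.single 0 1) = (1 :: 's)"
    by (simp add: poly_val_single monomial_val_def del: single_one)
  moreover have "poly_val scale (\<lambda>u. u) (Poly_Mapping.single 0 1) \<in> homogeneous_values U 0"
    by (rule homogeneous_valuesI) (auto simp: total_degree_def poly_ring_single simp del: single_one)
  ultimately show ?thesis by simp
qed

lemma subspace_homogeneous_values: "subspace (homogeneous_values U m)"
proof (rule subspaceI)
  show "0 \<in> homogeneous_values U m"
    using homogeneous_valuesI[of 0 U m] by (simp add: poly_ring_0 poly_val_0)
next
  fix x y assume x: "x \<in> homogeneous_values U m" and y: "y \<in> homogeneous_values U m"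
  obtain P where P: "P \<in> poly_ring U" "\<forall>\<alpha>\<in>Poly_Mapping.keys P. total_degree \<alpha> = m"
    "x = poly_val scale (\<lambda>u. u) P" using x by (rule homogeneous_valuesE)
  obtain Q where Q: "Q \<in> poly_ring U" "\<forall>\<alpha>\<in>Poly_Mapping.keys Q. total_degree \<alpha> = m"
    "y = poly_val scale (\<lambda>u. u) Q" using y by (rule homogeneous_valuesE)
  show "x + y \<in> homogeneous_values U m"
    unfolding P(3) Q(3) poly_val_add[symmetric]
    by (rule homogeneous_valuesI) (use P Q keys_add[of P Q] in \<open>auto intro: poly_ring_add\<close>)
next
  fix c x assume x: "x \<in> homogeneous_values U m"
  have "poly_val scale (\<lambda>u. u) (Poly_Mapping.single 0 c) \<in> homogeneous_values U 0"
    by (rule homogeneous_valuesI) (auto simp: total_degree_def poly_ring_single split: if_splits)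
  hence "scale c 1 \<in> homogeneous_values U 0" by (simp add: poly_val_single monomial_val_def)
  from homogeneous_values_mult[OF this x] show "scale c x \<in> homogeneous_values U m"
    using scale_mult[of c 1 x] by simp
qed

lemma span_subset_homogeneous_values: "span U \<subseteq> homogeneous_values U 1"
proof (rule span_minimal[OF _ subspace_homogeneous_values], rule subsetI)
  fix u assume "u \<in> U"
  hence "poly_val scale (\<lambda>u. u) (Poly_Mapping.single (Poly_Mapping.single u 1) 1) \<in> homogeneous_values U 1"
    by (intro homogeneous_valuesI poly_ring_single) (auto simp: total_degree_def)
  thus "u \<in> homogeneous_values U 1" by (simp add: poly_val_variable del: One_nat_def)
qed

lemma prod_list_in_homogeneous_values:
  "set xs \<subseteq> span U \<Longrightarrow> prod_list xs \<in> homogeneous_values U (length xs)"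
proof (induction xs)
  case Nil
  show ?case using one_in_homogeneous_values by simp
next
  case (Cons x xs)
  hence "x \<in> homogeneous_values U 1" using span_subset_homogeneous_values by auto
  from homogeneous_values_mult[OF this Cons.IH] Cons.prems show ?case by simp
qed

lemma sym_power_subset_homogeneous_values: "sym_power scale (span U) m \<subseteq> homogeneous_values U m"
  unfolding sym_power_def
  by (rule span_minimal[OF _ subspace_homogeneous_values])
    (use prod_list_in_homogeneous_values in blast)

lemma monomial_val_in_homogeneous_values:
  assumes "\<And>i. i \<in> Poly_Mapping.keys \<alpha> \<Longrightarrow> g i \<in> span U"
  shows "monomial_val g \<alpha> \<in> homogeneous_values U (total_degree \<alpha>)"
proof -
  have pow: "x ^ n \<in> homogeneous_values U n" if "x \<in> span U" for x n
  proof -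
    have "set (replicate n x) \<subseteq> span U" using that by (simp add: set_replicate_conv_if)
    from prod_list_in_homogeneous_values[OF this] show ?thesis by (simp add: prod_list_replicate)
  qed
  have "(\<Prod>i\<in>S. g i ^ Poly_Mapping.lookup \<alpha> i) \<in>
      homogeneous_values U (\<Sum>i\<in>S. Poly_Mapping.lookup \<alpha> i)"
    if "finite S" "S \<subseteq> Poly_Mapping.keys \<alpha>" for S
    using that
  proof (induction S rule: finite_induct)
    case empty
    show ?case using one_in_homogeneous_values by simp
  next
    case (insert i S)
    thus ?case using homogeneous_values_mult[OF pow[OF assms[of i]],
        where y = "\<Prod>i\<in>S. g i ^ Poly_Mapping.lookup \<alpha> i"] by simp
  qed
  from this[OF finite_keys order_refl] show ?thesis unfolding monomial_val_def total_degree_def .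
qed

text \<open>If the generators have degree one, the value of the part of degree \<open>k\<close> of a presentation is
  homogeneous of degree \<open>k\<close>. The decomposition of the value into homogeneous elements is unique
  because it can be read off from the polynomial in the basis \<open>U\<close>, so for a homogeneous value the
  other parts contribute nothing.\<close>
lemma poly_val_homogeneous_part:
  assumes inj: "inj_on (poly_val scale (\<lambda>u. u)) (poly_ring U :: (('s \<Rightarrow>\<^sub>0 nat) \<Rightarrow>\<^sub>0 'k) set)"
    and g: "\<And>i. i \<in> X \<Longrightarrow> g i \<in> span U"
    and P: "P \<in> poly_ring X" "poly_val scale g P \<in> homogeneous_values U m"
  shows "poly_val scale g (homogeneous_part P m) = poly_val scale g P"
proof -
  let ?ev = "poly_val scale (\<lambda>u. u) :: (('s \<Rightarrow>\<^sub>0 nat) \<Rightarrow>\<^sub>0 'k) \<Rightarrow> 's"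
  have hv: "poly_val scale g (homogeneous_part P k) \<in> homogeneous_values U k" for k
    unfolding poly_val_def
  proof (intro subspace_sum[OF subspace_homogeneous_values] subspace_scale[OF subspace_homogeneous_values])
    fix \<alpha> assume "\<alpha> \<in> Poly_Mapping.keys (homogeneous_part P k)"
    hence "Poly_Mapping.keys \<alpha> \<subseteq> X" "total_degree \<alpha> = k"
      using P(1) by (auto simp: keys_homogeneous_part poly_ring_def)
    thus "monomial_val g \<alpha> \<in> homogeneous_values U k"
      using monomial_val_in_homogeneous_values[of \<alpha> g U] g by auto
  qed
  have "\<exists>Q. Q \<in> poly_ring U \<and> (\<forall>\<alpha>\<in>Poly_Mapping.keys Q. total_degree \<alpha> = k) \<and>
    poly_val scale g (homogeneous_part P k) = ?ev Q" for k
    using homogeneous_valuesE[OF hv[of k]] by metis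
  then obtain Q where Q: "\<And>k. Q k \<in> poly_ring U"
    "\<And>k \<alpha>. \<alpha> \<in> Poly_Mapping.keys (Q k) \<Longrightarrow> total_degree \<alpha> = k"
    "\<And>k. poly_val scale g (homogeneous_part P k) = ?ev (Q k)" by metis
  obtain R where R: "R \<in> poly_ring U" "\<forall>\<alpha>\<in>Poly_Mapping.keys R. total_degree \<alpha> = m"
    "poly_val scale g P = ?ev R" using P(2) by (rule homogeneous_valuesE)
  define K where "K = insert m (total_degree ` Poly_Mapping.keys P)"
  have K: "finite K" "total_degree ` Poly_Mapping.keys P \<subseteq> K" by (auto simp: K_def)
  have "?ev R = poly_val scale g (\<Sum>k\<in>K. homogeneous_part P k)"
    using R(3) sum_homogeneous_parts[OF K] by simp
  also have "\<dots> = ?ev (\<Sum>k\<in>K. Q k)" by (simp add: poly_val_sum Q(3))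
  finally have ev: "?ev R = ?ev (\<Sum>k\<in>K. Q k)" .
  have "(\<Sum>k\<in>K. Q k) \<in> poly_ring U"
    using K(1) by (induction K rule: finite_induct) (auto simp: poly_ring_0 intro: poly_ring_add Q(1))
  hence RQ: "R = (\<Sum>k\<in>K. Q k)" using inj_onD[OF inj ev R(1)] by blast
  have "R = Q m"
  proof (rule poly_mapping_eqI)
    fix \<alpha>
    show "Poly_Mapping.lookup R \<alpha> = Poly_Mapping.lookup (Q m) \<alpha>"
    proof (cases "total_degree \<alpha> = m")
      case True
      have "Poly_Mapping.lookup (Q k) \<alpha> = 0" if "k \<noteq> m" for k
        using Q(2)[of \<alpha> k] that True by (auto simp: in_keys_iff)
      hence "(\<Sum>k\<in>K. Poly_Mapping.lookup (Q k) \<alpha>) = (\<Sum>k\<in>{m}. Poly_Mapping.lookup (Q k) \<alpha>)"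
        using K(1) by (intro sum.mono_neutral_right) (auto simp: K_def)
      thus ?thesis by (simp add: RQ lookup_sum)
    next
      case False
      hence "\<alpha> \<notin> Poly_Mapping.keys R" "\<alpha> \<notin> Poly_Mapping.keys (Q m)" using R(2) Q(2) by blast+
      thus ?thesis by (simp add: in_keys_iff)
    qed
  qed
  thus ?thesis using Q(3)[of m] R(3) by simp
qed

text \<open>If \<open>g\<close> takes values in degree one and \<open>f\<close> is nonzero and homogeneous of degree \<open>m\<close>, the weight
  values of \<open>f\<close> can be read off from these sets. For finite \<open>X\<close> only finitely many
  monomials occur in them, although there may be infinitely many presentations of \<open>f\<close>.\<close>
definition homogeneous_supports :: "'x set \<Rightarrow> ('x \<Rightarrow> 's) \<Rightarrow> nat \<Rightarrow> 's \<Rightarrow> ('x \<Rightarrow>\<^sub>0 nat) set set" where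
  "homogeneous_supports X g m f =
     {Poly_Mapping.keys P | P. P \<in> poly_ring X \<and> poly_val scale g P = f \<and>
        (\<forall>\<alpha>\<in>Poly_Mapping.keys P. total_degree \<alpha> = m)}"

end

context symmetric_algebra
begin

text \<open>Passing from a presentation to its part of degree \<open>m\<close> shrinks the set of monomials and keeps
  the value, so it can only increase the minimal weight.\<close>
lemma has_weight_value_iff_homogeneous_supports:
  assumes g: "\<forall>i\<in>X. g i \<in> E" and f: "f \<noteq> 0" "f \<in> sym_power scale E m"
  shows "has_weight_value scale X g w f a \<longleftrightarrow>
    (\<exists>S\<in>homogeneous_supports X g m f. \<forall>\<alpha>\<in>S. a \<le> weight w \<alpha>) \<and>
    (\<forall>S\<in>homogeneous_supports X g m f. \<exists>\<alpha>\<in>S. weight w \<alpha> \<le> a)"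
proof -
  obtain U where U: "basis_of scale E U" "monomials_form_basis scale U" using free_on_basis by blast
  have span: "span U = E" using U(1) by (simp add: basis_of_def)
  have inj: "inj_on (poly_val scale (\<lambda>u. u)) (poly_ring U :: (('s \<Rightarrow>\<^sub>0 nat) \<Rightarrow>\<^sub>0 'k) set)"
    using U(2) by (auto simp: monomials_form_basis_def bij_betw_def)
  have fU: "f \<in> homogeneous_values U m"
    using f(2) sym_power_subset_homogeneous_values[of U m] by (auto simp: span)
  have part: "Poly_Mapping.keys (homogeneous_part P m) \<in> homogeneous_supports X g m f"
    if P: "P \<in> poly_ring X" "poly_val scale g P = f" for P
  proof -
    have "poly_val scale g (homogeneous_part P m) = f"
      using poly_val_homogeneous_part[OF inj _ P(1), of g m] g fU P(2) by (simp add: span)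
    moreover have "homogeneous_part P m \<in> poly_ring X" using P(1) by (rule homogeneous_part_poly_ring)
    moreover have "\<forall>\<alpha>\<in>Poly_Mapping.keys (homogeneous_part P m). total_degree \<alpha> = m"
      by (simp add: keys_homogeneous_part)
    ultimately show ?thesis unfolding homogeneous_supports_def by blast
  qed
  have sub: "Poly_Mapping.keys (homogeneous_part P m) \<subseteq> Poly_Mapping.keys P" for P :: "('x \<Rightarrow>\<^sub>0 nat) \<Rightarrow>\<^sub>0 'k"
    by (auto simp: keys_homogeneous_part)
  show ?thesis
    unfolding has_weight_value_iff[OF f(1)]
  proof (intro arg_cong2[where f = "(\<and>)"] iffI)
    assume "\<exists>P\<in>poly_ring X. poly_val scale g P = f \<and> (\<forall>\<alpha>\<in>Poly_Mapping.keys P. a \<le> weight w \<alpha>)"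
    thus "\<exists>S\<in>homogeneous_supports X g m f. \<forall>\<alpha>\<in>S. a \<le> weight w \<alpha>" using part sub by blast
  next
    assume "\<exists>S\<in>homogeneous_supports X g m f. \<forall>\<alpha>\<in>S. a \<le> weight w \<alpha>"
    thus "\<exists>P\<in>poly_ring X. poly_val scale g P = f \<and> (\<forall>\<alpha>\<in>Poly_Mapping.keys P. a \<le> weight w \<alpha>)"
      unfolding homogeneous_supports_def by blast
  next
    assume "\<forall>P\<in>poly_ring X. poly_val scale g P = f \<longrightarrow> (\<exists>\<alpha>\<in>Poly_Mapping.keys P. weight w \<alpha> \<le> a)"
    thus "\<forall>S\<in>homogeneous_supports X g m f. \<exists>\<alpha>\<in>S. weight w \<alpha> \<le> a"
      unfolding homogeneous_supports_def by blast
  next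
    assume *: "\<forall>S\<in>homogeneous_supports X g m f. \<exists>\<alpha>\<in>S. weight w \<alpha> \<le> a"
    show "\<forall>P\<in>poly_ring X. poly_val scale g P = f \<longrightarrow> (\<exists>\<alpha>\<in>Poly_Mapping.keys P. weight w \<alpha> \<le> a)"
    proof (intro ballI impI)
      fix P assume "P \<in> poly_ring X" "poly_val scale g P = f"
      thus "\<exists>\<alpha>\<in>Poly_Mapping.keys P. weight w \<alpha> \<le> a" using bspec[OF * part] sub[of P] by blast
    qed
  qed
qed

end

section \<open>Cones of weight values\<close>

definition restrict_weight :: "'i set \<Rightarrow> ('i \<Rightarrow> rat) \<Rightarrow> 'i \<Rightarrow> rat" where
  "restrict_weight X y = (\<lambda>i. if i \<in> X then y i else 0)"

lemma restrict_weight_qspace: "restrict_weight X y \<in> qspace X"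
  by (simp add: restrict_weight_def qspace_def)

lemma weight_restrict: "Poly_Mapping.keys \<alpha> \<subseteq> X \<Longrightarrow> weight (restrict_weight X y) \<alpha> = weight y \<alpha>"
  unfolding weight_def restrict_weight_def by (intro sum.cong) auto

lemma qdot_restrict:
  assumes "finite I" "X \<subseteq> I" "u \<in> qspace X"
  shows "qdot X u (restrict_weight X y) = qdot I u y"
proof -
  have "qdot I u y = (\<Sum>i\<in>X. u i * y i)"
    unfolding qdot_def using assms by (intro sum.mono_neutral_right) (auto simp: qspace_def)
  also have "\<dots> = qdot X u (restrict_weight X y)"
    unfolding qdot_def restrict_weight_def by (intro sum.cong) auto
  finally show ?thesis ..
qed

context symmetric_algebra
begin

text \<open>By \<open>Trop_weight_value\<close> the weight vector that produces \<open>y\<close> is the restriction of \<open>y\<close> to the linear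
  part, which eliminates the existential quantifier in the definition.\<close>
lemma Trop_star_iff:
  assumes nz: "\<forall>j<r. b j \<noteq> 0"
  defines "X \<equiv> linear_part E r b"
  shows "y \<in> Trop_star scale E r b \<longleftrightarrow> y \<in> qspace {..<r} \<and>
    restrict_weight X y \<in> Trop X (relation_ideal scale X b) \<and>
    (\<forall>j<r. has_weight_value scale X b (restrict_weight X y) (b j) (y j))"
proof -
  have eq: "w = restrict_weight X y"
    if w: "w \<in> Trop X (relation_ideal scale X b)" "\<forall>j<r. has_weight_value scale X b w (b j) (y j)" for w
  proof
    fix i
    show "w i = restrict_weight X y i"
    proof (cases "i \<in> X")
      case True
      hence i: "i < r" by (simp add: X_def linear_part_def)
      hence "y i = w i" using Trop_weight_value[OF w(1) True nz[rule_format, OF i]] w(2) by blast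
      thus ?thesis using True by (simp add: restrict_weight_def)
    next
      case False
      thus ?thesis using w(1) by (simp add: restrict_weight_def Trop_def qspace_def)
    qed
  qed
  show ?thesis
    unfolding Trop_star_def X_def[symmetric] using eq by auto
qed

text \<open>The forms in \<open>A1\<close> control the tropical linear space of the linear part. Those in \<open>A2\<close> compare
  the weight of a monomial of degree \<open>m j\<close> in the linear part with the coordinate \<open>y j\<close>; by
  \<open>has_weight_value_iff_homogeneous_supports\<close> they and their negatives control the equation between
  \<open>y j\<close> and the weight value of \<open>b j\<close>. Both extend to forms in all coordinates because the weight on
  the linear part is the restriction of \<open>y\<close>.\<close>
theorem Trop_star_is_union_of_cones:
  assumes b: "homogeneous_generators scale E r b"
  obtains A where "finite A" "A \<subseteq> qspace {..<r}"
    "union_of_halfspace_cones {..<r} A (Trop_star scale E r b)"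
proof -
  define X where "X = linear_part E r b"
  let ?L = "relation_ideal scale X b"
  have X: "finite X" "X \<subseteq> {..<r}" "\<forall>i\<in>X. b i \<in> E"
    by (auto simp: X_def linear_part_def)
  have nz: "\<forall>j<r. b j \<noteq> 0" using b by (simp add: homogeneous_generators_def)
  have "\<forall>j. \<exists>m. j < r \<longrightarrow> b j \<in> sym_power scale E m" using b by (auto simp: homogeneous_generators_def)
  then obtain m where m: "\<And>j. j < r \<Longrightarrow> b j \<in> sym_power scale E (m j)" by metis
  interpret L: polynomial_ideal X ?L by (rule relation_ideal_is_ideal)
  obtain A1 where A1: "finite A1" "A1 \<subseteq> qspace X"
    "\<forall>w w'. (\<forall>u\<in>A1. sgn (qdot X u w) = sgn (qdot X u w')) \<longrightarrow>
      initial_ideal X ?L w = initial_ideal X ?L w'"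
    by (rule initial_ideal_sign_determined[OF relation_ideal_is_ideal X(1)])
  have Trop: "Trop X ?L = {w \<in> qspace X. \<forall>\<gamma>\<in>{\<gamma>. Poly_Mapping.keys \<gamma> \<subseteq> X}.
    Poly_Mapping.single \<gamma> 1 \<notin> initial_ideal X ?L w}" by (auto simp: Trop_def)
  have TropC: "union_of_halfspace_cones X (negation_closure A1) (Trop X ?L)"
    unfolding Trop by (rule L.avoiding_monomials_is_union_of_cones[OF X(1) A1(1,3)]) simp
  define A2 where "A2 = (\<Union>j<r. (\<lambda>\<alpha>. exponent_difference \<alpha> (Poly_Mapping.single j 1)) `
    monomials_upto X (m j))"
  have A2: "finite A2" "A2 \<subseteq> qspace {..<r}"
    using finite_monomials_upto[OF X(1)] X(2)
    by (auto simp: A2_def monomials_upto_def subset_iff intro!: exponent_difference_qspace)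
  define A where "A = negation_closure (A1 \<union> A2)"
  have A1r: "A1 \<subseteq> qspace {..<r}" using A1(2) X(2) by (fastforce simp: qspace_def)
  show ?thesis
  proof (rule that[of A])
    show "finite A" unfolding A_def using A1(1) A2(1) by (intro finite_negation_closure) simp
    show "A \<subseteq> qspace {..<r}" unfolding A_def using A1r A2(2) by (intro negation_closure_qspace) simp
    show "union_of_halfspace_cones {..<r} A (Trop_star scale E r b)"
      unfolding union_of_halfspace_cones_def
    proof (intro conjI ballI impI)
      show "Trop_star scale E r b \<subseteq> qspace {..<r}" by (auto simp: Trop_star_def)
      fix y x assume y: "y \<in> Trop_star scale E r b" and x: "x \<in> qspace {..<r}"
        and yx: "\<forall>u\<in>A. 0 \<le> qdot {..<r} u y \<longrightarrow> 0 \<le> qdot {..<r} u x"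
      note y' = y[unfolded Trop_star_iff[OF nz, folded X_def]]
      have "restrict_weight X x \<in> Trop X ?L"
      proof (rule union_of_halfspace_conesD[OF TropC _ restrict_weight_qspace])
        show "restrict_weight X y \<in> Trop X ?L" using y' by blast
        fix u assume u: "u \<in> negation_closure A1" "0 \<le> qdot X u (restrict_weight X y)"
        have "u \<in> qspace X" using u(1) negation_closure_qspace[OF A1(2)] by blast
        moreover have "u \<in> A" using u(1) negation_closure_mono[of A1 "A1 \<union> A2"] by (auto simp: A_def)
        ultimately show "0 \<le> qdot X u (restrict_weight X x)"
          using u(2) yx qdot_restrict[OF finite_lessThan X(2)] by simp
      qed
      moreover have "has_weight_value scale X b (restrict_weight X x) (b j) (x j)" if j: "j < r" for j
      proof -
        have cmp: "(y j \<le> weight (restrict_weight X y) \<alpha> \<longrightarrow> x j \<le> weight (restrict_weight X x) \<alpha>) \<and>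
          (weight (restrict_weight X y) \<alpha> \<le> y j \<longrightarrow> weight (restrict_weight X x) \<alpha> \<le> x j)"
          if \<alpha>: "Poly_Mapping.keys \<alpha> \<subseteq> X" "total_degree \<alpha> = m j" for \<alpha>
        proof -
          let ?u = "exponent_difference \<alpha> (Poly_Mapping.single j 1)"
          have q: "qdot {..<r} ?u z = weight (restrict_weight X z) \<alpha> - z j" for z
            using qdot_exponent_difference[of "{..<r}" \<alpha> "Poly_Mapping.single j 1" z] \<alpha>(1) X(2) j
              weight_variable[of z j] weight_restrict[OF \<alpha>(1), of z] by auto
          have "?u \<in> A2"
            unfolding A2_def by (rule UN_I[of j], use j in simp, rule imageI)
              (use \<alpha> in \<open>simp add: monomials_upto_def\<close>)
          hence "?u \<in> A" "(\<lambda>i. - ?u i) \<in> A" unfolding A_def negation_closure_def by blast+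
          hence "0 \<le> qdot {..<r} ?u y \<longrightarrow> 0 \<le> qdot {..<r} ?u x"
            "0 \<le> qdot {..<r} (\<lambda>i. - ?u i) y \<longrightarrow> 0 \<le> qdot {..<r} (\<lambda>i. - ?u i) x"
            using yx by blast+
          thus ?thesis unfolding qdot_uminus_left q by simp
        qed
        have S: "Poly_Mapping.keys \<alpha> \<subseteq> X \<and> total_degree \<alpha> = m j"
          if "S \<in> homogeneous_supports X b (m j) (b j)" "\<alpha> \<in> S" for S \<alpha>
          using that by (auto simp: homogeneous_supports_def poly_ring_def)
        note iff = has_weight_value_iff_homogeneous_supports[OF X(3) nz[rule_format, OF j] m[OF j]]
        have "has_weight_value scale X b (restrict_weight X y) (b j) (y j)" using y' j by blast
        thus ?thesis unfolding iff using cmp S by (meson order_refl)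
      qed
      ultimately show "x \<in> Trop_star scale E r b"
        using x unfolding Trop_star_iff[OF nz, folded X_def] by blast
    qed
  qed
qed

text \<open>One finite set of forms determines the initial ideals of the relation ideal, and hence serves
  for the support of \<open>\<K>\<close> and for all cones of the Groebner fan simultaneously.\<close>
theorem apartments_are_unions_of_cones:
  assumes nz: "\<forall>j<r. b j \<noteq> 0"
  obtains A where "finite A" "A \<subseteq> qspace {..<r}"
    "\<forall>C\<in>apartments scale r b. union_of_halfspace_cones {..<r} A C"
proof -
  let ?I = "relation_ideal scale {..<r} b"
  interpret I: polynomial_ideal "{..<r}" ?I by (rule relation_ideal_is_ideal)
  obtain A where A: "finite A" "A \<subseteq> qspace {..<r}"
    "\<forall>w w'. (\<forall>u\<in>A. sgn (qdot {..<r} u w) = sgn (qdot {..<r} u w')) \<longrightarrow>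
      initial_ideal {..<r} ?I w = initial_ideal {..<r} ?I w'"
    by (rule initial_ideal_sign_determined[OF relation_ideal_is_ideal finite_lessThan])
  have K: "union_of_halfspace_cones {..<r} (negation_closure A) (K_support scale r b)"
    unfolding K_support_iff[OF nz]
    by (rule I.avoiding_monomials_is_union_of_cones[OF finite_lessThan A(1,3)]) auto
  show ?thesis
  proof (rule that[of "negation_closure A"]; (intro ballI)?)
    show "finite (negation_closure A)" using A(1) by (rule finite_negation_closure)
    show "negation_closure A \<subseteq> qspace {..<r}" using A(2) by (rule negation_closure_qspace)
    fix C assume "C \<in> apartments scale r b"
    then obtain \<tau> where \<tau>: "\<tau> \<in> Groebner_fan {..<r} ?I" "C = K_support scale r b \<inter> \<tau>"
      by (auto simp: apartments_def maximal_cones_def)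
    have "union_of_halfspace_cones {..<r} (negation_closure A) \<tau>"
      by (rule I.Groebner_cone_is_union_of_cones[OF finite_lessThan A(1,3) \<tau>(1)])
    thus "union_of_halfspace_cones {..<r} (negation_closure A) C"
      using K unfolding \<tau>(2) union_of_halfspace_cones_def by blast
  qed
qed

end

section \<open>Diagrams\<close>

definition row_functional :: "nat \<Rightarrow> (nat \<Rightarrow> rat) \<Rightarrow> nat \<times> nat \<Rightarrow> rat" where
  "row_functional i u = (\<lambda>(k, j). if k = i then u j else 0)"

lemma qdot_row_functional:
  assumes "i < n"
  shows "qdot ({..<n} \<times> {..<r}) (row_functional i u) M = qdot {..<r} u (mat_row M i)"
proof -
  have "qdot ({..<n} \<times> {..<r}) (row_functional i u) M =
      (\<Sum>k<n. \<Sum>j<r. (if k = i then u j else 0) * M (k, j))"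
    by (simp add: qdot_def row_functional_def sum.cartesian_product case_prod_unfold)
  also have "\<dots> = (\<Sum>k<n. if k = i then qdot {..<r} u (mat_row M i) else 0)"
    by (intro sum.cong) (auto simp: qdot_def mat_row_def)
  finally show ?thesis using assms by simp
qed

text \<open>The rows of a diagram are subject to conditions which are all monotone in the signs of the forms
  in \<open>A1 \<union> A2\<close>. Applied to each row, these forms give the finite set \<open>B\<close> of forms on matrices.\<close>
theorem proposition6p12:
  fixes scale :: "'k::alg_closed_field \<Rightarrow> 's::comm_ring_1 \<Rightarrow> 's"
    and E :: "'s set"
    and d n r :: nat
    and \<Sigma> :: "(nat \<Rightarrow> rat) set set"
    and \<rho> :: "nat \<Rightarrow> nat \<Rightarrow> rat"
    and v :: "'s \<Rightarrow> (nat \<Rightarrow> rat) \<Rightarrow> rat"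
    and b :: "nat \<Rightarrow> 's"
  assumes "symmetric_algebra scale E"
    and "smooth_fan d \<Sigma>"
    and "bij_betw \<rho> {..<n} (primitive_ray_generators d \<Sigma>)"
    and "toric_vector_bundle scale E d \<Sigma> v"
    and "homogeneous_generators scale E r b"
    and "Khovanskii_basis scale \<Sigma> v r b"
  shows "\<exists>\<F>. polyhedral_fan ({..<n} \<times> {..<r}) \<F> \<and> \<Union>\<F> = diagrams scale E d \<Sigma> n \<rho> r b"
proof -
  interpret symmetric_algebra scale E by fact
  have nz: "\<forall>j<r. b j \<noteq> 0" using assms(5) by (simp add: homogeneous_generators_def)
  obtain A1 where A1: "finite A1" "A1 \<subseteq> qspace {..<r}"
    "union_of_halfspace_cones {..<r} A1 (Trop_star scale E r b)"
    using Trop_star_is_union_of_cones[OF assms(5)] .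
  obtain A2 where A2: "finite A2" "A2 \<subseteq> qspace {..<r}"
    "\<forall>C\<in>apartments scale r b. union_of_halfspace_cones {..<r} A2 C"
    by (rule apartments_are_unions_of_cones[OF nz])
  define B where "B = (\<lambda>(i, u). row_functional i u) ` ({..<n} \<times> (A1 \<union> A2))"
  have B: "finite B" "B \<subseteq> qspace ({..<n} \<times> {..<r})"
    using A1(1,2) A2(1,2) by (auto simp: B_def row_functional_def qspace_def subset_iff)
  have "union_of_halfspace_cones ({..<n} \<times> {..<r}) B (diagrams scale E d \<Sigma> n \<rho> r b)"
    unfolding union_of_halfspace_cones_def
  proof (intro conjI ballI impI)
    show "diagrams scale E d \<Sigma> n \<rho> r b \<subseteq> qspace ({..<n} \<times> {..<r})" by (auto simp: diagrams_def)
    fix M N assume M: "M \<in> diagrams scale E d \<Sigma> n \<rho> r b" and N: "N \<in> qspace ({..<n} \<times> {..<r})"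
      and MN: "\<forall>u\<in>B. 0 \<le> qdot ({..<n} \<times> {..<r}) u M \<longrightarrow> 0 \<le> qdot ({..<n} \<times> {..<r}) u N"
    have row: "mat_row N i \<in> S"
      if i: "i < n" and S: "union_of_halfspace_cones {..<r} A S" "A \<subseteq> A1 \<union> A2" "mat_row M i \<in> S" for i A S
    proof (rule union_of_halfspace_conesD[OF S(1,3)])
      show "mat_row N i \<in> qspace {..<r}" using N by (simp add: qspace_def mat_row_def)
      fix u assume u: "u \<in> A" "0 \<le> qdot {..<r} u (mat_row M i)"
      have "row_functional i u \<in> B" using i u(1) S(2) by (auto simp: B_def)
      thus "0 \<le> qdot {..<r} u (mat_row N i)"
        using MN u(2) qdot_row_functional[OF i] by (metis (no_types))
    qed
    have "mat_row N i \<in> Trop_star scale E r b" if "i < n" for i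
      using row[OF that A1(3)] M that by (simp add: diagrams_def)
    moreover have "adapted_matrix scale d \<Sigma> n \<rho> r b N"
      unfolding adapted_matrix_def
    proof
      fix \<sigma> assume "\<sigma> \<in> \<Sigma>"
      then obtain C where C: "C \<in> apartments scale r b"
        "\<And>i. i < n \<Longrightarrow> cone_face {..<d} (cone_gen {\<rho> i}) \<sigma> \<Longrightarrow> mat_row M i \<in> C"
        using M unfolding diagrams_def adapted_matrix_def by blast
      show "\<exists>C\<in>apartments scale r b. \<forall>i<n. cone_face {..<d} (cone_gen {\<rho> i}) \<sigma> \<longrightarrow> mat_row N i \<in> C"
        using row[OF _ bspec[OF A2(3) C(1)]] C by (intro bexI[of _ C]) auto
    qed
    ultimately show "N \<in> diagrams scale E d \<Sigma> n \<rho> r b" using N by (simp add: diagrams_def)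
  qed
  thus ?thesis using B by (intro union_of_halfspace_cones_is_fan_support)
qed

end
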